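(* Let $V$ be a finite dimensional complex symplectic vector space with symplectic form $\omega$, and let $G$ be a finite group acting faithfully, linearly and symplectically on $V$, such that the space of $G$-invariant skew-symmetric bilinear forms on $V$ is $\mathbb{C}\omega$. Let $\kappa:\wedge^2V\to\mathbb{C}[G]$ be a linear $G$-equivariant map ($G$ acting on $\mathbb{C}[G]$ by conjugation). Let $H_\kappa$ be the quotient of $\mathbb{C}[G]\ltimes \mathbf{T}(V)$ by the relations $[x,y]=\kappa(x,y)$, $x,y\in V$, equipped with the increasing filtration determined by $\deg(V)=1$, $\deg(G)=0$, and let $\xi:\mathbb{C}G\ltimes SV\to \mathrm{gr}\,H_\kappa$ be the natural surjective homomorphism. Then $\xi$ is an isomorphism if and only if $\kappa$ has the form $$\kappa(x,y)=t\,\omega(x,y)-2\sum_{s\in S}c_s\,\omega_s(x,y)\,s$$ for some $t\in\mathbb{C}$ and some $G$-invariant function $c:S\to\mathbb{C}$, where $S\subset G$ is the set of symplectic reflections.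
   Context: $\mathbf{T}(V)$ and $SV$ denote the tensor and symmetric algebras of $V$; $\mathbb{C}[G]\ltimes\mathbf{T}(V)$ is the semidirect (smash) product. A symplectic reflection in $G$ is an element $s$ such that $s-1$ has rank $2$ on $V$; $S$ is the set of all of them, and $c:S\to\mathbb{C}$ is $G$-invariant if it is invariant under conjugation. For $s\in S$, $\omega_s(x,y)$ is $\omega$ applied to the projections of $x,y$ to the image of $1-s$ along the kernel of $1-s$ (a skew-symmetric form of rank $2$ on $V$). *)

theory Defs
  imports Complex_Main "HOL-Algebra.QuotRing" "HOL-Algebra.Group_Action"
begin

text \<open>
  A complex vector space is a type \<open>'v\<close> with a scalar multiplication
  \<open>scale :: complex \<Rightarrow> 'v \<Rightarrow> 'v\<close> satisfying \<^locale>\<open>vector_space\<close>. A group \<open>G\<close> acts on it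
  through \<open>\<rho> :: 'g \<Rightarrow> 'v \<Rightarrow> 'v\<close>, as in \<^locale>\<open>group_action\<close>.
\<close>

section \<open>Forms and symplectic reflections\<close>

definition bilinear_form :: "(complex \<Rightarrow> 'v::ab_group_add \<Rightarrow> 'v) \<Rightarrow> ('v \<Rightarrow> 'v \<Rightarrow> complex) \<Rightarrow> bool" where
  "bilinear_form scale B \<longleftrightarrow>
     (\<forall>x. Vector_Spaces.linear scale (*) (\<lambda>y. B x y)) \<and>
     (\<forall>y. Vector_Spaces.linear scale (*) (\<lambda>x. B x y))"

definition skew_form :: "(complex \<Rightarrow> 'v::ab_group_add \<Rightarrow> 'v) \<Rightarrow> ('v \<Rightarrow> 'v \<Rightarrow> complex) \<Rightarrow> bool" where
  "skew_form scale B \<longleftrightarrow> bilinear_form scale B \<and> (\<forall>x y. B x y = - B y x)"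

definition symplectic_form :: "(complex \<Rightarrow> 'v::ab_group_add \<Rightarrow> 'v) \<Rightarrow> ('v \<Rightarrow> 'v \<Rightarrow> complex) \<Rightarrow> bool" where
  "symplectic_form scale \<omega> \<longleftrightarrow> skew_form scale \<omega> \<and> (\<forall>x. (\<forall>y. \<omega> x y = 0) \<longrightarrow> x = 0)"

definition invariant_form ::
  "('g, 'm) monoid_scheme \<Rightarrow> ('g \<Rightarrow> 'v \<Rightarrow> 'v) \<Rightarrow> ('v \<Rightarrow> 'v \<Rightarrow> complex) \<Rightarrow> bool" where
  "invariant_form G \<rho> B \<longleftrightarrow> (\<forall>g\<in>carrier G. \<forall>x y. B (\<rho> g x) (\<rho> g y) = B x y)"

definition symplectic_reflections ::
  "(complex \<Rightarrow> 'v::ab_group_add \<Rightarrow> 'v) \<Rightarrow> ('g, 'm) monoid_scheme \<Rightarrow> ('g \<Rightarrow> 'v \<Rightarrow> 'v) \<Rightarrow> 'g set" where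
  "symplectic_reflections scale G \<rho> =
     {s \<in> carrier G. vector_space.dim scale (range (\<lambda>x. \<rho> s x - x)) = 2}"

text \<open>
  The projection to the image of \<open>1 - s\<close> along its kernel; these subspaces are complementary
  because \<open>s\<close> has finite order.
\<close>

definition refl_proj :: "('g \<Rightarrow> 'v::ab_group_add \<Rightarrow> 'v) \<Rightarrow> 'g \<Rightarrow> 'v \<Rightarrow> 'v" where
  "refl_proj \<rho> s x =
     (THE u. u \<in> range (\<lambda>z. z - \<rho> s z) \<and> (\<exists>k. k - \<rho> s k = 0 \<and> x = u + k))"

definition refl_form ::
  "('g \<Rightarrow> 'v::ab_group_add \<Rightarrow> 'v) \<Rightarrow> ('v \<Rightarrow> 'v \<Rightarrow> complex) \<Rightarrow> 'g \<Rightarrow> 'v \<Rightarrow> 'v \<Rightarrow> complex" where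
  "refl_form \<rho> \<omega> s x y = \<omega> (refl_proj \<rho> s x) (refl_proj \<rho> s y)"


section \<open>The group algebra of a finite group\<close>

text \<open>
  An element of \<open>\<complex>[G]\<close> is its coefficient function \<open>'g \<Rightarrow> complex\<close>, vanishing outside the carrier.
\<close>

definition group_elt :: "'g \<Rightarrow> 'g \<Rightarrow> complex" where
  "group_elt g = (\<lambda>h. if h = g then 1 else 0)"

text \<open>
  A \<open>G\<close>-equivariant linear map from the exterior square of \<open>V\<close> to \<open>\<complex>[G]\<close>, given as an alternating
  bilinear map. The coefficient of \<open>h\<close> in \<open>g a g\<inverse>\<close> is that of \<open>g\<inverse> h g\<close> in \<open>a\<close>.
\<close>

definition equivariant_wedge_map ::
  "(complex \<Rightarrow> 'v::ab_group_add \<Rightarrow> 'v) \<Rightarrow> ('g, 'm) monoid_scheme \<Rightarrow> ('g \<Rightarrow> 'v \<Rightarrow> 'v) \<Rightarrow>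
   ('v \<Rightarrow> 'v \<Rightarrow> 'g \<Rightarrow> complex) \<Rightarrow> bool" where
  "equivariant_wedge_map scale G \<rho> \<kappa> \<longleftrightarrow>
     (\<forall>h. bilinear_form scale (\<lambda>x y. \<kappa> x y h)) \<and>
     (\<forall>x. \<forall>h. \<kappa> x x h = 0) \<and>
     (\<forall>x y. \<forall>h. h \<notin> carrier G \<longrightarrow> \<kappa> x y h = 0) \<and>
     (\<forall>g\<in>carrier G. \<forall>x y. \<forall>h\<in>carrier G.
        \<kappa> (\<rho> g x) (\<rho> g y) h = \<kappa> x y (inv\<^bsub>G\<^esub> g \<otimes>\<^bsub>G\<^esub> h \<otimes>\<^bsub>G\<^esub> g))"


section \<open>Tensor and symmetric algebras\<close>

text \<open>
  The free associative \<open>\<complex>\<close>-algebra on the underlying set of \<open>V\<close>: finitely supported functions on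
  words, with the convolution product for concatenation. Imposing linearity of the generators
  gives the tensor algebra.
\<close>

definition word_algebra :: "('v list \<Rightarrow> complex) ring" where
  "word_algebra =
     \<lparr>carrier = {f. finite {w. f w \<noteq> 0}},
      mult = (\<lambda>f g w. \<Sum>i\<le>length w. f (take i w) * g (drop i w)),
      one = (\<lambda>w. if w = [] then 1 else 0),
      zero = (\<lambda>w. 0),
      add = (\<lambda>f g w. f w + g w)\<rparr>"

definition monomial :: "complex \<Rightarrow> 'v list \<Rightarrow> 'v list \<Rightarrow> complex" where
  "monomial a w = (\<lambda>u. if u = w then a else 0)"

definition homogeneous_part :: "nat \<Rightarrow> ('v list \<Rightarrow> complex) \<Rightarrow> 'v list \<Rightarrow> complex" where
  "homogeneous_part n f = (\<lambda>w. if length w = n then f w else 0)"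

definition tensor_ideal :: "(complex \<Rightarrow> 'v::ab_group_add \<Rightarrow> 'v) \<Rightarrow> ('v list \<Rightarrow> complex) set" where
  "tensor_ideal scale = Idl\<^bsub>word_algebra\<^esub>
     ({monomial 1 [x + y] \<ominus>\<^bsub>word_algebra\<^esub> (monomial 1 [x] \<oplus>\<^bsub>word_algebra\<^esub> monomial 1 [y]) | x y. True} \<union>
      {monomial 1 [scale a x] \<ominus>\<^bsub>word_algebra\<^esub> monomial a [x] | a x. True})"

definition tensor_algebra :: "(complex \<Rightarrow> 'v::ab_group_add \<Rightarrow> 'v) \<Rightarrow> ('v list \<Rightarrow> complex) set ring" where
  "tensor_algebra scale = word_algebra Quot tensor_ideal scale"

definition tensor_class ::
  "(complex \<Rightarrow> 'v::ab_group_add \<Rightarrow> 'v) \<Rightarrow> ('v list \<Rightarrow> complex) \<Rightarrow> ('v list \<Rightarrow> complex) set" where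
  "tensor_class scale f = tensor_ideal scale +>\<^bsub>word_algebra\<^esub> f"

text \<open>The sum of the tensor powers of \<open>V\<close> of degree at most \<open>n\<close>.\<close>

definition tensor_upto ::
  "(complex \<Rightarrow> 'v::ab_group_add \<Rightarrow> 'v) \<Rightarrow> nat \<Rightarrow> ('v list \<Rightarrow> complex) set set" where
  "tensor_upto scale n =
     {tensor_class scale f | f. f \<in> carrier word_algebra \<and> (\<forall>w. f w \<noteq> 0 \<longrightarrow> length w \<le> n)}"

definition sym_ideal :: "(complex \<Rightarrow> 'v::ab_group_add \<Rightarrow> 'v) \<Rightarrow> ('v list \<Rightarrow> complex) set set" where
  "sym_ideal scale = Idl\<^bsub>tensor_algebra scale\<^esub>
     {tensor_class scale (monomial 1 [x]) \<otimes>\<^bsub>tensor_algebra scale\<^esub> tensor_class scale (monomial 1 [y])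
      \<ominus>\<^bsub>tensor_algebra scale\<^esub>
      tensor_class scale (monomial 1 [y]) \<otimes>\<^bsub>tensor_algebra scale\<^esub> tensor_class scale (monomial 1 [x])
      | x y. True}"

definition sym_algebra :: "(complex \<Rightarrow> 'v::ab_group_add \<Rightarrow> 'v) \<Rightarrow> ('v list \<Rightarrow> complex) set set ring" where
  "sym_algebra scale = tensor_algebra scale Quot sym_ideal scale"

definition sym_class ::
  "(complex \<Rightarrow> 'v::ab_group_add \<Rightarrow> 'v) \<Rightarrow> ('v list \<Rightarrow> complex) \<Rightarrow> ('v list \<Rightarrow> complex) set set" where
  "sym_class scale f = sym_ideal scale +>\<^bsub>tensor_algebra scale\<^esub> tensor_class scale f"

text \<open>
  The actions of \<open>G\<close> by algebra automorphisms extending the one on \<open>V\<close>; the word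
  \<open>v\<^sub>1 \<dots> v\<^sub>n\<close> goes to \<open>g v\<^sub>1 \<dots> g v\<^sub>n\<close>, and cosets are mapped elementwise.
\<close>

definition word_act ::
  "('g, 'm) monoid_scheme \<Rightarrow> ('g \<Rightarrow> 'v \<Rightarrow> 'v) \<Rightarrow> 'g \<Rightarrow> ('v list \<Rightarrow> complex) \<Rightarrow> 'v list \<Rightarrow> complex" where
  "word_act G \<rho> g f = (\<lambda>w. f (map (\<rho> (inv\<^bsub>G\<^esub> g)) w))"

definition tensor_act ::
  "('g, 'm) monoid_scheme \<Rightarrow> ('g \<Rightarrow> 'v \<Rightarrow> 'v) \<Rightarrow> 'g \<Rightarrow> ('v list \<Rightarrow> complex) set \<Rightarrow> ('v list \<Rightarrow> complex) set" where
  "tensor_act G \<rho> g X = word_act G \<rho> g ` X"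

definition sym_act ::
  "('g, 'm) monoid_scheme \<Rightarrow> ('g \<Rightarrow> 'v \<Rightarrow> 'v) \<Rightarrow> 'g \<Rightarrow> ('v list \<Rightarrow> complex) set set \<Rightarrow> ('v list \<Rightarrow> complex) set set" where
  "sym_act G \<rho> g Y = tensor_act G \<rho> g ` Y"


section \<open>Smash products\<close>

text \<open>
  The smash product of a finite group \<open>G\<close> with a ring \<open>A\<close> on which \<open>G\<close> acts by \<open>\<alpha>\<close>. The function \<open>f\<close>
  stands for the sum of the \<open>f(g) g\<close> over \<open>g \<in> G\<close>, and the product is determined by
  \<open>(a g) (b h) = a (\<alpha> g b) (g h)\<close>, i.e. by \<open>g b g\<inverse> = \<alpha> g b\<close>.
\<close>

definition smash :: "('g, 'm) monoid_scheme \<Rightarrow> ('a, 'r) ring_scheme \<Rightarrow> ('g \<Rightarrow> 'a \<Rightarrow> 'a) \<Rightarrow> ('g \<Rightarrow> 'a) ring" where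
  "smash G A \<alpha> =
     \<lparr>carrier = carrier G \<rightarrow>\<^sub>E carrier A,
      mult = (\<lambda>f h. \<lambda>k\<in>carrier G.
         finsum A (\<lambda>g. f g \<otimes>\<^bsub>A\<^esub> \<alpha> g (h (inv\<^bsub>G\<^esub> g \<otimes>\<^bsub>G\<^esub> k))) (carrier G)),
      one = (\<lambda>k\<in>carrier G. if k = \<one>\<^bsub>G\<^esub> then \<one>\<^bsub>A\<^esub> else \<zero>\<^bsub>A\<^esub>),
      zero = (\<lambda>k\<in>carrier G. \<zero>\<^bsub>A\<^esub>),
      add = (\<lambda>f h. \<lambda>k\<in>carrier G. f k \<oplus>\<^bsub>A\<^esub> h k)\<rparr>"

abbreviation tensor_smash ::
  "(complex \<Rightarrow> 'v::ab_group_add \<Rightarrow> 'v) \<Rightarrow> ('g, 'm) monoid_scheme \<Rightarrow> ('g \<Rightarrow> 'v \<Rightarrow> 'v) \<Rightarrow>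
   ('g \<Rightarrow> ('v list \<Rightarrow> complex) set) ring" where
  "tensor_smash scale G \<rho> \<equiv> smash G (tensor_algebra scale) (tensor_act G \<rho>)"

abbreviation sym_smash ::
  "(complex \<Rightarrow> 'v::ab_group_add \<Rightarrow> 'v) \<Rightarrow> ('g, 'm) monoid_scheme \<Rightarrow> ('g \<Rightarrow> 'v \<Rightarrow> 'v) \<Rightarrow>
   ('g \<Rightarrow> ('v list \<Rightarrow> complex) set set) ring" where
  "sym_smash scale G \<rho> \<equiv> smash G (sym_algebra scale) (sym_act G \<rho>)"

text \<open>The embeddings of \<open>\<complex>[G]\<close> and of \<open>V\<close> into the smash product with the tensor algebra.\<close>

definition group_alg_emb ::
  "(complex \<Rightarrow> 'v::ab_group_add \<Rightarrow> 'v) \<Rightarrow> ('g, 'm) monoid_scheme \<Rightarrow> ('g \<Rightarrow> complex) \<Rightarrow>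
   'g \<Rightarrow> ('v list \<Rightarrow> complex) set" where
  "group_alg_emb scale G a = (\<lambda>g\<in>carrier G. tensor_class scale (monomial (a g) []))"

definition vec_emb ::
  "(complex \<Rightarrow> 'v::ab_group_add \<Rightarrow> 'v) \<Rightarrow> ('g, 'm) monoid_scheme \<Rightarrow> 'v \<Rightarrow>
   'g \<Rightarrow> ('v list \<Rightarrow> complex) set" where
  "vec_emb scale G x =
     (\<lambda>g\<in>carrier G. if g = \<one>\<^bsub>G\<^esub> then tensor_class scale (monomial 1 [x]) else \<zero>\<^bsub>tensor_algebra scale\<^esub>)"


section \<open>The algebra $H_\kappa$ and its filtration\<close>

definition kappa_ideal ::
  "(complex \<Rightarrow> 'v::ab_group_add \<Rightarrow> 'v) \<Rightarrow> ('g, 'm) monoid_scheme \<Rightarrow> ('g \<Rightarrow> 'v \<Rightarrow> 'v) \<Rightarrow>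
   ('v \<Rightarrow> 'v \<Rightarrow> 'g \<Rightarrow> complex) \<Rightarrow> ('g \<Rightarrow> ('v list \<Rightarrow> complex) set) set" where
  "kappa_ideal scale G \<rho> \<kappa> =
     (let A = tensor_smash scale G \<rho>; \<iota> = vec_emb scale G in
      Idl\<^bsub>A\<^esub> {(\<iota> x \<otimes>\<^bsub>A\<^esub> \<iota> y \<ominus>\<^bsub>A\<^esub> \<iota> y \<otimes>\<^bsub>A\<^esub> \<iota> x) \<ominus>\<^bsub>A\<^esub> group_alg_emb scale G (\<kappa> x y) | x y. True})"

definition kappa_algebra ::
  "(complex \<Rightarrow> 'v::ab_group_add \<Rightarrow> 'v) \<Rightarrow> ('g, 'm) monoid_scheme \<Rightarrow> ('g \<Rightarrow> 'v \<Rightarrow> 'v) \<Rightarrow>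
   ('v \<Rightarrow> 'v \<Rightarrow> 'g \<Rightarrow> complex) \<Rightarrow> ('g \<Rightarrow> ('v list \<Rightarrow> complex) set) set ring" where
  "kappa_algebra scale G \<rho> \<kappa> = tensor_smash scale G \<rho> Quot kappa_ideal scale G \<rho> \<kappa>"

definition kappa_class ::
  "(complex \<Rightarrow> 'v::ab_group_add \<Rightarrow> 'v) \<Rightarrow> ('g, 'm) monoid_scheme \<Rightarrow> ('g \<Rightarrow> 'v \<Rightarrow> 'v) \<Rightarrow>
   ('v \<Rightarrow> 'v \<Rightarrow> 'g \<Rightarrow> complex) \<Rightarrow>
   ('g \<Rightarrow> ('v list \<Rightarrow> complex) set) \<Rightarrow> ('g \<Rightarrow> ('v list \<Rightarrow> complex) set) set" where
  "kappa_class scale G \<rho> \<kappa> f = kappa_ideal scale G \<rho> \<kappa> +>\<^bsub>tensor_smash scale G \<rho>\<^esub> f"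

text \<open>
  The \<open>n\<close>-th step is spanned by the products of elements of \<open>V\<close> and \<open>G\<close> having at most \<open>n\<close> factors
  from \<open>V\<close>; moving the group elements to the right, this is the image of the elements whose
  coefficients have tensor degree at most \<open>n\<close>.
\<close>

definition kappa_filtration ::
  "(complex \<Rightarrow> 'v::ab_group_add \<Rightarrow> 'v) \<Rightarrow> ('g, 'm) monoid_scheme \<Rightarrow> ('g \<Rightarrow> 'v \<Rightarrow> 'v) \<Rightarrow>
   ('v \<Rightarrow> 'v \<Rightarrow> 'g \<Rightarrow> complex) \<Rightarrow> nat \<Rightarrow> ('g \<Rightarrow> ('v list \<Rightarrow> complex) set) set set" where
  "kappa_filtration scale G \<rho> \<kappa> n =
     kappa_class scale G \<rho> \<kappa> ` (carrier G \<rightarrow>\<^sub>E tensor_upto scale n)"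


section \<open>Associated graded rings\<close>

text \<open>
  For an increasing filtration \<open>F\<close> of a ring \<open>R\<close>, \<open>filt_below R F n\<close> is \<open>F (n - 1)\<close>, with
  \<open>F (- 1) = 0\<close>. An element of the associated graded ring is a finitely supported family of
  cosets \<open>u n \<in> F n / F (n - 1)\<close>; products are formed on representatives, as in
  \<^const>\<open>rcoset_mult\<close>.
\<close>

definition filt_below :: "('a, 'r) ring_scheme \<Rightarrow> (nat \<Rightarrow> 'a set) \<Rightarrow> nat \<Rightarrow> 'a set" where
  "filt_below R F n = (case n of 0 \<Rightarrow> {\<zero>\<^bsub>R\<^esub>} | Suc m \<Rightarrow> F m)"

definition assoc_graded :: "('a, 'r) ring_scheme \<Rightarrow> (nat \<Rightarrow> 'a set) \<Rightarrow> (nat \<Rightarrow> 'a set) ring" where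
  "assoc_graded R F =
     \<lparr>carrier = {u. (\<forall>n. \<exists>x\<in>F n. u n = filt_below R F n +>\<^bsub>R\<^esub> x) \<and>
                    finite {n. u n \<noteq> filt_below R F n}},
      mult = (\<lambda>u v n. \<Union>x\<in>{x. \<forall>i. x i \<in> u i}. \<Union>y\<in>{y. \<forall>i. y i \<in> v i}.
         filt_below R F n +>\<^bsub>R\<^esub> finsum R (\<lambda>i. x i \<otimes>\<^bsub>R\<^esub> y (n - i)) {..n}),
      one = (\<lambda>n. filt_below R F n +>\<^bsub>R\<^esub> (if n = 0 then \<one>\<^bsub>R\<^esub> else \<zero>\<^bsub>R\<^esub>)),
      zero = (\<lambda>n. filt_below R F n),
      add = (\<lambda>u v n. u n <+>\<^bsub>R\<^esub> v n)\<rparr>"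

abbreviation gr_kappa ::
  "(complex \<Rightarrow> 'v::ab_group_add \<Rightarrow> 'v) \<Rightarrow> ('g, 'm) monoid_scheme \<Rightarrow> ('g \<Rightarrow> 'v \<Rightarrow> 'v) \<Rightarrow>
   ('v \<Rightarrow> 'v \<Rightarrow> 'g \<Rightarrow> complex) \<Rightarrow> (nat \<Rightarrow> ('g \<Rightarrow> ('v list \<Rightarrow> complex) set) set set) ring" where
  "gr_kappa scale G \<rho> \<kappa> \<equiv>
     assoc_graded (kappa_algebra scale G \<rho> \<kappa>) (kappa_filtration scale G \<rho> \<kappa>)"

text \<open>
  The natural homomorphism sends \<open>v\<^sub>1 \<dots> v\<^sub>n g\<close> to the class of \<open>v\<^sub>1 \<dots> v\<^sub>n g\<close> in \<open>F n / F (n - 1)\<close>,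
  so in degree \<open>n\<close> its value at \<open>u\<close> is the class of the degree \<open>n\<close> part of any lift \<open>\<phi>\<close> of \<open>u\<close>
  to the words. All lifts give the same class, so the union is a union of equal cosets.
\<close>

definition natural_hom ::
  "(complex \<Rightarrow> 'v::ab_group_add \<Rightarrow> 'v) \<Rightarrow> ('g, 'm) monoid_scheme \<Rightarrow> ('g \<Rightarrow> 'v \<Rightarrow> 'v) \<Rightarrow>
   ('v \<Rightarrow> 'v \<Rightarrow> 'g \<Rightarrow> complex) \<Rightarrow> ('g \<Rightarrow> ('v list \<Rightarrow> complex) set set) \<Rightarrow>
   nat \<Rightarrow> ('g \<Rightarrow> ('v list \<Rightarrow> complex) set) set set" where
  "natural_hom scale G \<rho> \<kappa> u n =
     (\<Union>\<phi>\<in>{\<phi> \<in> carrier G \<rightarrow> carrier word_algebra. u = (\<lambda>g\<in>carrier G. sym_class scale (\<phi> g))}.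
        filt_below (kappa_algebra scale G \<rho> \<kappa>) (kappa_filtration scale G \<rho> \<kappa>) n
          +>\<^bsub>kappa_algebra scale G \<rho> \<kappa>\<^esub>
        kappa_class scale G \<rho> \<kappa> (\<lambda>g\<in>carrier G. tensor_class scale (homogeneous_part n (\<phi> g))))"

end

theory Submission
  imports Defs "HOL-Algebra.Multiplicative_Group" "HOL-Library.Function_Algebras"
begin

text \<open>
  Both sides are equivalent to the Jacobi identity
  \<open>\<kappa>\<^sub>h(x, y) (h z - z) + \<kappa>\<^sub>h(y, z) (h x - x) + \<kappa>\<^sub>h(z, x) (h y - y) = 0\<close> for all \<open>h \<in> G\<close>.

  If \<open>h \<noteq> 1\<close> and \<open>\<kappa>\<^sub>h(x, y) \<noteq> 0\<close>, the identity shows that \<open>h x - x\<close> and \<open>h y - y\<close> form a basis of the image of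
  \<open>h - 1\<close> and that \<open>\<kappa>\<^sub>h\<close> vanishes on the kernel of \<open>h - 1\<close>, so \<open>h\<close> is a symplectic reflection and \<open>\<kappa>\<^sub>h\<close> is a
  multiple of \<open>\<omega>\<^sub>h\<close>; and \<open>\<kappa>\<^sub>1\<close> is an invariant form. Conversely, an alternating trilinear expression on
  a two-dimensional space vanishes.

  The Jacobi identity for the commutator holds in \<open>H\<^sub>\<kappa>\<close>, and injectivity of \<open>\<xi>\<close> in degree one turns it
  into the identity above. For the converse, a symmetric multilinear functional on the words of
  length \<open>n\<close> is extended step by step to a functional on all longer words which respects the relations
  of \<open>H\<^sub>\<kappa>\<close> and vanishes on shorter words. The values on \<open>u x y v - u y x v\<close> are prescribed by the values on
  shorter words; the Jacobi identity makes them compatible with the braid relation, and averaging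
  over the symmetric group yields a functional with these values. Such functionals separate the
  elements of the symmetric algebra, so \<open>\<xi>\<close> is injective.
\<close>

section \<open>Functionals with prescribed values on commutators\<close>

text \<open>SV, \<open>H\<close> and its graded ring are iterated quotients whose kernels have no
  explicit description, so injectivity of \<xi> is proved dually: a functional on words descends to
  a quotient once it kills the generators inside every two-sided context. No basis of V and no
  normal form of words is chosen. Words, unlike tensors, allow a functional to be defined letter by
  letter; multilinearity is checked afterwards.

  Prescribed values for adjacent swaps are consistent when the Coxeter relations hold. Repeating a
  swap is the skewness of \<kappa>. Two distant swaps are the delicate case: the group element
  produced by the left swap acts on the letters of the right one, and equivariance of \<kappa>
  compensates this, together with the relations already known for shorter words. Only the braid
  relation imposes a new condition. The averages divide by the length of the word, which is one
  place where characteristic zero enters.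

  In the other direction a single degree suffices, since the Jacobi identity takes its values in
  V.\<close>

text \<open>
  Think of \<open>d u x y v\<close> as a prescribed value for \<open>u x y v - u y x v\<close>. Then \<open>to_front d p u a v\<close> is the
  resulting value for \<open>p u a v - p a u v\<close>, and \<open>avg_sort d n p w\<close>, with \<open>n\<close> the length of \<open>w\<close>, is the
  average over the \<open>n!\<close> ways to move the letters of \<open>w\<close> to the front one after the other. Averaging
  trivializes the cocycle that \<open>d\<close> defines on the symmetric group, without the need to show that it
  is well defined.
\<close>

primrec to_front :: "('v list \<Rightarrow> 'v \<Rightarrow> 'v \<Rightarrow> 'v list \<Rightarrow> complex) \<Rightarrow> 'v list \<Rightarrow> 'v list \<Rightarrow> 'v \<Rightarrow> 'v list \<Rightarrow> complex" where
  "to_front d p [] a v = 0"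
| "to_front d p (b # u) a v = to_front d (p @ [b]) u a v + d p b a (u @ v)"

primrec splits_sum :: "('v list \<Rightarrow> 'v \<Rightarrow> 'v list \<Rightarrow> complex) \<Rightarrow> 'v list \<Rightarrow> 'v list \<Rightarrow> complex" where
  "splits_sum f u [] = 0"
| "splits_sum f u (a # w) = f u a w + splits_sum f (u @ [a]) w"

primrec avg_sort :: "('v list \<Rightarrow> 'v \<Rightarrow> 'v \<Rightarrow> 'v list \<Rightarrow> complex) \<Rightarrow> nat \<Rightarrow> 'v list \<Rightarrow> 'v list \<Rightarrow> complex" where
  "avg_sort d 0 p w = 0"
| "avg_sort d (Suc n) p w =
     splits_sum (\<lambda>u a v. to_front d p u a v + avg_sort d n (p @ [a]) (u @ v)) [] w / of_nat (Suc n)"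

lemma splits_sum_append:
  "splits_sum f r (u @ w) = splits_sum (\<lambda>r' a v. f r' a (v @ w)) r u + splits_sum f (r @ u) w"
  by (induction u arbitrary: r) auto

text \<open>The prefixes \<open>r\<close> and \<open>r'\<close> may differ: this serves to compare
  the letters of \<open>v\<close> behind \<open>u x y\<close> with the same letters behind
  \<open>u y x\<close>.\<close>

lemma splits_sum_diff:
  assumes "\<And>v1 b v2. w = v1 @ b # v2 \<Longrightarrow> f (r @ v1) b v2 - f' (r' @ v1) b v2 = D"
  shows "splits_sum f r w - splits_sum f' r' w = of_nat (length w) * D"
  using assms
proof (induction w arbitrary: r r')
  case (Cons a w)
  have "splits_sum f (r @ [a]) w - splits_sum f' (r' @ [a]) w = of_nat (length w) * D"
  proof (rule Cons.IH)
    fix v1 b v2 assume "w = v1 @ b # v2"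
    then show "f ((r @ [a]) @ v1) b v2 - f' ((r' @ [a]) @ v1) b v2 = D"
      using Cons.prems[of "a # v1" b v2] by simp
  qed
  with Cons.prems[of "[]" a w] show ?case
    by (simp add: algebra_simps)
qed simp

lemma to_front_append:
  "to_front d p (u @ w) a v = to_front d (p @ u) w a v + to_front d p u a (w @ v)"
  by (induction u arbitrary: p) auto

lemma diff_add_diff:
  fixes a b c e :: "'a::ab_group_add"
  assumes "a - b = k" "c - e = l"
  shows "c + a - (e + b) = k + l"
  using assms by (simp add: algebra_simps)

text \<open>The three assumptions are the Coxeter relations for adjacent swaps: a swap is undone by
  repeating it, disjoint swaps commute, and the two reduced ways from \<open>x y z\<close> to
  \<open>z y x\<close> have the same total.\<close>

context
  fixes d :: "'v list \<Rightarrow> 'v \<Rightarrow> 'v \<Rightarrow> 'v list \<Rightarrow> complex"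
  assumes skew: "\<And>u x y v. d u x y v = - d u y x v"
    and far: "\<And>u a b q x y v. d u a b (q @ x # y # v) - d u a b (q @ y # x # v)
                = d (u @ a # b # q) x y v - d (u @ b # a # q) x y v"
    and braid: "\<And>u x y z v. d u x y (z # v) + d (u @ [y]) x z v + d u y z (x # v)
                = d (u @ [x]) y z v + d u x z (y # v) + d (u @ [z]) x y v"
begin

text \<open>Bringing \<open>a\<close> to the front and swapping \<open>x y\<close> act on disjoint
  places, so both orders lead from \<open>p u a r x y v\<close> to \<open>p a u r y x v\<close>; the
  identity compares the two totals.\<close>

lemma to_front_swap_right:
  "to_front d p u a (r @ x # y # v) - to_front d p u a (r @ y # x # v)
     = d (p @ u @ a # r) x y v - d (p @ a # u @ r) x y v"
proof (induction u arbitrary: p)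
  case (Cons b u)
  have "d p b a (u @ r @ x # y # v) - d p b a (u @ r @ y # x # v)
     = d (p @ b # a # u @ r) x y v - d (p @ a # b # u @ r) x y v"
    using far[of p b a "u @ r" x y v] by simp
  moreover have "to_front d (p @ [b]) u a (r @ x # y # v) - to_front d (p @ [b]) u a (r @ y # x # v)
     = d (p @ b # u @ a # r) x y v - d (p @ b # a # u @ r) x y v"
    using Cons[of "p @ [b]"] by simp
  ultimately show ?case
    unfolding to_front.simps append_Cons append_assoc by (simp add: diff_add_diff)
qed simp

text \<open>The same commutation, with the swapped pair to the left of all letters crossed by
  \<open>a\<close>.\<close>

lemma to_front_swap_left:
  "to_front d (p @ x # y # r) u a v - to_front d (p @ y # x # r) u a v
     = d p x y (r @ u @ a # v) - d p x y (r @ a # u @ v)"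
proof (induction u arbitrary: r)
  case (Cons b u)
  have "d (p @ x # y # r) b a (u @ v) - d (p @ y # x # r) b a (u @ v)
     = d p x y (r @ b # a # u @ v) - d p x y (r @ a # b # u @ v)"
    using far[of p x y r b a "u @ v"] by simp
  moreover have "to_front d (p @ x # y # r @ [b]) u a v - to_front d (p @ y # x # r @ [b]) u a v
     = d p x y (r @ b # u @ a # v) - d p x y (r @ b # a # u @ v)"
    using Cons[of "r @ [b]"] by simp
  ultimately show ?case
    unfolding to_front.simps append_Cons append_assoc by (simp add: diff_add_diff)
qed simp

text \<open>The choices of the first letter, suitably matched between the two words, each contribute
  the same amount \<open>d (p @ u) x y v\<close>, and so does their average.\<close>

lemma avg_sort_swap:
  assumes "n = length u + length v + 2"
  shows "avg_sort d n p (u @ x # y # v) - avg_sort d n p (u @ y # x # v) = d (p @ u) x y v"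
  using assms
proof (induction n arbitrary: p u v)
  case (Suc n)
  let ?f = "\<lambda>u a v. to_front d p u a v + avg_sort d n (p @ [a]) (u @ v)"
  let ?D = "d (p @ u) x y v"
  \<comment> \<open>The chosen letter stands left of the pair: crossing letters of \<open>u\<close>
    commutes with the swap, and the induction hypothesis gives the swap behind the longer
    prefix.\<close>
  have 1: "splits_sum (\<lambda>u a w. ?f u a (w @ x # y # v)) [] u
         - splits_sum (\<lambda>u a w. ?f u a (w @ y # x # v)) [] u = of_nat (length u) * ?D"
  proof (rule splits_sum_diff)
    fix v1 b v2 assume u: "u = v1 @ b # v2"
    have "avg_sort d n (p @ [b]) ((v1 @ v2) @ x # y # v) - avg_sort d n (p @ [b]) ((v1 @ v2) @ y # x # v)
        = d ((p @ [b]) @ v1 @ v2) x y v"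
      by (rule Suc.IH) (use Suc.prems u in simp)
    with to_front_swap_right[of p v1 b v2 x y v] u
    show "?f ([] @ v1) b (v2 @ x # y # v) - ?f ([] @ v1) b (v2 @ y # x # v) = ?D"
      by (simp add: algebra_simps)
  qed
  \<comment> \<open>The chosen letter \<open>b\<close> stands right of the pair and has to cross
    both \<open>x\<close> and \<open>y\<close>; the braid relation \<open>f\<close> trades the
    crossings before the swap for those after it.\<close>
  have 2: "splits_sum ?f (u @ [x, y]) v - splits_sum ?f (u @ [y, x]) v = of_nat (length v) * ?D"
  proof (rule splits_sum_diff)
    fix v1 b v2 assume v: "v = v1 @ b # v2"
    have a: "avg_sort d n (p @ [b]) (u @ x # y # v1 @ v2) - avg_sort d n (p @ [b]) (u @ y # x # v1 @ v2)
        = d (p @ b # u) x y (v1 @ v2)"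
      using Suc.IH[of u "v1 @ v2" "p @ [b]"] Suc.prems v by simp
    have b: "to_front d p u b (x # y # v1 @ v2) - to_front d p u b (y # x # v1 @ v2)
       = d (p @ u @ [b]) x y (v1 @ v2) - d (p @ b # u) x y (v1 @ v2)"
      using to_front_swap_right[of p u b "[]" x y "v1 @ v2"] by simp
    have c: "to_front d (p @ u @ [x, y]) v1 b v2 - to_front d (p @ u @ [y, x]) v1 b v2
       = d (p @ u) x y (v1 @ b # v2) - d (p @ u) x y (b # v1 @ v2)"
      using to_front_swap_left[of "p @ u" x y "[]" v1 b v2] by simp
    \<comment> \<open>The way of \<open>b\<close> to the front leads across \<open>v1\<close>, then
      across the pair, then across \<open>u\<close>.\<close>
    have e: "to_front d p (u @ x # y # v1) b v2 = to_front d (p @ u @ [x, y]) v1 b v2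
         + d (p @ u @ [x]) y b (v1 @ v2) + d (p @ u) x b (y # v1 @ v2)
         + to_front d p u b (x # y # v1 @ v2)" for x y
      using to_front_append[of d p u "x # y # v1" b v2] by simp
    have f: "d (p @ u) x y (b # v1 @ v2) + d (p @ u @ [y]) x b (v1 @ v2) + d (p @ u) y b (x # v1 @ v2)
       = d (p @ u @ [x]) y b (v1 @ v2) + d (p @ u) x b (y # v1 @ v2) + d (p @ u @ [b]) x y (v1 @ v2)"
      using braid[of "p @ u" x y b "v1 @ v2"] by simp
    have "?f (u @ x # y # v1) b v2 - ?f (u @ y # x # v1) b v2 = d (p @ u) x y (v1 @ b # v2)"
    proof -
      have "C1 + e1 + e2 + B1 + A1 - (C2 + g1 + g2 + B2 + A2) = h"
        if "A1 - A2 = q" "B1 - B2 = l - q" "C1 - C2 = h - i" "i = e1 + e2 + l - g1 - g2"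
        for A1 A2 B1 B2 C1 C2 e1 e2 g1 g2 h i l q :: complex
        using that by (simp add: diff_eq_eq)
      note aux = this
      show ?thesis
        unfolding e append_assoc append_Cons append_Nil
        by (rule aux[OF a b c]) (use f in \<open>simp add: algebra_simps\<close>)
    qed
    then show "?f ((u @ [x, y]) @ v1) b v2 - ?f ((u @ [y, x]) @ v1) b v2 = ?D"
      using v by simp
  qed
  \<comment> \<open>When \<open>x\<close> itself is chosen, it crosses \<open>y\<close> in only one
    of the two words, and likewise for \<open>y\<close>; the averages over the remaining letters
    agree because the same word is left.\<close>
  have 3: "?f u x (y # v) - ?f (u @ [y]) x v = ?D" "?f (u @ [x]) y v - ?f u y (x # v) = ?D"
    using skew[of "p @ u" x y v] by (simp_all add: to_front_append)
  have len: "of_nat (Suc n) * ?D = of_nat (length u) * ?D + ?D + ?D + of_nat (length v) * ?D"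
    using Suc.prems by (simp add: algebra_simps)
  have "splits_sum ?f [] (u @ x # y # v) - splits_sum ?f [] (u @ y # x # v)
     = (splits_sum (\<lambda>u a w. ?f u a (w @ x # y # v)) [] u
         - splits_sum (\<lambda>u a w. ?f u a (w @ y # x # v)) [] u)
      + (?f u x (y # v) - ?f (u @ [y]) x v) + (?f (u @ [x]) y v - ?f u y (x # v))
      + (splits_sum ?f (u @ [x, y]) v - splits_sum ?f (u @ [y, x]) v)"
    unfolding splits_sum_append by simp
  also have "\<dots> = of_nat (Suc n) * ?D"
    unfolding 1 2 3 len ..
  finally show ?case
    by (simp add: diff_divide_distrib[symmetric] del: of_nat_Suc)
qed simp

end

section \<open>Multilinearity of the averaged functional\<close>

definition lin_fun :: "(complex \<Rightarrow> 'v::ab_group_add \<Rightarrow> 'v) \<Rightarrow> ('v \<Rightarrow> complex) \<Rightarrow> bool" where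
  "lin_fun scale f \<longleftrightarrow> (\<forall>x y. f (x + y) = f x + f y) \<and> (\<forall>a x. f (scale a x) = a * f x)"

text \<open>These are the functions on words that induce linear functionals on the tensor algebra.
  \<open>lin_fun\<close> leaves out the vector space axioms, so that its closure rules hold for any
  \<open>scale\<close>.\<close>

definition multilin :: "(complex \<Rightarrow> 'v::ab_group_add \<Rightarrow> 'v) \<Rightarrow> ('v list \<Rightarrow> complex) \<Rightarrow> bool" where
  "multilin scale \<Phi> \<longleftrightarrow> (\<forall>u v. lin_fun scale (\<lambda>z. \<Phi> (u @ z # v)))"

lemma lin_fun_0: "lin_fun scale (\<lambda>z. 0)"
  and lin_fun_add: "lin_fun scale f \<Longrightarrow> lin_fun scale g \<Longrightarrow> lin_fun scale (\<lambda>z. f z + g z)"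
  and lin_fun_divide: "lin_fun scale f \<Longrightarrow> lin_fun scale (\<lambda>z. f z / c)"
  and lin_fun_cmult: "lin_fun scale f \<Longrightarrow> lin_fun scale (\<lambda>z. c * f z)"
  and lin_fun_multc: "lin_fun scale f \<Longrightarrow> lin_fun scale (\<lambda>z. f z * c)"
  unfolding lin_fun_def by (auto simp: algebra_simps add_divide_distrib)

lemma lin_fun_sum: "(\<And>i. i \<in> I \<Longrightarrow> lin_fun scale (f i)) \<Longrightarrow> lin_fun scale (\<lambda>z. \<Sum>i\<in>I. f i z)"
  by (induction I rule: infinite_finite_induct) (auto intro: lin_fun_0 lin_fun_add)

lemma lin_fun_if:
  "(c \<Longrightarrow> lin_fun scale f) \<Longrightarrow> (\<not> c \<Longrightarrow> lin_fun scale g) \<Longrightarrow> lin_fun scale (\<lambda>z. if c then f z else g z)"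
  by (cases c) auto

lemma lin_fun_splits_sum:
  assumes "\<And>u a v. lin_fun scale (\<lambda>z. f z u a v)"
  shows "lin_fun scale (\<lambda>z. splits_sum (f z) u w)"
  by (induction w arbitrary: u) (auto intro!: lin_fun_0 lin_fun_add assms)

text \<open>The varied letter \<open>z\<close> occurs in the prefix, as the chosen letter, or in the
  suffix of a splitting, whence three hypotheses.\<close>

lemma lin_fun_splits_sum_word:
  assumes "\<And>u u' a v. lin_fun scale (\<lambda>z. f (u @ z # u') a v)"
    and "\<And>u v. lin_fun scale (\<lambda>z. f u z v)"
    and "\<And>u a v v'. lin_fun scale (\<lambda>z. f u a (v @ z # v'))"
  shows "lin_fun scale (\<lambda>z. splits_sum f r (u @ z # v))"
proof -
  have "lin_fun scale (\<lambda>z. splits_sum f (r @ u @ z # u') v)" for u'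
  proof (induction v arbitrary: u')
    case (Cons a v)
    show ?case
      using assms(1)[of "r @ u" u' a v] Cons[of "u' @ [a]"] by (auto intro!: lin_fun_add)
  qed (simp add: lin_fun_0)
  from this[of "[]"] show ?thesis
    unfolding splits_sum_append by (auto intro!: lin_fun_add lin_fun_splits_sum assms)
qed

context
  fixes d :: "'v::ab_group_add list \<Rightarrow> 'v \<Rightarrow> 'v \<Rightarrow> 'v list \<Rightarrow> complex"
    and scale :: "complex \<Rightarrow> 'v \<Rightarrow> 'v"
  assumes l1: "\<And>u u' x y v. lin_fun scale (\<lambda>z. d (u @ z # u') x y v)"
    and l2: "\<And>u y v. lin_fun scale (\<lambda>z. d u z y v)"
    and l3: "\<And>u x v. lin_fun scale (\<lambda>z. d u x z v)"
    and l4: "\<And>u x y v v'. lin_fun scale (\<lambda>z. d u x y (v @ z # v'))"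
begin

lemma lin_to_front1: "lin_fun scale (\<lambda>z. to_front d (p @ z # p') u a v)"
  by (induction u arbitrary: p') (auto intro!: lin_fun_0 lin_fun_add l1)

lemma lin_to_front4: "lin_fun scale (\<lambda>z. to_front d p u a (v @ z # v'))"
proof (induction u arbitrary: p)
  case (Cons b u)
  show ?case using l4[of p b a "u @ v" v'] by (auto intro!: lin_fun_add Cons)
qed (simp add: lin_fun_0)

lemma lin_to_front3: "lin_fun scale (\<lambda>z. to_front d p u z v)"
  by (induction u arbitrary: p) (auto intro!: lin_fun_0 lin_fun_add l3)

lemma lin_to_front2: "lin_fun scale (\<lambda>z. to_front d p (u @ z # u') a v)"
  unfolding to_front_append
  using lin_to_front4[of p u a "[]" "u' @ v"] lin_to_front1[of "p @ u" "[]" u' a v]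
  by (auto intro!: lin_fun_add l2)

lemma lin_avg_sort:
  "lin_fun scale (\<lambda>z. avg_sort d n (p @ z # p') w)"
  "lin_fun scale (\<lambda>z. avg_sort d n p (u @ z # v))"
proof (induction n arbitrary: p p' w u v)
  case (Suc n)
  {
    case 1
    have "lin_fun scale (\<lambda>z. avg_sort d n (p @ z # p' @ [a]) w)" for a w
      using Suc.IH(1) by simp
    then show ?case
      by (auto intro!: lin_fun_divide lin_fun_splits_sum lin_fun_add lin_to_front1)
  next
    case 2
    have "lin_fun scale (\<lambda>z. avg_sort d n (p @ [a]) (u @ v @ z # v'))" for a u v v'
      using Suc.IH(2)[of "p @ [a]" "u @ v"] by simp
    moreover have "lin_fun scale (\<lambda>z. avg_sort d n (p @ [z]) w)" for w
      using Suc.IH(1)[of p "[]"] by simp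
    ultimately show ?case
      by (auto intro!: lin_fun_divide lin_fun_splits_sum_word lin_fun_add
          lin_to_front2 lin_to_front3 lin_to_front4 Suc.IH(2))
  }
qed (auto intro: lin_fun_0)

end

section \<open>Functionals that respect the relations of the algebra attached to \<kappa>\<close>

locale wedge_setting = vector_space scale + group_action G UNIV \<rho>
  for scale :: "complex \<Rightarrow> 'v::ab_group_add \<Rightarrow> 'v"
    and G :: "('g, 'm) monoid_scheme" (structure) and \<rho> :: "'g \<Rightarrow> 'v \<Rightarrow> 'v" +
  fixes \<kappa> :: "'v \<Rightarrow> 'v \<Rightarrow> 'g \<Rightarrow> complex"
  assumes finite_G: "finite (carrier G)"
    and linear_act: "g \<in> carrier G \<Longrightarrow> Vector_Spaces.linear scale scale (\<rho> g)"
    and equivariant: "equivariant_wedge_map scale G \<rho> \<kappa>"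
begin

sublocale G: group G
  by (rule group_hom.axioms(1)[OF group_hom])

text \<open>In the smash product \<open>h z - z h = (h z - z) h\<close>, so the vector stated here
  is the coefficient of \<open>h\<close> in
  \<open>[\<kappa>(x,y), z] + [\<kappa>(y,z), x] + [\<kappa>(z,x), y]\<close>.\<close>

definition jacobi :: bool where
  "jacobi \<longleftrightarrow> (\<forall>h\<in>carrier G. \<forall>x y z. scale (\<kappa> x y h) (\<rho> h z - z) + scale (\<kappa> y z h) (\<rho> h x - x)
                + scale (\<kappa> z x h) (\<rho> h y - y) = 0)"

lemma act_add: "g \<in> carrier G \<Longrightarrow> \<rho> g (x + y) = \<rho> g x + \<rho> g y"
  and act_scale: "g \<in> carrier G \<Longrightarrow> \<rho> g (scale a x) = scale a (\<rho> g x)"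
  using linear_act[of g] by (auto simp: Vector_Spaces.linear_iff)

lemma act_mult: "g \<in> carrier G \<Longrightarrow> h \<in> carrier G \<Longrightarrow> \<rho> (g \<otimes> h) x = \<rho> g (\<rho> h x)"
  using composition_rule by auto

lemma act_one: "\<rho> \<one> x = x"
  using id_eq_one by (metis restrict_UNIV)

lemma kappa_add_left: "\<kappa> (x + y) z h = \<kappa> x z h + \<kappa> y z h"
  and kappa_scale_left: "\<kappa> (scale a x) z h = a * \<kappa> x z h"
  and kappa_add_right: "\<kappa> z (x + y) h = \<kappa> z x h + \<kappa> z y h"
  and kappa_scale_right: "\<kappa> z (scale a x) h = a * \<kappa> z x h"
  and kappa_self: "\<kappa> x x h = 0"
  and kappa_outside: "h \<notin> carrier G \<Longrightarrow> \<kappa> x y h = 0"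
  using equivariant unfolding equivariant_wedge_map_def bilinear_form_def Vector_Spaces.linear_iff by auto

lemma kappa_act: "g \<in> carrier G \<Longrightarrow> h \<in> carrier G \<Longrightarrow> \<kappa> (\<rho> g x) (\<rho> g y) h = \<kappa> x y (inv g \<otimes> h \<otimes> g)"
  using equivariant unfolding equivariant_wedge_map_def by auto

lemma kappa_skew: "\<kappa> x y h = - \<kappa> y x h"
proof -
  have "\<kappa> x x h + \<kappa> y x h + (\<kappa> x y h + \<kappa> y y h) = 0"
    using kappa_self[of "x + y" h] unfolding kappa_add_left kappa_add_right .
  then show ?thesis by (simp add: kappa_self eq_neg_iff_add_eq_0 add.commute)
qed

lemma lin_fun_comp_act: "g \<in> carrier G \<Longrightarrow> lin_fun scale f \<Longrightarrow> lin_fun scale (\<lambda>z. f (\<rho> g z))"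
  unfolding lin_fun_def by (simp add: act_add act_scale)

text \<open>
  The value, prescribed by \<open>[x, y] = \<kappa>(x, y)\<close>, of a functional \<open>\<Lambda>\<close> at \<open>u (x y - y x) v g\<close>: moving the
  group elements to the right turns \<open>u h v g\<close> into \<open>u (h v) (h g)\<close>. It is cut down to words of
  length \<open>m\<close>.
\<close>

definition commutator_value ::
  "('g \<Rightarrow> 'v list \<Rightarrow> complex) \<Rightarrow> nat \<Rightarrow> 'g \<Rightarrow> 'v list \<Rightarrow> 'v \<Rightarrow> 'v \<Rightarrow> 'v list \<Rightarrow> complex" where
  "commutator_value \<Lambda> m g u x y v =
     (if length u + length v + 2 = m then \<Sum>h\<in>carrier G. \<kappa> x y h * \<Lambda> (h \<otimes> g) (u @ map (\<rho> h) v) else 0)"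

definition multilin_family :: "('g \<Rightarrow> 'v list \<Rightarrow> complex) \<Rightarrow> bool" where
  "multilin_family \<Lambda> \<longleftrightarrow> (\<forall>g\<in>carrier G. multilin scale (\<Lambda> g))"

text \<open>\<open>\<Lambda> g w\<close> is the value at the word \<open>w\<close> followed by
  \<open>g\<close>. The length \<open>m\<close> is a parameter because the right side involves only
  words of length \<open>m - 2\<close>, which permits an induction on length.\<close>

definition respects_kappa :: "('g \<Rightarrow> 'v list \<Rightarrow> complex) \<Rightarrow> nat \<Rightarrow> bool" where
  "respects_kappa \<Lambda> m \<longleftrightarrow>
     (\<forall>g\<in>carrier G. \<forall>u x y v. length u + length v + 2 = m \<longrightarrow>
        \<Lambda> g (u @ x # y # v) - \<Lambda> g (u @ y # x # v)
          = (\<Sum>h\<in>carrier G. \<kappa> x y h * \<Lambda> (h \<otimes> g) (u @ map (\<rho> h) v)))"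

lemma multilin_family_add:
  "multilin_family \<Lambda> \<Longrightarrow> g \<in> carrier G \<Longrightarrow> \<Lambda> g (u @ (x + y) # v) = \<Lambda> g (u @ x # v) + \<Lambda> g (u @ y # v)"
  and multilin_family_scale:
  "multilin_family \<Lambda> \<Longrightarrow> g \<in> carrier G \<Longrightarrow> \<Lambda> g (u @ scale a x # v) = a * \<Lambda> g (u @ x # v)"
  by (auto simp: multilin_family_def multilin_def lin_fun_def)

lemma lin_commutator_value:
  assumes "multilin_family \<Lambda>" "g \<in> carrier G"
  shows "lin_fun scale (\<lambda>z. commutator_value \<Lambda> m g (u @ z # u') x y v)"
    and "lin_fun scale (\<lambda>z. commutator_value \<Lambda> m g u z y v)"
    and "lin_fun scale (\<lambda>z. commutator_value \<Lambda> m g u x z v)"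
    and "lin_fun scale (\<lambda>z. commutator_value \<Lambda> m g u x y (v @ z # v'))"
proof -
  have \<Lambda>: "h \<in> carrier G \<Longrightarrow> lin_fun scale (\<lambda>z. \<Lambda> h (u @ z # v))" for h u v
    using assms(1) by (auto simp: multilin_family_def multilin_def)
  have \<Lambda>': "lin_fun scale (\<lambda>z. \<Lambda> (h \<otimes> g) (u @ map (\<rho> h) v @ \<rho> h z # w))" if "h \<in> carrier G" for h u v w
    using lin_fun_comp_act[OF that \<Lambda>[of "h \<otimes> g" "u @ map (\<rho> h) v" w]] that assms(2) by simp
  have \<kappa>: "lin_fun scale (\<lambda>z. \<kappa> z y h)" "lin_fun scale (\<lambda>z. \<kappa> x z h)" for h
    by (auto simp: lin_fun_def kappa_add_left kappa_add_right kappa_scale_left kappa_scale_right)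
  show "lin_fun scale (\<lambda>z. commutator_value \<Lambda> m g (u @ z # u') x y v)"
    using assms(2) \<Lambda>
    unfolding commutator_value_def append_assoc append_Cons by (auto intro!: lin_fun_if lin_fun_sum lin_fun_cmult lin_fun_0)
  show "lin_fun scale (\<lambda>z. commutator_value \<Lambda> m g u z y v)" "lin_fun scale (\<lambda>z. commutator_value \<Lambda> m g u x z v)"
    unfolding commutator_value_def by (auto intro!: lin_fun_if lin_fun_sum lin_fun_multc \<kappa> lin_fun_0)
  show "lin_fun scale (\<lambda>z. commutator_value \<Lambda> m g u x y (v @ z # v'))"
    using assms(2) unfolding commutator_value_def by (auto intro!: lin_fun_if lin_fun_sum lin_fun_cmult \<Lambda>' lin_fun_0)
qed

lemma commutator_value_skew: "commutator_value \<Lambda> m g u x y v = - commutator_value \<Lambda> m g u y x v"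
  unfolding commutator_value_def using kappa_skew[of x y] by (simp add: sum_negf[symmetric])

text \<open>Evaluating both commutators, in either order, leads to a double sum over group elements
  \<open>h\<close> and \<open>k\<close>. The element \<open>h\<close> produced on the left also acts
  on \<open>x\<close> and \<open>y\<close>, which conjugates \<open>k\<close>; equivariance of
  \<kappa> absorbs this, and the two double sums agree.\<close>

lemma commutator_value_far:
  assumes "\<And>k. k < m \<Longrightarrow> respects_kappa \<Lambda> k" and g: "g \<in> carrier G"
  shows "commutator_value \<Lambda> m g u a b (q @ x # y # v) - commutator_value \<Lambda> m g u a b (q @ y # x # v)
       = commutator_value \<Lambda> m g (u @ a # b # q) x y v - commutator_value \<Lambda> m g (u @ b # a # q) x y v"
proof (cases "length u + length q + length v + 4 = m")
  case True
  \<comment> \<open>After the removal of one pair \<open>m - 2\<close> letters remain, so the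
    hypothesis applies to the other commutator at that length.\<close>
  have R: "\<Lambda> g' (u' @ x' # y' # v') - \<Lambda> g' (u' @ y' # x' # v')
          = (\<Sum>h\<in>carrier G. \<kappa> x' y' h * \<Lambda> (h \<otimes> g') (u' @ map (\<rho> h) v'))"
    if "g' \<in> carrier G" "length u' + length v' + 4 = m" for g' u' x' y' v'
    using assms(1)[of "m - 2"] that unfolding respects_kappa_def by force
  have "commutator_value \<Lambda> m g u a b (q @ x # y # v) - commutator_value \<Lambda> m g u a b (q @ y # x # v)
      = (\<Sum>h\<in>carrier G. \<kappa> a b h * (\<Lambda> (h \<otimes> g) ((u @ map (\<rho> h) q) @ \<rho> h x # \<rho> h y # map (\<rho> h) v)
          - \<Lambda> (h \<otimes> g) ((u @ map (\<rho> h) q) @ \<rho> h y # \<rho> h x # map (\<rho> h) v)))"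
    using True unfolding commutator_value_def by (simp add: sum_subtractf algebra_simps)
  also have "\<dots> = (\<Sum>h\<in>carrier G. \<kappa> a b h * (\<Sum>k\<in>carrier G. \<kappa> (\<rho> h x) (\<rho> h y) k *
                    \<Lambda> (k \<otimes> (h \<otimes> g)) ((u @ map (\<rho> h) q) @ map (\<rho> k) (map (\<rho> h) v))))"
    using True g by (intro sum.cong refl, subst R) auto
  also have "\<dots> = (\<Sum>h\<in>carrier G. \<kappa> a b h * (\<Sum>k\<in>carrier G. \<kappa> x y k *
                    \<Lambda> (h \<otimes> k \<otimes> g) (u @ map (\<rho> h) q @ map (\<rho> (h \<otimes> k)) v)))"
  proof -
    have "(\<Sum>k\<in>carrier G. \<kappa> (\<rho> h x) (\<rho> h y) k *
                    \<Lambda> (k \<otimes> (h \<otimes> g)) ((u @ map (\<rho> h) q) @ map (\<rho> k) (map (\<rho> h) v)))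
        = (\<Sum>k\<in>carrier G. \<kappa> x y k * \<Lambda> (h \<otimes> k \<otimes> g) (u @ map (\<rho> h) q @ map (\<rho> (h \<otimes> k)) v))"
      if h: "h \<in> carrier G" for h
    \<comment> \<open>Passing from \<open>k\<close> to \<open>h^-1 k h\<close> turns
      \<open>\<kappa> (\<rho> h x) (\<rho> h y)\<close> into \<open>\<kappa> x y\<close> by
      equivariance.\<close>
    proof (rule sum.reindex_bij_witness[where i = "\<lambda>k. h \<otimes> k \<otimes> inv h" and j = "\<lambda>k. inv h \<otimes> k \<otimes> h"])
      fix k assume k: "k \<in> carrier G"
      have "h \<otimes> (inv h \<otimes> k \<otimes> h) = k \<otimes> h"
        using h k by (metis G.inv_closed G.m_assoc G.m_closed G.r_inv G.l_one)
      moreover have "\<rho> k \<circ> \<rho> h = \<rho> (k \<otimes> h)"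
        using h k by (auto simp: act_mult)
      ultimately show "\<kappa> x y (inv h \<otimes> k \<otimes> h) * \<Lambda> (h \<otimes> (inv h \<otimes> k \<otimes> h) \<otimes> g)
            (u @ map (\<rho> h) q @ map (\<rho> (h \<otimes> (inv h \<otimes> k \<otimes> h))) v)
          = \<kappa> (\<rho> h x) (\<rho> h y) k * \<Lambda> (k \<otimes> (h \<otimes> g)) ((u @ map (\<rho> h) q) @ map (\<rho> k) (map (\<rho> h) v))"
        using h k g by (simp add: kappa_act G.m_assoc)
    next
      fix k assume k: "k \<in> carrier G"
      show "h \<otimes> (inv h \<otimes> k \<otimes> h) \<otimes> inv h = k"
        using h k by (metis G.inv_closed G.m_assoc G.m_closed G.r_inv G.r_one G.l_one)
      show "inv h \<otimes> (h \<otimes> k \<otimes> inv h) \<otimes> h = k"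
        using h k by (metis G.inv_closed G.m_assoc G.m_closed G.l_inv G.r_one G.l_one)
    qed (use h in auto)
    then show ?thesis by simp
  qed
  also have "\<dots> = (\<Sum>k\<in>carrier G. \<kappa> x y k * (\<Sum>h\<in>carrier G. \<kappa> a b h *
                    \<Lambda> (h \<otimes> (k \<otimes> g)) (u @ map (\<rho> h) (q @ map (\<rho> k) v))))"
    unfolding sum_distrib_left
    by (subst sum.swap, intro sum.cong refl)
      (use g in \<open>auto simp: G.m_assoc act_mult comp_def algebra_simps intro!: arg_cong2[where f = \<Lambda>]\<close>)
  also have "\<dots> = (\<Sum>k\<in>carrier G. \<kappa> x y k * (\<Lambda> (k \<otimes> g) (u @ a # b # q @ map (\<rho> k) v)
                                      - \<Lambda> (k \<otimes> g) (u @ b # a # q @ map (\<rho> k) v)))"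
    using True g by (intro sum.cong refl, subst R) auto
  also have "\<dots> = commutator_value \<Lambda> m g (u @ a # b # q) x y v - commutator_value \<Lambda> m g (u @ b # a # q) x y v"
    using True unfolding commutator_value_def by (simp add: sum_subtractf algebra_simps)
  finally show ?thesis .
qed (auto simp: commutator_value_def)

text \<open>For a single \<open>h\<close>, let \<open>f\<close> be the value after inserting a
  vector between \<open>u\<close> and the word \<open>h v\<close>. By linearity the six terms
  combine to \<open>f\<close> of the vector in \<open>jacobi\<close>.\<close>

lemma commutator_value_braid:
  assumes "jacobi" "multilin_family \<Lambda>" "g \<in> carrier G"
  shows "commutator_value \<Lambda> m g u x y (z # v) + commutator_value \<Lambda> m g (u @ [y]) x z v
           + commutator_value \<Lambda> m g u y z (x # v)
       = commutator_value \<Lambda> m g (u @ [x]) y z v + commutator_value \<Lambda> m g u x z (y # v)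
           + commutator_value \<Lambda> m g (u @ [z]) x y v"
proof (cases "length u + length v + 3 = m")
  case True
  have "(\<kappa> x y h * \<Lambda> (h \<otimes> g) (u @ \<rho> h z # map (\<rho> h) v) + \<kappa> x z h * \<Lambda> (h \<otimes> g) (u @ y # map (\<rho> h) v)
          + \<kappa> y z h * \<Lambda> (h \<otimes> g) (u @ \<rho> h x # map (\<rho> h) v))
      = (\<kappa> y z h * \<Lambda> (h \<otimes> g) (u @ x # map (\<rho> h) v) + \<kappa> x z h * \<Lambda> (h \<otimes> g) (u @ \<rho> h y # map (\<rho> h) v)
          + \<kappa> x y h * \<Lambda> (h \<otimes> g) (u @ z # map (\<rho> h) v))"
    (is "?l = ?r") if h: "h \<in> carrier G" for h
  proof -
    define f where "f z = \<Lambda> (h \<otimes> g) (u @ z # map (\<rho> h) v)" for z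
    have f: "f (x + y) = f x + f y" "f (scale a x) = a * f x" for x y a
      using assms h by (auto simp: f_def multilin_family_add multilin_family_scale)
    have f0: "f 0 = 0" using f(2)[of 0 0] by simp
    have "f (- x) = - f x" for x using f(2)[of "-1" x] by simp
    then have fd: "f (x - y) = f x - f y" for x y using f(1)[of x "- y"] by simp
    have "f (scale (\<kappa> x y h) (\<rho> h z - z) + scale (\<kappa> y z h) (\<rho> h x - x) + scale (\<kappa> z x h) (\<rho> h y - y)) = 0"
      using assms(1) h f0 by (simp add: jacobi_def)
    then have "\<kappa> x y h * (f (\<rho> h z) - f z) + \<kappa> y z h * (f (\<rho> h x) - f x) - \<kappa> x z h * (f (\<rho> h y) - f y) = 0"
      using kappa_skew[of z x h] by (simp add: f fd)
    then show ?thesis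
      unfolding f_def[symmetric] by (simp add: algebra_simps)
  qed
  then show ?thesis
    using True unfolding commutator_value_def by (simp flip: sum.distrib)
qed (auto simp: commutator_value_def)

text \<open>Stage \<open>j\<close> is final on words of length at most \<open>n + j\<close>; longer
  words keep the values of \<open>\<Lambda>\<close> as placeholders. The commutators prescribed at
  the new length refer to words two letters shorter.\<close>

primrec extend_functional ::
  "('g \<Rightarrow> 'v list \<Rightarrow> complex) \<Rightarrow> nat \<Rightarrow> nat \<Rightarrow> 'g \<Rightarrow> 'v list \<Rightarrow> complex" where
  "extend_functional \<Lambda> n 0 = \<Lambda>"
| "extend_functional \<Lambda> n (Suc j) = (\<lambda>g w.
     if length w = n + Suc j
     then avg_sort (commutator_value (extend_functional \<Lambda> n j) (n + Suc j) g) (n + Suc j) [] w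
     else extend_functional \<Lambda> n j g w)"

lemma extend_functional_stable:
  "length w \<le> n + j \<Longrightarrow> j \<le> k \<Longrightarrow> extend_functional \<Lambda> n k g w = extend_functional \<Lambda> n j g w"
  by (induction k) (auto simp: le_Suc_eq)

text \<open>At the new length, skewness is that of \<kappa>, distant swaps use the relations at all
  smaller lengths, and the braid relation uses \<open>jacobi\<close>; \<open>avg_sort_swap\<close>
  then yields the prescribed commutators.\<close>

lemma extend_functional_step:
  assumes "jacobi" "multilin_family \<Lambda>" "\<And>k. k \<le> n \<Longrightarrow> respects_kappa \<Lambda> k"
  shows "multilin_family (extend_functional \<Lambda> n j) \<and> (\<forall>k \<le> n + j. respects_kappa (extend_functional \<Lambda> n j) k)"
proof (induction j)
  case (Suc j)
  let ?\<Lambda> = "extend_functional \<Lambda> n j" and ?\<Lambda>' = "extend_functional \<Lambda> n (Suc j)" and ?m = "n + Suc j"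
  have ml: "multilin_family ?\<Lambda>" and rk: "\<And>k. k < ?m \<Longrightarrow> respects_kappa ?\<Lambda> k"
    using Suc by auto
  have "multilin_family ?\<Lambda>'"
    unfolding multilin_family_def multilin_def
  proof safe
    fix g u v assume g: "g \<in> carrier G"
    show "lin_fun scale (\<lambda>z. ?\<Lambda>' g (u @ z # v))"
    proof (cases "length u + Suc (length v) = ?m")
      case True
      then show ?thesis
        using lin_avg_sort(2)[where d = "commutator_value ?\<Lambda> ?m g" and scale = scale,
            OF lin_commutator_value[OF ml g]] by (simp del: avg_sort.simps)
    next
      case False
      then show ?thesis using ml g by (simp add: multilin_family_def multilin_def)
    qed
  qed
  moreover have "respects_kappa ?\<Lambda>' k" if k: "k \<le> n + Suc j" for k
    unfolding respects_kappa_def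
  proof (intro ballI allI impI)
    fix g and u v :: "'v list" and x y assume g: "g \<in> carrier G" and l: "length u + length v + 2 = k"
    \<comment> \<open>The right side lives on words shorter than the new length, where the two
      stages agree.\<close>
    have rhs: "(\<Sum>h\<in>carrier G. \<kappa> x y h * ?\<Lambda>' (h \<otimes> g) (u @ map (\<rho> h) v))
             = (\<Sum>h\<in>carrier G. \<kappa> x y h * ?\<Lambda> (h \<otimes> g) (u @ map (\<rho> h) v))"
      using l k by (intro sum.cong) auto
    show "?\<Lambda>' g (u @ x # y # v) - ?\<Lambda>' g (u @ y # x # v)
        = (\<Sum>h\<in>carrier G. \<kappa> x y h * ?\<Lambda>' (h \<otimes> g) (u @ map (\<rho> h) v))"
    proof (cases "k = ?m")
      case True
      have "avg_sort (commutator_value ?\<Lambda> ?m g) ?m [] (u @ x # y # v)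
           - avg_sort (commutator_value ?\<Lambda> ?m g) ?m [] (u @ y # x # v) = commutator_value ?\<Lambda> ?m g ([] @ u) x y v"
        by (rule avg_sort_swap)
          (use l True in \<open>auto intro: commutator_value_skew commutator_value_far[OF rk g]
              commutator_value_braid[OF assms(1) ml g]\<close>)
      then show ?thesis
        unfolding rhs using l True by (simp add: commutator_value_def)
    next
      case False
      then show ?thesis
        unfolding rhs using l k rk[of k] g by (simp add: respects_kappa_def)
    qed
  qed
  ultimately show ?case by blast
qed (use assms in auto)

theorem functional_extension:
  assumes "jacobi" "multilin_family \<Lambda>" "\<And>k. k \<le> n \<Longrightarrow> respects_kappa \<Lambda> k"
  obtains \<Lambda>' where "multilin_family \<Lambda>'" "\<And>k. respects_kappa \<Lambda>' k"
    "\<And>g w. length w \<le> n \<Longrightarrow> \<Lambda>' g w = \<Lambda> g w"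
proof
  \<comment> \<open>A word of length \<open>l\<close> is evaluated at stage \<open>l\<close>, which
    is final on it since \<open>l \<le> n + l\<close>.\<close>
  let ?\<Lambda> = "\<lambda>g w. extend_functional \<Lambda> n (length w) g w"
  have step: "multilin_family (extend_functional \<Lambda> n j) \<and> (\<forall>k \<le> n + j. respects_kappa (extend_functional \<Lambda> n j) k)" for j
    by (rule extend_functional_step) (use assms in auto)
  have eq: "extend_functional \<Lambda> n l g w = extend_functional \<Lambda> n j g w" if "length w \<le> l" "l < j" for g w l j
    using extend_functional_stable[of w n l j] that by simp
  show "multilin_family ?\<Lambda>"
    unfolding multilin_family_def multilin_def
  proof safe
    fix g u v assume "g \<in> carrier G"
    then have "lin_fun scale (\<lambda>z. extend_functional \<Lambda> n (length u + Suc (length v)) g (u @ z # v))"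
      using step[of "length u + Suc (length v)"] unfolding multilin_family_def multilin_def by blast
    then show "lin_fun scale (\<lambda>z. ?\<Lambda> g (u @ z # v))"
      by (simp del: extend_functional.simps)
  qed
  show "respects_kappa ?\<Lambda> k" for k
    unfolding respects_kappa_def
  proof (intro ballI allI impI)
    fix g and u v :: "'v list" and x y assume g: "g \<in> carrier G" and l: "length u + length v + 2 = k"
    have "respects_kappa (extend_functional \<Lambda> n k) k"
      using step by simp
    with g l show "?\<Lambda> g (u @ x # y # v) - ?\<Lambda> g (u @ y # x # v)
        = (\<Sum>h\<in>carrier G. \<kappa> x y h * ?\<Lambda> (h \<otimes> g) (u @ map (\<rho> h) v))"
      by (simp add: respects_kappa_def eq[where j = k])
  qed
  show "?\<Lambda> g w = \<Lambda> g w" if "length w \<le> n" for g w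
    using extend_functional_stable[of w n 0 "length w"] that by simp
qed

end

section \<open>The Jacobi identity and symplectic reflections\<close>

locale symplectic_setting = wedge_setting scale G \<rho> \<kappa>
  for scale :: "complex \<Rightarrow> 'v::ab_group_add \<Rightarrow> 'v"
    and G :: "('g, 'm) monoid_scheme" (structure) and \<rho> :: "'g \<Rightarrow> 'v \<Rightarrow> 'v"
    and \<kappa> :: "'v \<Rightarrow> 'v \<Rightarrow> 'g \<Rightarrow> complex" +
  fixes \<omega> :: "'v \<Rightarrow> 'v \<Rightarrow> complex"
  assumes symplectic: "symplectic_form scale \<omega>"
    and invariant: "invariant_form G \<rho> \<omega>"
    and faithful: "inj_on \<rho> (carrier G)"
    and invariant_forms: "skew_form scale B \<Longrightarrow> invariant_form G \<rho> B \<Longrightarrow> \<exists>a. B = (\<lambda>x y. a * \<omega> x y)"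
begin

lemma om_add_left: "\<omega> (x + y) z = \<omega> x z + \<omega> y z"
  and om_scale_left: "\<omega> (scale a x) z = a * \<omega> x z"
  and om_add_right: "\<omega> z (x + y) = \<omega> z x + \<omega> z y"
  and om_scale_right: "\<omega> z (scale a x) = a * \<omega> z x"
  and om_nondeg: "(\<And>y. \<omega> x y = 0) \<Longrightarrow> x = 0"
  using symplectic
  unfolding symplectic_form_def skew_form_def bilinear_form_def Vector_Spaces.linear_iff by blast+

lemma om_skew: "\<omega> x y = - \<omega> y x"
  using symplectic unfolding symplectic_form_def skew_form_def by blast

lemma om_act: "g \<in> carrier G \<Longrightarrow> \<omega> (\<rho> g x) (\<rho> g y) = \<omega> x y"
  using invariant unfolding invariant_form_def by auto

lemma om_self: "\<omega> x x = 0"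
  using om_skew[of x x] by simp

lemma om_zero_left: "\<omega> 0 z = 0"
  using om_scale_left[of 0 0 z] by simp

lemma om_zero_right: "\<omega> z 0 = 0"
  using om_scale_right[of z 0 0] by simp

lemma om_minus_right: "\<omega> z (- x) = - \<omega> z x"
  using om_scale_right[of z "-1" x] by simp

lemma om_minus_left: "\<omega> (- x) z = - \<omega> x z"
  using om_scale_left[of "-1" x z] by simp

lemma om_diff_left: "\<omega> (x - y) z = \<omega> x z - \<omega> y z"
  using om_add_left[of x "- y" z] by (simp add: om_minus_left)

lemma om_diff_right: "\<omega> z (x - y) = \<omega> z x - \<omega> z y"
  using om_add_right[of z x "- y"] by (simp add: om_minus_right)

lemma act_zero: "g \<in> carrier G \<Longrightarrow> \<rho> g 0 = 0"
  using act_scale[of g 0 0] by simp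

lemma act_minus: "g \<in> carrier G \<Longrightarrow> \<rho> g (- x) = - \<rho> g x"
  using act_scale[of g "-1" x] by simp

lemma act_diff: "g \<in> carrier G \<Longrightarrow> \<rho> g (x - y) = \<rho> g x - \<rho> g y"
  using act_add[of g x "- y"] by (simp add: act_minus)

lemma act_sum: "g \<in> carrier G \<Longrightarrow> \<rho> g (\<Sum>i\<in>I. f i) = (\<Sum>i\<in>I. \<rho> g (f i))"
  by (induction I rule: infinite_finite_induct) (auto simp: act_zero act_add)

section \<open>Image and kernel of \<open>1 - g\<close> for a symplectic map of finite order\<close>

lemma act_pow: "g \<in> carrier G \<Longrightarrow> \<rho> (g [^] n) x = (\<rho> g ^^ n) x"
proof (induction n arbitrary: x)
  case (Suc n)
  then show ?case by (simp add: act_mult funpow_swap1)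
qed (simp add: act_one)

lemma act_pow_card: "g \<in> carrier G \<Longrightarrow> (\<rho> g ^^ card (carrier G)) x = x"
  using act_pow[of g "card (carrier G)" x] G.pow_order_eq_1[of g] by (simp add: order_def act_one)

lemma card_pos: "card (carrier G) > 0"
  using finite_G G.one_closed by (auto simp: card_gt_0_iff)

text \<open>If \<open>d = z - g z\<close> is fixed, then \<open>g^i z = z - i d\<close>; with
  \<open>i\<close> the order of the group this forces \<open>i d = 0\<close>. So image and kernel of
  \<open>1 - g\<close> meet only in 0.\<close>

lemma fixed_moved_eq_0:
  assumes g: "g \<in> carrier G" and k: "\<rho> g (z - \<rho> g z) = z - \<rho> g z"
  shows "z - \<rho> g z = 0"
proof -
  define d where "d = z - \<rho> g z"
  have d: "\<rho> g d = d" using k unfolding d_def .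
  have "(\<rho> g ^^ i) z = z - scale (of_nat i) d" for i
  proof (induction i)
    case (Suc i)
    have "(\<rho> g ^^ Suc i) z = \<rho> g z - scale (of_nat i) d"
      using g by (simp add: Suc act_diff act_scale d)
    then show ?case by (simp add: d_def scale_left_distrib algebra_simps)
  qed simp
  from this[of "card (carrier G)"] show ?thesis
    using act_pow_card[OF g, of z] card_pos by (simp add: d_def)
qed

text \<open>The mean of \<open>x\<close> over the powers of \<open>g\<close> is fixed, and
  \<open>x\<close> minus this mean lies in the image of \<open>1 - g\<close>; so image and kernel
  span the space.\<close>

lemma moved_fixed_decomposition:
  assumes g: "g \<in> carrier G"
  obtains z where "\<rho> g (x - (z - \<rho> g z)) = x - (z - \<rho> g z)"
proof
  let ?N = "card (carrier G)"
  \<comment> \<open>Since \<open>(1 - g)(1 + ... + g^(i-1)) = 1 - g^i\<close>, averaging over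
    \<open>i\<close> makes \<open>z - g z\<close> equal to \<open>x\<close> minus the mean.\<close>
  define z where "z = scale (1 / of_nat ?N) (\<Sum>i<?N. \<Sum>j<i. (\<rho> g ^^ j) x)"
  have tele: "(\<Sum>j<i. (\<rho> g ^^ j) x) - \<rho> g (\<Sum>j<i. (\<rho> g ^^ j) x) = x - (\<rho> g ^^ i) x" for i
  proof (induction i)
    case (Suc i)
    let ?S = "\<Sum>j<i. (\<rho> g ^^ j) x"
    have "(?S + (\<rho> g ^^ i) x) - \<rho> g (?S + (\<rho> g ^^ i) x) = (?S - \<rho> g ?S) + ((\<rho> g ^^ i) x - (\<rho> g ^^ Suc i) x)"
      using g by (simp add: act_add)
    then show ?case unfolding Suc by simp
  qed (use g in \<open>simp add: act_zero\<close>)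
  have "z - \<rho> g z = scale (1 / of_nat ?N) (\<Sum>i<?N. x - (\<rho> g ^^ i) x)"
    unfolding z_def using g
    by (simp only: act_scale act_sum[of g _ "{..<card (carrier G)}"] tele
        flip: scale_right_diff_distrib sum_subtractf)
  also have "\<dots> = x - scale (1 / of_nat ?N) (\<Sum>i<?N. (\<rho> g ^^ i) x)"
  proof -
    have "(\<Sum>i<n. x) = scale (of_nat n) x" for n :: nat
      by (induction n) (auto simp: scale_left_distrib add.commute)
    then show ?thesis
      using card_pos by (simp add: sum_subtractf scale_right_diff_distrib)
  qed
  finally have "x - (z - \<rho> g z) = scale (1 / of_nat ?N) (\<Sum>i<?N. (\<rho> g ^^ i) x)" by simp
  \<comment> \<open>Applying \<open>g\<close> shifts the sum by one place; the new last term
    \<open>g^N x\<close> is the old first term \<open>x\<close>.\<close>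
  moreover have "\<rho> g (\<Sum>i<?N. (\<rho> g ^^ i) x) = (\<Sum>i<?N. (\<rho> g ^^ i) x)"
  proof -
    have "x + \<rho> g (\<Sum>i<?N. (\<rho> g ^^ i) x) = (\<Sum>i<Suc ?N. (\<rho> g ^^ i) x)"
      unfolding sum.lessThan_Suc_shift using g by (simp add: act_sum)
    also have "\<dots> = x + (\<Sum>i<?N. (\<rho> g ^^ i) x)"
      by (simp add: act_pow_card[OF g])
    finally show ?thesis by simp
  qed
  ultimately show "\<rho> g (x - (z - \<rho> g z)) = x - (z - \<rho> g z)"
    using g by (simp add: act_scale)
qed

text \<open>Two candidates differ by a vector that is both fixed and in the image of
  \<open>1 - g\<close>, hence zero; this makes the \<open>THE\<close> in \<open>refl_proj\<close>
  meaningful.\<close>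

lemma refl_proj_eqI:
  assumes g: "g \<in> carrier G" and u: "u = z - \<rho> g z" and k: "\<rho> g (x - u) = x - u"
  shows "refl_proj \<rho> g x = u"
  unfolding refl_proj_def
proof (rule the_equality)
  show "u \<in> range (\<lambda>z. z - \<rho> g z) \<and> (\<exists>k. k - \<rho> g k = 0 \<and> x = u + k)"
    using u k by (auto intro!: exI[of _ "x - u"])
next
  fix u' assume "u' \<in> range (\<lambda>z. z - \<rho> g z) \<and> (\<exists>k. k - \<rho> g k = 0 \<and> x = u' + k)"
  then obtain z' k' where u': "u' = z' - \<rho> g z'" and "k' - \<rho> g k' = 0" and x: "x = u' + k'"
    by blast
  then have k': "\<rho> g k' = k'" by simp
  have "(z - z') - \<rho> g (z - z') = u - u'"
    using g u u' by (simp add: act_diff)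
  moreover have "\<rho> g (u - u') = u - u'"
  proof -
    have "u - u' = k' - (x - u)" using x by (simp add: algebra_simps)
    then show ?thesis using act_diff[OF g, of k' "x - u"] k k' by (simp only:)
  qed
  ultimately show "u' = u"
    using fixed_moved_eq_0[OF g, of "z - z'"] by simp
qed

lemma refl_proj_moved:
  assumes g: "g \<in> carrier G"
  obtains z where "refl_proj \<rho> g x = z - \<rho> g z"
  using moved_fixed_decomposition[OF g, of x] refl_proj_eqI[OF g] by metis

lemma refl_proj_fixed:
  assumes g: "g \<in> carrier G"
  shows "\<rho> g (x - refl_proj \<rho> g x) = x - refl_proj \<rho> g x"
  using moved_fixed_decomposition[OF g, of x] refl_proj_eqI[OF g] by metis

lemma refl_proj_add:
  assumes g: "g \<in> carrier G"
  shows "refl_proj \<rho> g (x + y) = refl_proj \<rho> g x + refl_proj \<rho> g y"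
proof -
  obtain z z' where z: "refl_proj \<rho> g x = z - \<rho> g z" "refl_proj \<rho> g y = z' - \<rho> g z'"
    using refl_proj_moved[OF g] by metis
  have "\<rho> g (x - refl_proj \<rho> g x + (y - refl_proj \<rho> g y)) = x - refl_proj \<rho> g x + (y - refl_proj \<rho> g y)"
    using g by (simp only: act_add refl_proj_fixed)
  then have "\<rho> g (x + y - (refl_proj \<rho> g x + refl_proj \<rho> g y)) = x + y - (refl_proj \<rho> g x + refl_proj \<rho> g y)"
    by (simp only: add_diff_add)
  moreover have "refl_proj \<rho> g x + refl_proj \<rho> g y = (z + z') - \<rho> g (z + z')"
    unfolding z act_add[OF g] by (simp add: algebra_simps)
  ultimately show ?thesis
    by (intro refl_proj_eqI[OF g])
qed

lemma refl_proj_scale: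
  assumes g: "g \<in> carrier G"
  shows "refl_proj \<rho> g (scale a x) = scale a (refl_proj \<rho> g x)"
proof -
  obtain z where z: "refl_proj \<rho> g x = z - \<rho> g z"
    using refl_proj_moved[OF g] by metis
  have "\<rho> g (scale a (x - refl_proj \<rho> g x)) = scale a (x - refl_proj \<rho> g x)"
    using g by (simp only: act_scale refl_proj_fixed)
  then have "\<rho> g (scale a x - scale a (refl_proj \<rho> g x)) = scale a x - scale a (refl_proj \<rho> g x)"
    by (simp only: scale_right_diff_distrib)
  moreover have "scale a (refl_proj \<rho> g x) = scale a z - \<rho> g (scale a z)"
    unfolding z act_scale[OF g] by (simp add: scale_right_diff_distrib)
  ultimately show ?thesis
    by (intro refl_proj_eqI[OF g])
qed

lemma refl_proj_of_fixed: "g \<in> carrier G \<Longrightarrow> \<rho> g k = k \<Longrightarrow> refl_proj \<rho> g k = 0"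
  by (rule refl_proj_eqI[where z = 0]) (auto simp: act_zero)

lemma refl_proj_of_moved: "g \<in> carrier G \<Longrightarrow> refl_proj \<rho> g (z - \<rho> g z) = z - \<rho> g z"
  by (rule refl_proj_eqI[where z = z]) (auto simp: act_zero)

lemma act_refl_proj: "g \<in> carrier G \<Longrightarrow> \<rho> g (refl_proj \<rho> g x) - refl_proj \<rho> g x = \<rho> g x - x"
  using refl_proj_fixed[of g x] by (simp add: act_diff algebra_simps)

text \<open>Invariance gives
  \<open>\<omega> (g z) k = \<omega> (g z) (g k) = \<omega> z k\<close>.\<close>

lemma moved_orthogonal_fixed:
  assumes g: "g \<in> carrier G" and k: "\<rho> g k = k"
  shows "\<omega> (z - \<rho> g z) k = 0"
  using om_act[OF g, of z k] k by (simp add: om_diff_left)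

text \<open>The kernel of \<open>1 - g\<close> is orthogonal to its image and the two span the
  space, so a partner of an image vector can be replaced by its component in the image.\<close>

lemma moved_nondegenerate:
  assumes g: "g \<in> carrier G" and "z - \<rho> g z \<noteq> 0"
  obtains y where "\<omega> (z - \<rho> g z) (y - \<rho> g y) \<noteq> 0"
proof -
  obtain x where x: "\<omega> (z - \<rho> g z) x \<noteq> 0"
    using om_nondeg assms(2) by blast
  obtain y where "\<rho> g (x - (y - \<rho> g y)) = x - (y - \<rho> g y)"
    using moved_fixed_decomposition[OF g] by blast
  from moved_orthogonal_fixed[OF g this, of z] x have "\<omega> (z - \<rho> g z) (y - \<rho> g y) \<noteq> 0"
    by (simp add: om_diff_right)
  with that show thesis by blast
qed

lemma moves_some:
  assumes "g \<in> carrier G" "g \<noteq> \<one>"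
  obtains z where "z - \<rho> g z \<noteq> 0"
proof -
  have "\<rho> g \<noteq> \<rho> \<one>"
    using faithful assms by (auto dest: inj_onD)
  then obtain z where "\<rho> g z \<noteq> z" by (auto simp: fun_eq_iff act_one)
  with that[of z] show thesis by auto
qed

lemma refl_form_add_left:
  "g \<in> carrier G \<Longrightarrow> refl_form \<rho> \<omega> g (x + y) z = refl_form \<rho> \<omega> g x z + refl_form \<rho> \<omega> g y z"
  and refl_form_scale_left:
  "g \<in> carrier G \<Longrightarrow> refl_form \<rho> \<omega> g (scale a x) z = a * refl_form \<rho> \<omega> g x z"
  and refl_form_skew: "refl_form \<rho> \<omega> g x z = - refl_form \<rho> \<omega> g z x"
  and refl_form_fixed: "g \<in> carrier G \<Longrightarrow> \<rho> g k = k \<Longrightarrow> refl_form \<rho> \<omega> g k z = 0"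
  unfolding refl_form_def using om_skew[of "refl_proj \<rho> g x" "refl_proj \<rho> g z"]
  by (simp_all add: refl_proj_add refl_proj_scale refl_proj_of_fixed om_add_left om_scale_left om_zero_left)

text \<open>On the image of \<open>1 - g\<close> the projection is the identity, and the image is
  nonzero by faithfulness. The nonvanishing is what determines the coefficient of \<open>g\<close>
  in the final formula.\<close>

lemma refl_form_nonzero:
  assumes "g \<in> carrier G" "g \<noteq> \<one>"
  obtains x y where "refl_form \<rho> \<omega> g x y \<noteq> 0"
proof -
  obtain z where z: "z - \<rho> g z \<noteq> 0" using moves_some assms by blast
  obtain y where y: "\<omega> (z - \<rho> g z) (y - \<rho> g y) \<noteq> 0"
    using moved_nondegenerate[OF assms(1) z] by blast
  show thesis
    by (rule that[of "z - \<rho> g z" "y - \<rho> g y"])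
      (use y assms in \<open>simp add: refl_form_def refl_proj_of_moved\<close>)
qed

text \<open>Conjugation by \<open>g\<close> carries image and kernel of \<open>1 - s\<close> to
  those of \<open>1 - g s g^-1\<close>.\<close>

lemma refl_proj_conj:
  assumes g: "g \<in> carrier G" and s: "s \<in> carrier G"
  shows "refl_proj \<rho> (g \<otimes> s \<otimes> inv g) (\<rho> g x) = \<rho> g (refl_proj \<rho> s x)"
proof -
  have c: "\<rho> (g \<otimes> s \<otimes> inv g) (\<rho> g x) = \<rho> g (\<rho> s x)" for x
  proof -
    have "(g \<otimes> s \<otimes> inv g) \<otimes> g = g \<otimes> s" using g s by (simp add: G.m_assoc)
    then show ?thesis using g s by (metis act_mult G.m_closed G.inv_closed)
  qed
  obtain z where z: "refl_proj \<rho> s x = z - \<rho> s z" using refl_proj_moved[OF s] by metis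
  show ?thesis
  proof (rule refl_proj_eqI[where z = "\<rho> g z"])
    show "\<rho> g (refl_proj \<rho> s x) = \<rho> g z - \<rho> (g \<otimes> s \<otimes> inv g) (\<rho> g z)"
      using g by (simp add: c z act_diff)
    have "\<rho> (g \<otimes> s \<otimes> inv g) (\<rho> g (x - refl_proj \<rho> s x)) = \<rho> g (x - refl_proj \<rho> s x)"
      by (simp only: c refl_proj_fixed[OF s])
    then show "\<rho> (g \<otimes> s \<otimes> inv g) (\<rho> g x - \<rho> g (refl_proj \<rho> s x)) = \<rho> g x - \<rho> g (refl_proj \<rho> s x)"
      using g by (simp add: act_diff)
  qed (use g s in auto)
qed

lemma refl_form_conj:
  assumes g: "g \<in> carrier G" and s: "s \<in> carrier G"
  shows "refl_form \<rho> \<omega> (g \<otimes> s \<otimes> inv g) (\<rho> g x) (\<rho> g y) = refl_form \<rho> \<omega> s x y"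
  unfolding refl_form_def refl_proj_conj[OF g s] om_act[OF g] ..

lemma kappa_conj:
  assumes g: "g \<in> carrier G" and s: "s \<in> carrier G"
  shows "\<kappa> (\<rho> g x) (\<rho> g y) (g \<otimes> s \<otimes> inv g) = \<kappa> x y s"
proof -
  have "inv g \<otimes> (g \<otimes> s \<otimes> inv g) \<otimes> g = s"
    using g s by (metis G.inv_closed G.m_assoc G.m_closed G.l_inv G.r_one G.l_one)
  then show ?thesis using g s by (simp add: kappa_act)
qed

text \<open>The identity is fixed by conjugation, so this coefficient is an invariant skew form;
  here it enters that such forms are multiples of \<omega>.\<close>

lemma kappa_one: "\<exists>t. \<forall>x y. \<kappa> x y \<one> = t * \<omega> x y"
proof -
  have "skew_form scale (\<lambda>x y. \<kappa> x y \<one>)"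
    using equivariant kappa_skew unfolding skew_form_def equivariant_wedge_map_def by blast
  moreover have "invariant_form G \<rho> (\<lambda>x y. \<kappa> x y \<one>)"
    unfolding invariant_form_def by (auto simp: kappa_act)
  ultimately obtain t where "(\<lambda>x y. \<kappa> x y \<one>) = (\<lambda>x y. t * \<omega> x y)"
    using invariant_forms by blast
  then show ?thesis by (metis (no_types))
qed

section \<open>The shape of \<kappa> under the Jacobi identity\<close>

context
  assumes jacobi: jacobi
begin

lemma kappa_jacobi:
  assumes "h \<in> carrier G"
  shows "scale (\<kappa> x y h) (\<rho> h z - z) + scale (\<kappa> y z h) (\<rho> h x - x) + scale (\<kappa> z x h) (\<rho> h y - y) = 0"
  using jacobi assms unfolding jacobi_def by auto

text \<open>For fixed \<open>z\<close> only the terms with \<open>h x - x\<close> and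
  \<open>h y - y\<close> survive. If \<open>x\<close> is fixed too, any moved \<open>y\<close> gives
  the claim. Otherwise \<open>y\<close> is taken such that \<open>h y - y\<close> is not orthogonal
  to \<open>h x - x\<close>, and pairing with \<open>h x - x\<close> annihilates the first
  term.\<close>

lemma kappa_fixed:
  assumes h: "h \<in> carrier G" "h \<noteq> \<one>" and z: "\<rho> h z = z"
  shows "\<kappa> z x h = 0"
proof (cases "\<rho> h x = x")
  case True
  obtain y where "y - \<rho> h y \<noteq> 0" using moves_some[OF h] by blast
  then show ?thesis using kappa_jacobi[OF h(1), of x y z] z True by simp
next
  case False
  then obtain y where "\<omega> (x - \<rho> h x) (y - \<rho> h y) \<noteq> 0"
    using moved_nondegenerate[OF h(1), of x] by auto
  then have y: "\<omega> (\<rho> h x - x) (\<rho> h y - y) \<noteq> 0"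
    by (simp add: om_diff_left om_diff_right algebra_simps)
  have "\<omega> (\<rho> h x - x) (scale (\<kappa> y z h) (\<rho> h x - x) + scale (\<kappa> z x h) (\<rho> h y - y)) = 0"
    using kappa_jacobi[OF h(1), of x y z] z by (simp add: om_zero_right)
  then have "\<kappa> z x h * \<omega> (\<rho> h x - x) (\<rho> h y - y) = 0"
    by (simp only: om_add_right om_scale_right om_self) simp
  with y show ?thesis by simp
qed

text \<open>Dividing the Jacobi identity by \<open>\<kappa> x y h\<close> expresses
  \<open>h z - z\<close> by \<open>h x - x\<close> and \<open>h y - y\<close>; so \<open>a z\<close>
  and \<open>b z\<close> serve as coordinates of \<open>z\<close> modulo the kernel of
  \<open>h - 1\<close>.\<close>

lemma kappa_coordinates:
  assumes h: "h \<in> carrier G" and xy: "\<kappa> x y h \<noteq> 0"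
  defines "a \<equiv> \<lambda>z. - \<kappa> y z h / \<kappa> x y h" and "b \<equiv> \<lambda>z. - \<kappa> z x h / \<kappa> x y h"
  shows "\<rho> h z - z = scale (a z) (\<rho> h x - x) + scale (b z) (\<rho> h y - y)"
    and "\<rho> h (z - scale (a z) x - scale (b z) y) = z - scale (a z) x - scale (b z) y"
proof -
  have "scale (\<kappa> x y h) (\<rho> h z - z) = - scale (\<kappa> y z h) (\<rho> h x - x) - scale (\<kappa> z x h) (\<rho> h y - y)"
    using kappa_jacobi[OF h, of x y z] by (simp add: algebra_simps eq_neg_iff_add_eq_0)
  then have "scale (1 / \<kappa> x y h) (scale (\<kappa> x y h) (\<rho> h z - z))
      = scale (1 / \<kappa> x y h) (- scale (\<kappa> y z h) (\<rho> h x - x) - scale (\<kappa> z x h) (\<rho> h y - y))" by simp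
  then show 1: "\<rho> h z - z = scale (a z) (\<rho> h x - x) + scale (b z) (\<rho> h y - y)"
    using xy by (simp only: scale_right_diff_distrib scale_minus_right scale_scale) (simp add: a_def b_def algebra_simps)
  show "\<rho> h (z - scale (a z) x - scale (b z) y) = z - scale (a z) x - scale (b z) y"
    using 1 unfolding act_diff[OF h] act_scale[OF h] by (simp add: scale_right_diff_distrib algebra_simps)
qed

text \<open>Modulo the kernel of \<open>h - 1\<close>, where \<open>B\<close> vanishes, all vectors
  are combinations of \<open>x\<close> and \<open>y\<close>; hence \<open>B z z'\<close> is a 2 by 2
  determinant of coordinates times \<open>B x y\<close>, and the square clears the denominators. The
  determinant does not depend on \<open>B\<close>, so any two such forms are comparable.\<close>

lemma form_proportional_kappa:
  assumes h: "h \<in> carrier G" and xy: "\<kappa> x y h \<noteq> 0"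
    and B: "\<And>u v w. B (u + v) w = B u w + B v w" "\<And>a u w. B (scale a u) w = a * B u w"
      "\<And>u w. B u w = - B w u" "\<And>k w. \<rho> h k = k \<Longrightarrow> B k w = 0"
  shows "B z z' * \<kappa> x y h ^ 2 = (\<kappa> y z h * \<kappa> z' x h - \<kappa> z x h * \<kappa> y z' h) * B x y"
proof -
  define a where "a z = - \<kappa> y z h / \<kappa> x y h" for z
  define b where "b z = - \<kappa> z x h / \<kappa> x y h" for z
  have fx: "\<rho> h (z - scale (a z) x - scale (b z) y) = z - scale (a z) x - scale (b z) y" for z
    using kappa_coordinates(2)[OF h xy, of z] unfolding a_def b_def .
  have L: "B z w = a z * B x w + b z * B y w" for z w
  proof -
    have "z = (z - scale (a z) x - scale (b z) y) + (scale (a z) x + scale (b z) y)" by simp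
    then have "B z w = B (z - scale (a z) x - scale (b z) y) w + B (scale (a z) x + scale (b z) y) w"
      using B(1) by metis
    then show ?thesis using B(4)[OF fx] by (simp add: B(1,2))
  qed
  have S: "B u u = 0" for u using B(3)[of u u] by simp
  have xz: "B x z' = b z' * B x y" and yz: "B y z' = - (a z' * B x y)" for z'
  proof -
    have yx: "B y x = - B x y" by (rule B(3))
    have "B x z' = - (a z' * B x x + b z' * B y x)" "B y z' = - (a z' * B x y + b z' * B y y)"
      unfolding L[of z', symmetric] by (rule B(3))+
    then show "B x z' = b z' * B x y" "B y z' = - (a z' * B x y)" by (simp_all add: S yx)
  qed
  have "B z z' = (a z * b z' - b z * a z') * B x y"
    by (simp add: L[of z z'] xz[of z'] yz[of z'] algebra_simps)
  then show ?thesis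
    using xy by (simp add: a_def b_def field_simps power2_eq_square)
qed

lemma kappa_proportional_refl_form:
  assumes h: "h \<in> carrier G" "h \<noteq> \<one>"
  shows "\<exists>c. \<forall>z z'. \<kappa> z z' h = - 2 * c * refl_form \<rho> \<omega> h z z'"
proof (cases "\<exists>x y. \<kappa> x y h \<noteq> 0")
  case True
  then obtain x y where xy: "\<kappa> x y h \<noteq> 0" by blast
  note proportional = form_proportional_kappa[OF h(1) xy]
  let ?d = "\<lambda>z z'. \<kappa> y z h * \<kappa> z' x h - \<kappa> z x h * \<kappa> y z' h"
  have R: "refl_form \<rho> \<omega> h z z' * \<kappa> x y h ^ 2 = ?d z z' * refl_form \<rho> \<omega> h x y" for z z'
    by (rule proportional[OF refl_form_add_left[OF h(1)] refl_form_scale_left[OF h(1)] refl_form_skew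
          refl_form_fixed[OF h(1)]])
  have K: "\<kappa> z z' h * \<kappa> x y h ^ 2 = ?d z z' * \<kappa> x y h" for z z'
    by (rule proportional[where B = "\<lambda>z z'. \<kappa> z z' h",
          OF kappa_add_left kappa_scale_left kappa_skew kappa_fixed[OF h]])
  \<comment> \<open>If the value at \<open>x\<close>, \<open>y\<close> were zero, \<open>R\<close>
    would make the whole form vanish.\<close>
  have nz: "refl_form \<rho> \<omega> h x y \<noteq> 0"
    using refl_form_nonzero[OF h] R xy by (metis mult_eq_0_iff power_not_zero)
  \<comment> \<open>Solved from the equation at \<open>x\<close>, \<open>y\<close>; the 2 and the
    sign are the normalization of the final formula.\<close>
  define c where "c = - \<kappa> x y h / (2 * refl_form \<rho> \<omega> h x y)"
  have "\<kappa> z z' h = - 2 * c * refl_form \<rho> \<omega> h z z'" for z z'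
  proof -
    have "\<kappa> z z' h * \<kappa> x y h ^ 2 * refl_form \<rho> \<omega> h x y = refl_form \<rho> \<omega> h z z' * \<kappa> x y h ^ 2 * \<kappa> x y h"
      unfolding R K by (simp add: ac_simps)
    then show ?thesis using nz xy by (simp add: c_def field_simps power2_eq_square)
  qed
  then show ?thesis by blast
next
  case False
  then show ?thesis by (intro exI[of _ 0]) auto
qed

lemma kappa_nonzero_imp_reflection:
  assumes h: "h \<in> carrier G" "h \<noteq> \<one>" and xy: "\<kappa> x y h \<noteq> 0"
  shows "h \<in> symplectic_reflections scale G \<rho>"
proof -
  let ?u = "\<rho> h x - x" and ?v = "\<rho> h y - y"
  \<comment> \<open>A linear relation makes \<open>a x + b y\<close> a fixed vector; evaluating
    \<kappa> on it and \<open>y\<close>, or on it and \<open>x\<close>, isolates \<open>a\<close>,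
    or \<open>b\<close>.\<close>
  have indep: "a = 0 \<and> b = 0" if "scale a ?u + scale b ?v = 0" for a b
  proof -
    have "\<rho> h (scale a x + scale b y) = scale a x + scale b y"
      using that h by (simp add: act_add act_scale scale_right_diff_distrib algebra_simps)
    from kappa_fixed[OF h this, of y] kappa_fixed[OF h this, of x] xy show ?thesis
      using kappa_skew[of x y h] by (auto simp: kappa_add_left kappa_scale_left kappa_self)
  qed
  have "?v \<noteq> 0" using indep[of 0 1] by auto
  moreover have "?u \<notin> span {?v}"
  proof
    assume "?u \<in> span {?v}"
    then obtain k where "?u = scale k ?v" by (auto simp: span_singleton)
    then show False using indep[of 1 "- k"] by simp
  qed
  ultimately have ind: "independent {?u, ?v}" and "?u \<noteq> ?v"
    by (auto simp: independent_insert span_base independent_empty)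
  have "range (\<lambda>z. \<rho> h z - z) \<subseteq> span {?u, ?v}"
  proof clarify
    fix z
    show "\<rho> h z - z \<in> span {?u, ?v}"
      unfolding kappa_coordinates(1)[OF h(1) xy, of z]
      by (intro span_add span_scale span_base) auto
  qed
  then have "dim (range (\<lambda>z. \<rho> h z - z)) = 2"
    by (rule dim_unique[rotated]) (use ind \<open>?u \<noteq> ?v\<close> in auto)
  then show ?thesis
    using h by (simp add: symplectic_reflections_def)
qed

end

section \<open>Equivalence of the Jacobi identity with the explicit formula\<close>

lemma one_not_reflection: "\<one> \<notin> symplectic_reflections scale G \<rho>"
proof -
  have "range (\<lambda>x. \<rho> \<one> x - x) = {0}" by (auto simp: act_one)
  moreover have "dim {0} = 0"
    by (rule dim_unique[of "{}"]) (auto simp: independent_empty)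
  ultimately show ?thesis by (simp add: symplectic_reflections_def)
qed

lemma finite_reflections: "finite (symplectic_reflections scale G \<rho>)"
  and reflections_carrier: "s \<in> symplectic_reflections scale G \<rho> \<Longrightarrow> s \<in> carrier G"
  using finite_G by (auto simp: symplectic_reflections_def)

lemma sum_group_elt:
  "(\<Sum>s\<in>symplectic_reflections scale G \<rho>. f s * group_elt s h)
     = (if h \<in> symplectic_reflections scale G \<rho> then f h else (0::complex))"
  by (simp add: group_elt_def if_distrib[of "(*) _"] finite_reflections sum.delta cong: if_cong)

abbreviation kappa_form :: bool where
  "kappa_form \<equiv> (\<exists>(t :: complex) (c :: 'g \<Rightarrow> complex).
       (\<forall>g\<in>carrier G. \<forall>s\<in>symplectic_reflections scale G \<rho>. c (g \<otimes> s \<otimes> inv g) = c s) \<and>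
       (\<forall>x y. \<kappa> x y = (\<lambda>h. t * \<omega> x y * group_elt \<one> h
          - 2 * (\<Sum>s\<in>symplectic_reflections scale G \<rho>.
                   c s * refl_form \<rho> \<omega> s x y * group_elt s h))))"

lemma jacobi_imp_kappa_form:
  assumes jacobi
  shows kappa_form
proof -
  obtain t where t: "\<And>x y. \<kappa> x y \<one> = t * \<omega> x y" using kappa_one by blast
  \<comment> \<open>The choice is made for each \<open>h\<close> separately; as the reflection form
    is nonzero for \<open>h \<noteq> \<one>\<close>, the value is determined there, and this yields
    invariance under conjugation.\<close>
  define c where "c h = (SOME c. \<forall>x y. \<kappa> x y h = - 2 * c * refl_form \<rho> \<omega> h x y)" for h
  have c: "\<kappa> x y h = - 2 * c h * refl_form \<rho> \<omega> h x y" if "h \<in> carrier G" "h \<noteq> \<one>" for h x y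
    using someI_ex[OF kappa_proportional_refl_form[OF assms that]] unfolding c_def by blast
  show ?thesis
  proof (intro exI[of _ t] exI[of _ c] conjI ballI allI)
    fix g s assume g: "g \<in> carrier G" and "s \<in> symplectic_reflections scale G \<rho>"
    then have s: "s \<in> carrier G" "s \<noteq> \<one>" using one_not_reflection reflections_carrier by auto
    obtain x y where xy: "refl_form \<rho> \<omega> s x y \<noteq> 0" using refl_form_nonzero[OF s] by blast
    have "g \<otimes> s \<otimes> inv g \<noteq> \<one>"
    proof
      assume "g \<otimes> s \<otimes> inv g = \<one>"
      then have "g \<otimes> s = g"
        using g s by (metis G.inv_closed G.inv_equality G.inv_inv G.m_closed)
      then show False using g s by simp
    qed
    then have "\<kappa> (\<rho> g x) (\<rho> g y) (g \<otimes> s \<otimes> inv g) = - 2 * c (g \<otimes> s \<otimes> inv g) * refl_form \<rho> \<omega> s x y"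
      using g s by (simp add: c refl_form_conj)
    then show "c (g \<otimes> s \<otimes> inv g) = c s"
      using xy by (simp add: kappa_conj[OF g s(1)] c[OF s])
  next
    fix x y
    show "\<kappa> x y = (\<lambda>h. t * \<omega> x y * group_elt \<one> h - 2 * (\<Sum>s\<in>symplectic_reflections scale G \<rho>.
                   c s * refl_form \<rho> \<omega> s x y * group_elt s h))"
      unfolding sum_group_elt
    proof (rule ext)
      fix h
      consider "h \<notin> carrier G" | "h = \<one>" | "h \<in> carrier G" "h \<noteq> \<one>" by blast
      then show "\<kappa> x y h = t * \<omega> x y * group_elt \<one> h -
         2 * (if h \<in> symplectic_reflections scale G \<rho> then c h * refl_form \<rho> \<omega> h x y else 0)"
      proof cases
        case 1
        then show ?thesis using kappa_outside[of h] reflections_carrier[of h] by (auto simp: group_elt_def)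
      next
        case 2
        then show ?thesis using t one_not_reflection by (simp add: group_elt_def)
      next
        case 3
        then show ?thesis
          using c[OF 3] kappa_nonzero_imp_reflection[OF assms 3, of x y] by (auto simp: group_elt_def)
      qed
    qed
  qed
qed

text \<open>
  The cyclic sum factors through the quotient of \<open>V\<close> by the kernel of \<open>h - 1\<close>; it is alternating in
  three arguments, so it vanishes on this two-dimensional space.
\<close>

lemma refl_form_jacobi:
  assumes h: "h \<in> symplectic_reflections scale G \<rho>"
  shows "scale (refl_form \<rho> \<omega> h x y) (\<rho> h z - z) + scale (refl_form \<rho> \<omega> h y z) (\<rho> h x - x)
           + scale (refl_form \<rho> \<omega> h z x) (\<rho> h y - y) = 0"
proof -
  have hG: "h \<in> carrier G" using h reflections_carrier by blast
  have "dim (range (\<lambda>x. \<rho> h x - x)) = 2" using h by (simp add: symplectic_reflections_def)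
  then obtain B where B: "range (\<lambda>x. \<rho> h x - x) \<subseteq> span B" "card B = 2"
    using basis_exists by metis
  then obtain b1 b2 where b: "B = {b1, b2}" by (auto simp: card_2_iff)
  have "\<exists>p q. refl_proj \<rho> h x = scale p b1 + scale q b2" for x
  proof -
    obtain z where "refl_proj \<rho> h x = z - \<rho> h z" using refl_proj_moved[OF hG] by metis
    then have "refl_proj \<rho> h x \<in> range (\<lambda>x. \<rho> h x - x)"
      using hG by (intro image_eqI[of _ _ "- z"]) (simp_all add: act_minus)
    then have "refl_proj \<rho> h x \<in> span {b1, b2}" using B(1) b by blast
    then obtain p q where "refl_proj \<rho> h x - scale p b1 = scale q b2"
      by (auto simp: span_insert span_singleton)
    then show ?thesis by (metis add_diff_cancel_left' diff_add_cancel add.commute)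
  qed
  then obtain p q where pq: "\<And>x. refl_proj \<rho> h x = scale (p x) b1 + scale (q x) b2" by metis
  define d where "d x y = p x * q y - q x * p y" for x y
  have form: "refl_form \<rho> \<omega> h x y = d x y * \<omega> b1 b2" for x y
    using om_skew[of b2 b1]
    by (simp add: refl_form_def pq d_def om_add_left om_add_right om_scale_left om_scale_right om_self algebra_simps)
  have N: "\<rho> h z - z = scale (p z) (\<rho> h b1 - b1) + scale (q z) (\<rho> h b2 - b2)" for z
    unfolding act_refl_proj[OF hG, of z, symmetric] pq
    using hG by (simp add: act_add act_scale scale_right_diff_distrib)
  have "scale (d x y) (\<rho> h z - z) + scale (d y z) (\<rho> h x - x) + scale (d z x) (\<rho> h y - y)
      = scale (d x y * p z + d y z * p x + d z x * p y) (\<rho> h b1 - b1)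
      + scale (d x y * q z + d y z * q x + d z x * q y) (\<rho> h b2 - b2)"
    by (simp only: N[of x] N[of y] N[of z] scale_right_distrib scale_left_distrib scale_scale) (simp add: ac_simps)
  \<comment> \<open>Both coefficients are 3 by 3 determinants with a repeated column.\<close>
  also have "\<dots> = 0"
    by (simp add: d_def algebra_simps)
  finally have "scale (\<omega> b1 b2)
     (scale (d x y) (\<rho> h z - z) + scale (d y z) (\<rho> h x - x) + scale (d z x) (\<rho> h y - y)) = 0" by simp
  then show ?thesis
    unfolding form by (simp only: scale_right_distrib scale_scale mult.commute[of "\<omega> b1 b2"])
qed

lemma kappa_form_imp_jacobi:
  assumes kappa_form
  shows jacobi
proof -
  obtain t c where \<kappa>: "\<And>x y. \<kappa> x y = (\<lambda>h. t * \<omega> x y * group_elt \<one> h - 2 * (\<Sum>s\<in>symplectic_reflections scale G \<rho>.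
                   c s * refl_form \<rho> \<omega> s x y * group_elt s h))"
    using assms by blast
  show ?thesis
    unfolding jacobi_def
  proof (intro ballI allI)
    fix h x y z assume h: "h \<in> carrier G"
    consider "h = \<one>" | "h \<noteq> \<one>" "h \<in> symplectic_reflections scale G \<rho>" |
      "h \<noteq> \<one>" "h \<notin> symplectic_reflections scale G \<rho>" by blast
    then show "scale (\<kappa> x y h) (\<rho> h z - z) + scale (\<kappa> y z h) (\<rho> h x - x) + scale (\<kappa> z x h) (\<rho> h y - y) = 0"
    proof cases
      case 1
      then show ?thesis by (simp add: act_one)
    next
      case 2
      then have k: "\<kappa> x y h = (- 2 * c h) * refl_form \<rho> \<omega> h x y" for x y
        unfolding \<kappa> sum_group_elt by (simp add: group_elt_def)
      have "scale (- 2 * c h) (scale (refl_form \<rho> \<omega> h x y) (\<rho> h z - z) + scale (refl_form \<rho> \<omega> h y z) (\<rho> h x - x)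
           + scale (refl_form \<rho> \<omega> h z x) (\<rho> h y - y)) = 0"
        unfolding refl_form_jacobi[OF 2(2)] by simp
      then show ?thesis unfolding k by (simp only: scale_right_distrib scale_scale)
    next
      case 3
      then have "\<kappa> x y h = 0" for x y
        unfolding \<kappa> sum_group_elt by (simp add: group_elt_def)
      then show ?thesis by simp
    qed
  qed
qed

lemma jacobi_iff_kappa_form: "jacobi \<longleftrightarrow> kappa_form"
  using jacobi_imp_kappa_form kappa_form_imp_jacobi by blast

end

section \<open>Smash products\<close>

lemma ideal_of_closed:
  fixes R (structure)
  assumes "ring R" "I \<subseteq> carrier R" "\<zero> \<in> I"
    and add: "\<And>a b. a \<in> I \<Longrightarrow> b \<in> I \<Longrightarrow> a \<oplus> b \<in> I"
    and l: "\<And>a x. a \<in> I \<Longrightarrow> x \<in> carrier R \<Longrightarrow> x \<otimes> a \<in> I"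
    and r: "\<And>a x. a \<in> I \<Longrightarrow> x \<in> carrier R \<Longrightarrow> a \<otimes> x \<in> I"
  shows "ideal I R"
proof -
  interpret ring R by fact
  show ?thesis
  proof (rule idealI)
    have "\<ominus> a \<in> I" if "a \<in> I" for a
      using l[OF that, of "\<ominus> \<one>"] that assms(2) by (simp add: subset_iff l_minus)
    then show "subgroup I (add_monoid R)"
      using assms by (intro add.subgroupI) (auto simp: a_inv_def[symmetric])
  qed (use assms in auto)
qed

text \<open>The tensor and symmetric algebras, their smash products and \<open>H\<close> are targets
  of such maps from rings of words, so that elements can be replaced by lifts.\<close>

locale surj_ring_hom = ring_hom_ring +
  assumes surj: "h ` carrier R = carrier S"
begin

lemma lift: "s \<in> carrier S \<Longrightarrow> \<exists>r\<in>carrier R. s = h r"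
  using surj by auto

lemma image_ideal:
  assumes "ideal Z R"
  shows "ideal (h ` Z) S"
proof -
  interpret Z: ideal Z R by fact
  show ?thesis
  proof (rule ideal_of_closed)
    show "\<zero>\<^bsub>S\<^esub> \<in> h ` Z" by (metis Z.zero_closed hom_zero imageI)
    show "a \<oplus>\<^bsub>S\<^esub> b \<in> h ` Z" if ab: "a \<in> h ` Z" "b \<in> h ` Z" for a b
    proof -
      obtain u v where "a = h u" "u \<in> Z" "b = h v" "v \<in> Z" using ab by blast
      then show ?thesis using Z.Icarr by (auto intro!: image_eqI[of _ h "u \<oplus> v"])
    qed
    fix a x assume "a \<in> h ` Z" "x \<in> carrier S"
    then obtain u v where uv: "a = h u" "u \<in> Z" "x = h v" "v \<in> carrier R" using lift by blast
    show "x \<otimes>\<^bsub>S\<^esub> a \<in> h ` Z"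
      using uv Z.Icarr Z.I_l_closed by (auto intro!: image_eqI[of _ h "v \<otimes> u"])
    show "a \<otimes>\<^bsub>S\<^esub> x \<in> h ` Z"
      using uv Z.Icarr Z.I_r_closed by (auto intro!: image_eqI[of _ h "u \<otimes> v"])
  qed (use Z.Icarr S.ring_axioms in auto)
qed

lemma mem_of_hom_mem_genideal:
  assumes "ideal Z R" "X \<subseteq> Z" and ker: "\<And>x. x \<in> carrier R \<Longrightarrow> h x = \<zero>\<^bsub>S\<^esub> \<Longrightarrow> x \<in> Z"
    and x: "x \<in> carrier R" "h x \<in> Idl\<^bsub>S\<^esub> (h ` X)"
  shows "x \<in> Z"
proof -
  interpret Z: ideal Z R by fact
  have "Idl\<^bsub>S\<^esub> (h ` X) \<subseteq> h ` Z"
    by (rule S.genideal_minimal[OF image_ideal[OF assms(1)]]) (use assms(2) in auto)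
  then obtain z where z: "z \<in> Z" "h x = h z" using x by blast
  then have zR: "z \<in> carrier R" using Z.Icarr by simp
  have "h (x \<ominus> z) = \<zero>\<^bsub>S\<^esub>"
    using x z zR by (simp add: a_minus_def S.r_neg)
  then have "x \<ominus> z \<in> Z" using ker x zR by simp
  then have "(x \<ominus> z) \<oplus> z \<in> Z" using z by simp
  moreover have "(x \<ominus> z) \<oplus> z = x"
    using x zR by (simp add: a_minus_def R.a_assoc R.l_neg)
  ultimately show ?thesis by simp
qed

end

lemma (in abelian_monoid) finsum_swap:
  assumes "finite A" "finite B" "\<And>x y. x \<in> A \<Longrightarrow> y \<in> B \<Longrightarrow> f x y \<in> carrier G"
  shows "(\<Oplus>x\<in>A. \<Oplus>y\<in>B. f x y) = (\<Oplus>y\<in>B. \<Oplus>x\<in>A. f x y)"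
  using assms(1,3)
proof (induction A)
  case (insert a A)
  have 1: "(\<Oplus>x\<in>A. \<Oplus>y\<in>B. f x y) = (\<Oplus>y\<in>B. \<Oplus>x\<in>A. f x y)"
    by (rule insert.IH) (use insert.prems in auto)
  have "(\<Oplus>y\<in>B. \<Oplus>x\<in>insert a A. f x y) = (\<Oplus>y\<in>B. f a y \<oplus> (\<Oplus>x\<in>A. f x y))"
    using insert by (intro finsum_cong') (auto intro!: finsum_closed)
  also have "\<dots> = (\<Oplus>y\<in>B. f a y) \<oplus> (\<Oplus>y\<in>B. \<Oplus>x\<in>A. f x y)"
    using insert by (intro finsum_addf) (auto intro!: finsum_closed)
  also have "\<dots> = (\<Oplus>x\<in>insert a A. \<Oplus>y\<in>B. f x y)"
    unfolding 1[symmetric] using insert by (subst finsum_insert) (auto intro!: finsum_closed)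
  finally show ?case by simp
qed (simp add: finsum_zero)

lemma (in ideal) quotient_surj_ring_hom: "surj_ring_hom R (R Quot I) ((+>) I)"
proof (intro surj_ring_hom.intro surj_ring_hom_axioms.intro rcos_ring_hom_ring)
  show "(+>) I ` carrier R = carrier (R Quot I)"
    by (auto simp: FactRing_simps)
qed

lemma (in ideal) coset_eq_zero_iff:
  "x \<in> carrier R \<Longrightarrow> I +> x = \<zero>\<^bsub>R Quot I\<^esub> \<longleftrightarrow> x \<in> I"
  unfolding FactRing_def using a_coset_join1 a_coset_join2 a_subgroup a_subset
  by (metis (no_types, lifting) ring.simps(1) additive_subgroup.a_subgroup is_additive_subgroup)

section \<open>The ring structure of smash products\<close>

locale ring_action = A: ring A + G: group G
  for A :: "('a, 'r) ring_scheme" and G :: "('g, 'm) monoid_scheme" +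
  fixes \<alpha> :: "'g \<Rightarrow> 'a \<Rightarrow> 'a"
  assumes finite_carrier: "finite (carrier G)"
    and act_hom: "g \<in> carrier G \<Longrightarrow> \<alpha> g \<in> ring_hom A A"
    and act_one: "a \<in> carrier A \<Longrightarrow> \<alpha> \<one>\<^bsub>G\<^esub> a = a"
    and act_mult: "g \<in> carrier G \<Longrightarrow> h \<in> carrier G \<Longrightarrow> a \<in> carrier A \<Longrightarrow> \<alpha> (g \<otimes>\<^bsub>G\<^esub> h) a = \<alpha> g (\<alpha> h a)"
begin

lemma act_ring_hom: "g \<in> carrier G \<Longrightarrow> ring_hom_ring A A (\<alpha> g)"
  by (intro ring_hom_ringI2 A.ring_axioms act_hom)

lemma act_closed: "g \<in> carrier G \<Longrightarrow> a \<in> carrier A \<Longrightarrow> \<alpha> g a \<in> carrier A"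
  using act_hom by (rule ring_hom_closed)

lemma act_add:
  "g \<in> carrier G \<Longrightarrow> a \<in> carrier A \<Longrightarrow> b \<in> carrier A \<Longrightarrow> \<alpha> g (a \<oplus>\<^bsub>A\<^esub> b) = \<alpha> g a \<oplus>\<^bsub>A\<^esub> \<alpha> g b"
  using act_hom by (rule ring_hom_add)

lemma act_m:
  "g \<in> carrier G \<Longrightarrow> a \<in> carrier A \<Longrightarrow> b \<in> carrier A \<Longrightarrow> \<alpha> g (a \<otimes>\<^bsub>A\<^esub> b) = \<alpha> g a \<otimes>\<^bsub>A\<^esub> \<alpha> g b"
  using act_hom by (rule ring_hom_mult)

lemma act_unit: "g \<in> carrier G \<Longrightarrow> \<alpha> g \<one>\<^bsub>A\<^esub> = \<one>\<^bsub>A\<^esub>"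
  using act_hom by (rule ring_hom_one)

lemma act_zero: "g \<in> carrier G \<Longrightarrow> \<alpha> g \<zero>\<^bsub>A\<^esub> = \<zero>\<^bsub>A\<^esub>"
  using ring_hom_zero[OF act_hom] A.ring_axioms by blast

lemma act_finsum:
  assumes "g \<in> carrier G" "f \<in> I \<rightarrow> carrier A"
  shows "\<alpha> g (finsum A f I) = finsum A (\<lambda>i. \<alpha> g (f i)) I"
proof -
  interpret h: ring_hom_ring A A "\<alpha> g" using assms(1) by (rule act_ring_hom)
  show ?thesis using h.hom_finsum[OF assms(2)] by (simp add: comp_def)
qed

abbreviation "S \<equiv> smash G A \<alpha>"

lemma carrier_smash: "carrier S = carrier G \<rightarrow>\<^sub>E carrier A"
  and zero_smash: "\<zero>\<^bsub>S\<^esub> = (\<lambda>k\<in>carrier G. \<zero>\<^bsub>A\<^esub>)"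
  and one_smash: "\<one>\<^bsub>S\<^esub> = (\<lambda>k\<in>carrier G. if k = \<one>\<^bsub>G\<^esub> then \<one>\<^bsub>A\<^esub> else \<zero>\<^bsub>A\<^esub>)"
  and add_smash: "f \<oplus>\<^bsub>S\<^esub> h = (\<lambda>k\<in>carrier G. f k \<oplus>\<^bsub>A\<^esub> h k)"
  and mult_smash: "f \<otimes>\<^bsub>S\<^esub> h = (\<lambda>k\<in>carrier G.
         finsum A (\<lambda>g. f g \<otimes>\<^bsub>A\<^esub> \<alpha> g (h (inv\<^bsub>G\<^esub> g \<otimes>\<^bsub>G\<^esub> k))) (carrier G))"
  by (simp_all add: smash_def)

lemma add_apply: "k \<in> carrier G \<Longrightarrow> (f \<oplus>\<^bsub>S\<^esub> h) k = f k \<oplus>\<^bsub>A\<^esub> h k"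
  and mult_apply: "k \<in> carrier G \<Longrightarrow> (f \<otimes>\<^bsub>S\<^esub> h) k =
         finsum A (\<lambda>g. f g \<otimes>\<^bsub>A\<^esub> \<alpha> g (h (inv\<^bsub>G\<^esub> g \<otimes>\<^bsub>G\<^esub> k))) (carrier G)"
  by (simp_all add: add_smash mult_smash)

lemma smash_apply: "f \<in> carrier S \<Longrightarrow> g \<in> carrier G \<Longrightarrow> f g \<in> carrier A"
  by (auto simp: carrier_smash)

lemma smash_eqI:
  "f \<in> carrier S \<Longrightarrow> h \<in> carrier S \<Longrightarrow> (\<And>g. g \<in> carrier G \<Longrightarrow> f g = h g) \<Longrightarrow> f = h"
  unfolding carrier_smash by (rule PiE_ext)

lemma mult_apply_closed:
  assumes "f \<in> carrier S" "h \<in> carrier S" "k \<in> carrier G"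
  shows "(\<lambda>g. f g \<otimes>\<^bsub>A\<^esub> \<alpha> g (h (inv\<^bsub>G\<^esub> g \<otimes>\<^bsub>G\<^esub> k))) \<in> carrier G \<rightarrow> carrier A"
  using assms by (auto simp: act_closed smash_apply)

lemma smash_add_closed: "f \<in> carrier S \<Longrightarrow> h \<in> carrier S \<Longrightarrow> f \<oplus>\<^bsub>S\<^esub> h \<in> carrier S"
  and smash_mult_closed: "f \<in> carrier S \<Longrightarrow> h \<in> carrier S \<Longrightarrow> f \<otimes>\<^bsub>S\<^esub> h \<in> carrier S"
  and smash_zero_closed: "\<zero>\<^bsub>S\<^esub> \<in> carrier S"
  and smash_one_closed: "\<one>\<^bsub>S\<^esub> \<in> carrier S"
proof -
  show "f \<oplus>\<^bsub>S\<^esub> h \<in> carrier S" if "f \<in> carrier S" "h \<in> carrier S"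
    unfolding add_smash using that by (auto simp: carrier_smash intro!: A.add.m_closed)
  show "f \<otimes>\<^bsub>S\<^esub> h \<in> carrier S" if "f \<in> carrier S" "h \<in> carrier S"
    unfolding mult_smash using mult_apply_closed[OF that]
    by (auto simp: carrier_smash intro!: A.finsum_closed)
  show "\<zero>\<^bsub>S\<^esub> \<in> carrier S" "\<one>\<^bsub>S\<^esub> \<in> carrier S"
    by (auto simp: zero_smash one_smash carrier_smash)
qed

text \<open>Both products are double sums over the group; after exchanging the sums, the
  substitution of \<open>g' g\<close> for \<open>g\<close> and the multiplicativity of the action
  identify them.\<close>

lemma smash_assoc:
  assumes f: "f \<in> carrier S" and h: "h \<in> carrier S" and l: "l \<in> carrier S"
  shows "f \<otimes>\<^bsub>S\<^esub> h \<otimes>\<^bsub>S\<^esub> l = f \<otimes>\<^bsub>S\<^esub> (h \<otimes>\<^bsub>S\<^esub> l)"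
proof (rule smash_eqI)
  fix k assume k: "k \<in> carrier G"
  note clo = smash_apply[OF f] smash_apply[OF h] smash_apply[OF l] act_closed
  let ?G = "carrier G"
  have "(f \<otimes>\<^bsub>S\<^esub> h \<otimes>\<^bsub>S\<^esub> l) k
      = (\<Oplus>\<^bsub>A\<^esub>g\<in>?G. (\<Oplus>\<^bsub>A\<^esub>g'\<in>?G. f g' \<otimes>\<^bsub>A\<^esub> \<alpha> g' (h (inv\<^bsub>G\<^esub> g' \<otimes>\<^bsub>G\<^esub> g))) \<otimes>\<^bsub>A\<^esub> \<alpha> g (l (inv\<^bsub>G\<^esub> g \<otimes>\<^bsub>G\<^esub> k)))"
    unfolding mult_smash using k by (auto intro!: A.finsum_cong' A.m_closed A.finsum_closed clo)
  also have "\<dots> = (\<Oplus>\<^bsub>A\<^esub>g\<in>?G. \<Oplus>\<^bsub>A\<^esub>g'\<in>?G. f g' \<otimes>\<^bsub>A\<^esub> (\<alpha> g' (h (inv\<^bsub>G\<^esub> g' \<otimes>\<^bsub>G\<^esub> g)) \<otimes>\<^bsub>A\<^esub> \<alpha> g (l (inv\<^bsub>G\<^esub> g \<otimes>\<^bsub>G\<^esub> k))))"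
    using k by (intro A.finsum_cong' refl)
      (auto simp: A.finsum_ldistr finite_carrier A.m_assoc clo Pi_def intro!: A.finsum_cong' A.m_closed A.finsum_closed)
  also have "\<dots> = (\<Oplus>\<^bsub>A\<^esub>g'\<in>?G. \<Oplus>\<^bsub>A\<^esub>g\<in>?G. f g' \<otimes>\<^bsub>A\<^esub> (\<alpha> g' (h (inv\<^bsub>G\<^esub> g' \<otimes>\<^bsub>G\<^esub> g)) \<otimes>\<^bsub>A\<^esub> \<alpha> g (l (inv\<^bsub>G\<^esub> g \<otimes>\<^bsub>G\<^esub> k))))"
    using k by (intro A.finsum_swap finite_carrier A.m_closed clo) auto
  also have "\<dots> = (\<Oplus>\<^bsub>A\<^esub>g'\<in>?G. f g' \<otimes>\<^bsub>A\<^esub> \<alpha> g' (\<Oplus>\<^bsub>A\<^esub>g\<in>?G. h g \<otimes>\<^bsub>A\<^esub> \<alpha> g (l (inv\<^bsub>G\<^esub> g \<otimes>\<^bsub>G\<^esub> (inv\<^bsub>G\<^esub> g' \<otimes>\<^bsub>G\<^esub> k)))))"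
  proof (intro A.finsum_cong' refl)
    fix g' assume g': "g' \<in> ?G"
    have "(\<Oplus>\<^bsub>A\<^esub>g\<in>?G. f g' \<otimes>\<^bsub>A\<^esub> (\<alpha> g' (h (inv\<^bsub>G\<^esub> g' \<otimes>\<^bsub>G\<^esub> g)) \<otimes>\<^bsub>A\<^esub> \<alpha> g (l (inv\<^bsub>G\<^esub> g \<otimes>\<^bsub>G\<^esub> k))))
        = (\<Oplus>\<^bsub>A\<^esub>g\<in>(\<lambda>g. g' \<otimes>\<^bsub>G\<^esub> g) ` ?G. f g' \<otimes>\<^bsub>A\<^esub> (\<alpha> g' (h (inv\<^bsub>G\<^esub> g' \<otimes>\<^bsub>G\<^esub> g)) \<otimes>\<^bsub>A\<^esub> \<alpha> g (l (inv\<^bsub>G\<^esub> g \<otimes>\<^bsub>G\<^esub> k))))"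
      using G.surj_const_mult[OF g'] by simp
    also have "\<dots> = (\<Oplus>\<^bsub>A\<^esub>g\<in>?G. f g' \<otimes>\<^bsub>A\<^esub> (\<alpha> g' (h (inv\<^bsub>G\<^esub> g' \<otimes>\<^bsub>G\<^esub> (g' \<otimes>\<^bsub>G\<^esub> g))) \<otimes>\<^bsub>A\<^esub> \<alpha> (g' \<otimes>\<^bsub>G\<^esub> g) (l (inv\<^bsub>G\<^esub> (g' \<otimes>\<^bsub>G\<^esub> g) \<otimes>\<^bsub>G\<^esub> k))))"
      using g' k by (intro A.finsum_reindex) (auto intro!: A.m_closed clo inj_onI)
    also have "\<dots> = (\<Oplus>\<^bsub>A\<^esub>g\<in>?G. f g' \<otimes>\<^bsub>A\<^esub> \<alpha> g' (h g \<otimes>\<^bsub>A\<^esub> \<alpha> g (l (inv\<^bsub>G\<^esub> g \<otimes>\<^bsub>G\<^esub> (inv\<^bsub>G\<^esub> g' \<otimes>\<^bsub>G\<^esub> k)))))"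
      using g' k by (intro A.finsum_cong' refl)
        (auto simp: G.m_assoc[symmetric] G.inv_mult_group act_m act_mult clo intro!: A.m_closed clo)
    also have "\<dots> = f g' \<otimes>\<^bsub>A\<^esub> (\<Oplus>\<^bsub>A\<^esub>g\<in>?G. \<alpha> g' (h g \<otimes>\<^bsub>A\<^esub> \<alpha> g (l (inv\<^bsub>G\<^esub> g \<otimes>\<^bsub>G\<^esub> (inv\<^bsub>G\<^esub> g' \<otimes>\<^bsub>G\<^esub> k)))))"
      using g' k by (intro A.finsum_rdistr[symmetric] finite_carrier) (auto intro!: A.m_closed clo)
    also have "(\<Oplus>\<^bsub>A\<^esub>g\<in>?G. \<alpha> g' (h g \<otimes>\<^bsub>A\<^esub> \<alpha> g (l (inv\<^bsub>G\<^esub> g \<otimes>\<^bsub>G\<^esub> (inv\<^bsub>G\<^esub> g' \<otimes>\<^bsub>G\<^esub> k)))))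
        = \<alpha> g' (\<Oplus>\<^bsub>A\<^esub>g\<in>?G. h g \<otimes>\<^bsub>A\<^esub> \<alpha> g (l (inv\<^bsub>G\<^esub> g \<otimes>\<^bsub>G\<^esub> (inv\<^bsub>G\<^esub> g' \<otimes>\<^bsub>G\<^esub> k))))"
      using g' k by (intro act_finsum[symmetric]) (auto intro!: A.m_closed clo)
    finally show "(\<Oplus>\<^bsub>A\<^esub>g\<in>?G. f g' \<otimes>\<^bsub>A\<^esub> (\<alpha> g' (h (inv\<^bsub>G\<^esub> g' \<otimes>\<^bsub>G\<^esub> g)) \<otimes>\<^bsub>A\<^esub> \<alpha> g (l (inv\<^bsub>G\<^esub> g \<otimes>\<^bsub>G\<^esub> k))))
       = f g' \<otimes>\<^bsub>A\<^esub> \<alpha> g' (\<Oplus>\<^bsub>A\<^esub>g\<in>?G. h g \<otimes>\<^bsub>A\<^esub> \<alpha> g (l (inv\<^bsub>G\<^esub> g \<otimes>\<^bsub>G\<^esub> (inv\<^bsub>G\<^esub> g' \<otimes>\<^bsub>G\<^esub> k))))" .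
  qed (use k in \<open>auto intro!: A.m_closed A.finsum_closed clo\<close>)
  also have "\<dots> = (f \<otimes>\<^bsub>S\<^esub> (h \<otimes>\<^bsub>S\<^esub> l)) k"
    unfolding mult_smash using k by (auto intro!: A.finsum_cong' A.m_closed A.finsum_closed clo)
  finally show "(f \<otimes>\<^bsub>S\<^esub> h \<otimes>\<^bsub>S\<^esub> l) k = (f \<otimes>\<^bsub>S\<^esub> (h \<otimes>\<^bsub>S\<^esub> l)) k" .
qed (intro smash_mult_closed assms)+

text \<open>This is the element \<open>a g\<close> of the smash product.\<close>

definition single :: "'g \<Rightarrow> 'a \<Rightarrow> 'g \<Rightarrow> 'a" where
  "single g a = (\<lambda>k\<in>carrier G. if k = g then a else \<zero>\<^bsub>A\<^esub>)"

lemma single_closed: "a \<in> carrier A \<Longrightarrow> single g a \<in> carrier S"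
  by (auto simp: single_def carrier_smash)

lemma single_apply: "k \<in> carrier G \<Longrightarrow> single g a k = (if k = g then a else \<zero>\<^bsub>A\<^esub>)"
  by (simp add: single_def)

lemma one_eq_single: "\<one>\<^bsub>S\<^esub> = single \<one>\<^bsub>G\<^esub> \<one>\<^bsub>A\<^esub>"
  by (simp add: one_smash single_def)

lemma single_mult_apply:
  assumes "b \<in> carrier A" "f \<in> carrier S" "h \<in> carrier G" "k \<in> carrier G"
  shows "(single h b \<otimes>\<^bsub>S\<^esub> f) k = b \<otimes>\<^bsub>A\<^esub> \<alpha> h (f (inv\<^bsub>G\<^esub> h \<otimes>\<^bsub>G\<^esub> k))"
proof -
  have "(single h b \<otimes>\<^bsub>S\<^esub> f) k = (\<Oplus>\<^bsub>A\<^esub>g\<in>carrier G. if h = g then b \<otimes>\<^bsub>A\<^esub> \<alpha> g (f (inv\<^bsub>G\<^esub> g \<otimes>\<^bsub>G\<^esub> k)) else \<zero>\<^bsub>A\<^esub>)"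
    unfolding mult_apply[OF assms(4)] using assms
    by (intro A.finsum_cong' refl) (auto simp: single_apply act_closed smash_apply)
  also have "\<dots> = b \<otimes>\<^bsub>A\<^esub> \<alpha> h (f (inv\<^bsub>G\<^esub> h \<otimes>\<^bsub>G\<^esub> k))"
    using assms by (intro A.finsum_singleton finite_carrier) (auto simp: act_closed smash_apply)
  finally show ?thesis .
qed

lemma mult_single_apply:
  assumes "b \<in> carrier A" "f \<in> carrier S" "h \<in> carrier G" "k \<in> carrier G"
  shows "(f \<otimes>\<^bsub>S\<^esub> single h b) k = f (k \<otimes>\<^bsub>G\<^esub> inv\<^bsub>G\<^esub> h) \<otimes>\<^bsub>A\<^esub> \<alpha> (k \<otimes>\<^bsub>G\<^esub> inv\<^bsub>G\<^esub> h) b"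
proof -
  have eq: "inv\<^bsub>G\<^esub> g \<otimes>\<^bsub>G\<^esub> k = h \<longleftrightarrow> k \<otimes>\<^bsub>G\<^esub> inv\<^bsub>G\<^esub> h = g" if "g \<in> carrier G" for g
    using assms that by (metis G.inv_closed G.inv_solve_left G.inv_solve_right)
  have "(f \<otimes>\<^bsub>S\<^esub> single h b) k = (\<Oplus>\<^bsub>A\<^esub>g\<in>carrier G. if k \<otimes>\<^bsub>G\<^esub> inv\<^bsub>G\<^esub> h = g then f g \<otimes>\<^bsub>A\<^esub> \<alpha> g b else \<zero>\<^bsub>A\<^esub>)"
    unfolding mult_apply[OF assms(4)] using assms
    by (intro A.finsum_cong' refl) (auto simp: single_apply eq act_zero act_closed smash_apply)
  also have "\<dots> = f (k \<otimes>\<^bsub>G\<^esub> inv\<^bsub>G\<^esub> h) \<otimes>\<^bsub>A\<^esub> \<alpha> (k \<otimes>\<^bsub>G\<^esub> inv\<^bsub>G\<^esub> h) b"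
    using assms by (intro A.finsum_singleton finite_carrier) (auto simp: act_closed smash_apply)
  finally show ?thesis .
qed

lemma smash_ring: "ring S"
proof (rule ringI)
  show "abelian_group S"
  proof (rule abelian_groupI)
    fix x assume x: "x \<in> carrier S"
    show "\<exists>y\<in>carrier S. y \<oplus>\<^bsub>S\<^esub> x = \<zero>\<^bsub>S\<^esub>"
    proof (rule bexI[of _ "\<lambda>k\<in>carrier G. \<ominus>\<^bsub>A\<^esub> x k"])
      show "(\<lambda>k\<in>carrier G. \<ominus>\<^bsub>A\<^esub> x k) \<oplus>\<^bsub>S\<^esub> x = \<zero>\<^bsub>S\<^esub>"
        unfolding add_smash zero_smash using x by (auto simp: smash_apply A.l_neg intro!: restrict_ext)
    qed (use x in \<open>auto simp: carrier_smash\<close>)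
    show "\<zero>\<^bsub>S\<^esub> \<oplus>\<^bsub>S\<^esub> x = x"
      by (rule smash_eqI) (use x in \<open>auto simp: smash_apply add_smash zero_smash intro!: smash_add_closed smash_zero_closed x\<close>,
        use x in \<open>auto simp: carrier_smash\<close>)
  next
    fix x y assume "x \<in> carrier S" "y \<in> carrier S"
    then show "x \<oplus>\<^bsub>S\<^esub> y = y \<oplus>\<^bsub>S\<^esub> x"
      unfolding add_smash by (auto simp: smash_apply A.a_comm intro!: restrict_ext)
  next
    fix x y z assume "x \<in> carrier S" "y \<in> carrier S" "z \<in> carrier S"
    then show "x \<oplus>\<^bsub>S\<^esub> y \<oplus>\<^bsub>S\<^esub> z = x \<oplus>\<^bsub>S\<^esub> (y \<oplus>\<^bsub>S\<^esub> z)"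
      unfolding add_smash by (auto simp: smash_apply A.a_assoc intro!: restrict_ext)
  qed (intro smash_add_closed smash_zero_closed; assumption)+
  show "Group.monoid S"
  proof (rule monoidI)
    fix x assume x: "x \<in> carrier S"
    show "\<one>\<^bsub>S\<^esub> \<otimes>\<^bsub>S\<^esub> x = x"
      using x unfolding one_eq_single
      by (intro smash_eqI smash_mult_closed single_closed) (auto simp: single_mult_apply smash_apply act_one)
    show "x \<otimes>\<^bsub>S\<^esub> \<one>\<^bsub>S\<^esub> = x"
      using x unfolding one_eq_single
      by (intro smash_eqI smash_mult_closed single_closed) (auto simp: mult_single_apply smash_apply act_unit)
  qed (intro smash_mult_closed smash_one_closed smash_assoc; assumption)+
next
  fix x y z assume xyz: "x \<in> carrier S" "y \<in> carrier S" "z \<in> carrier S"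
  note clo = smash_apply[OF xyz(1)] smash_apply[OF xyz(2)] smash_apply[OF xyz(3)] act_closed
  show "(x \<oplus>\<^bsub>S\<^esub> y) \<otimes>\<^bsub>S\<^esub> z = x \<otimes>\<^bsub>S\<^esub> z \<oplus>\<^bsub>S\<^esub> y \<otimes>\<^bsub>S\<^esub> z"
  proof (rule smash_eqI)
    fix k assume k: "k \<in> carrier G"
    have "((x \<oplus>\<^bsub>S\<^esub> y) \<otimes>\<^bsub>S\<^esub> z) k = (\<Oplus>\<^bsub>A\<^esub>g\<in>carrier G. x g \<otimes>\<^bsub>A\<^esub> \<alpha> g (z (inv\<^bsub>G\<^esub> g \<otimes>\<^bsub>G\<^esub> k)) \<oplus>\<^bsub>A\<^esub> y g \<otimes>\<^bsub>A\<^esub> \<alpha> g (z (inv\<^bsub>G\<^esub> g \<otimes>\<^bsub>G\<^esub> k)))"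
      unfolding mult_apply[OF k]
      by (intro A.finsum_cong' refl) (use k in \<open>auto simp: add_apply A.l_distr clo\<close>)
    also have "\<dots> = (x \<otimes>\<^bsub>S\<^esub> z \<oplus>\<^bsub>S\<^esub> y \<otimes>\<^bsub>S\<^esub> z) k"
      unfolding add_apply[OF k] mult_apply[OF k]
      by (intro A.finsum_addf) (use k in \<open>auto simp: clo\<close>)
    finally show "((x \<oplus>\<^bsub>S\<^esub> y) \<otimes>\<^bsub>S\<^esub> z) k = (x \<otimes>\<^bsub>S\<^esub> z \<oplus>\<^bsub>S\<^esub> y \<otimes>\<^bsub>S\<^esub> z) k" .
  qed (intro smash_mult_closed smash_add_closed xyz)+
  show "z \<otimes>\<^bsub>S\<^esub> (x \<oplus>\<^bsub>S\<^esub> y) = z \<otimes>\<^bsub>S\<^esub> x \<oplus>\<^bsub>S\<^esub> z \<otimes>\<^bsub>S\<^esub> y"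
  proof (rule smash_eqI)
    fix k assume k: "k \<in> carrier G"
    have "(z \<otimes>\<^bsub>S\<^esub> (x \<oplus>\<^bsub>S\<^esub> y)) k = (\<Oplus>\<^bsub>A\<^esub>g\<in>carrier G. z g \<otimes>\<^bsub>A\<^esub> \<alpha> g (x (inv\<^bsub>G\<^esub> g \<otimes>\<^bsub>G\<^esub> k)) \<oplus>\<^bsub>A\<^esub> z g \<otimes>\<^bsub>A\<^esub> \<alpha> g (y (inv\<^bsub>G\<^esub> g \<otimes>\<^bsub>G\<^esub> k)))"
      unfolding mult_apply[OF k]
      by (intro A.finsum_cong' refl) (use k in \<open>auto simp: add_apply A.r_distr act_add clo\<close>)
    also have "\<dots> = (z \<otimes>\<^bsub>S\<^esub> x \<oplus>\<^bsub>S\<^esub> z \<otimes>\<^bsub>S\<^esub> y) k"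
      unfolding add_apply[OF k] mult_apply[OF k]
      by (intro A.finsum_addf) (use k in \<open>auto simp: clo\<close>)
    finally show "(z \<otimes>\<^bsub>S\<^esub> (x \<oplus>\<^bsub>S\<^esub> y)) k = (z \<otimes>\<^bsub>S\<^esub> x \<oplus>\<^bsub>S\<^esub> z \<otimes>\<^bsub>S\<^esub> y) k" .
  qed (intro smash_mult_closed smash_add_closed xyz)+
qed

text \<open>The last case concerns only the coefficients of \<open>f\<close> itself, so that
  properties known for these coefficients can be exploited.\<close>

lemma smash_induct [consumes 1, case_names zero add single]:
  assumes f: "f \<in> carrier S"
    and zero: "P \<zero>\<^bsub>S\<^esub>"
    and add: "\<And>f h. f \<in> carrier S \<Longrightarrow> h \<in> carrier S \<Longrightarrow> P f \<Longrightarrow> P h \<Longrightarrow> P (f \<oplus>\<^bsub>S\<^esub> h)"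
    and single: "\<And>g. g \<in> carrier G \<Longrightarrow> P (single g (f g))"
  shows "P f"
proof -
  define cut where "cut T = (\<lambda>k\<in>carrier G. if k \<in> T then f k else \<zero>\<^bsub>A\<^esub>)" for T
  have cut: "cut T \<in> carrier S" for T
    using f by (auto simp: cut_def carrier_smash)
  have "P (cut T)" if "finite T" "T \<subseteq> carrier G" for T
    using that
  proof (induction T)
    case empty
    have "cut {} = \<zero>\<^bsub>S\<^esub>" by (simp add: cut_def zero_smash)
    then show ?case using zero by (simp only:)
  next
    case (insert g T)
    have "cut (insert g T) = single g (f g) \<oplus>\<^bsub>S\<^esub> cut T"
      using insert f by (intro smash_eqI smash_add_closed single_closed cut)
        (auto simp: cut_def single_def add_smash smash_apply)
    then show ?case
      using insert f by (auto intro!: add single single_closed cut smash_apply)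
  qed
  from this[OF finite_carrier] have "P (cut (carrier G))" by simp
  moreover have "cut (carrier G) = f"
    by (rule smash_eqI[OF cut f]) (simp add: cut_def)
  ultimately show ?thesis by simp
qed

end

text \<open>Every element of \<open>B\<close> lifts to \<open>A\<close>, where the laws hold. The
  actions on the tensor and symmetric algebras arise in this way from the action on words.\<close>

lemma ring_action_transport:
  assumes A: "ring_action A G \<alpha>" and \<pi>: "surj_ring_hom A B \<pi>"
    and eq: "\<And>g a. g \<in> carrier G \<Longrightarrow> a \<in> carrier A \<Longrightarrow> \<beta> g (\<pi> a) = \<pi> (\<alpha> g a)"
  shows "ring_action B G \<beta>"
proof -
  interpret A: ring_action A G \<alpha> by fact
  interpret \<pi>: surj_ring_hom A B \<pi> by fact
  show ?thesis
  proof
    show "\<beta> g \<in> ring_hom B B" if g: "g \<in> carrier G" for g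
    proof (rule ring_hom_memI)
      fix x y assume "x \<in> carrier B" "y \<in> carrier B"
      then obtain a b where ab: "x = \<pi> a" "a \<in> carrier A" "y = \<pi> b" "b \<in> carrier A"
        using \<pi>.lift by blast
      show "\<beta> g x \<in> carrier B" using ab g by (simp add: eq A.act_closed)
      show "\<beta> g (x \<otimes>\<^bsub>B\<^esub> y) = \<beta> g x \<otimes>\<^bsub>B\<^esub> \<beta> g y"
        using eq[OF g, of "a \<otimes>\<^bsub>A\<^esub> b"] ab g by (simp add: eq A.act_m A.act_closed)
      show "\<beta> g (x \<oplus>\<^bsub>B\<^esub> y) = \<beta> g x \<oplus>\<^bsub>B\<^esub> \<beta> g y"
        using eq[OF g, of "a \<oplus>\<^bsub>A\<^esub> b"] ab g by (simp add: eq A.act_add A.act_closed)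
    next
      show "\<beta> g \<one>\<^bsub>B\<^esub> = \<one>\<^bsub>B\<^esub>"
        using eq[OF g A.A.one_closed] g by (simp add: A.act_unit)
    qed
    fix x assume "x \<in> carrier B"
    then obtain a where a: "x = \<pi> a" "a \<in> carrier A" using \<pi>.lift by blast
    show "\<beta> \<one>\<^bsub>G\<^esub> x = x" using a by (simp add: eq A.act_one)
    fix g h assume "g \<in> carrier G" "h \<in> carrier G"
    then show "\<beta> (g \<otimes>\<^bsub>G\<^esub> h) x = \<beta> g (\<beta> h x)" using a by (simp add: eq A.act_mult A.act_closed)
  qed (rule A.finite_carrier)
qed

lemma smash_map_surj_ring_hom:
  assumes A: "ring_action A G \<alpha>" and B: "ring_action B G \<beta>" and \<pi>: "surj_ring_hom A B \<pi>"
    and eq: "\<And>g a. g \<in> carrier G \<Longrightarrow> a \<in> carrier A \<Longrightarrow> \<beta> g (\<pi> a) = \<pi> (\<alpha> g a)"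
  shows "surj_ring_hom (smash G A \<alpha>) (smash G B \<beta>) (\<lambda>f. \<lambda>g\<in>carrier G. \<pi> (f g))"
proof -
  interpret A: ring_action A G \<alpha> by fact
  interpret B: ring_action B G \<beta> by fact
  interpret \<pi>: surj_ring_hom A B \<pi> by fact
  let ?h = "\<lambda>f. \<lambda>g\<in>carrier G. \<pi> (f g)"
  have clo: "?h f \<in> carrier B.S" if "f \<in> carrier A.S" for f
    using that by (auto simp: B.carrier_smash A.smash_apply)
  have "?h \<in> ring_hom A.S B.S"
  proof (rule ring_hom_memI)
    fix f f' assume f: "f \<in> carrier A.S" "f' \<in> carrier A.S"
    show "?h f \<in> carrier B.S" by (rule clo[OF f(1)])
    show "?h (f \<oplus>\<^bsub>A.S\<^esub> f') = ?h f \<oplus>\<^bsub>B.S\<^esub> ?h f'"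
      using f by (auto simp: A.add_smash B.add_smash A.smash_apply)
    show "?h (f \<otimes>\<^bsub>A.S\<^esub> f') = ?h f \<otimes>\<^bsub>B.S\<^esub> ?h f'"
    proof (rule B.smash_eqI)
      fix k assume k: "k \<in> carrier G"
      have "?h (f \<otimes>\<^bsub>A.S\<^esub> f') k = \<pi> (\<Oplus>\<^bsub>A\<^esub>g\<in>carrier G. f g \<otimes>\<^bsub>A\<^esub> \<alpha> g (f' (inv\<^bsub>G\<^esub> g \<otimes>\<^bsub>G\<^esub> k)))"
        using k by (simp add: A.mult_smash)
      also have "\<dots> = (\<Oplus>\<^bsub>B\<^esub>g\<in>carrier G. \<pi> (f g \<otimes>\<^bsub>A\<^esub> \<alpha> g (f' (inv\<^bsub>G\<^esub> g \<otimes>\<^bsub>G\<^esub> k))))"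
        using \<pi>.hom_finsum[OF A.mult_apply_closed[OF f k]] by (simp add: comp_def)
      also have "\<dots> = (?h f \<otimes>\<^bsub>B.S\<^esub> ?h f') k"
        using f k by (auto simp: B.mult_smash A.smash_apply A.act_closed eq intro!: B.A.finsum_cong')
      finally show "?h (f \<otimes>\<^bsub>A.S\<^esub> f') k = (?h f \<otimes>\<^bsub>B.S\<^esub> ?h f') k" .
    qed (intro clo A.smash_mult_closed B.smash_mult_closed f)+
  next
    show "?h \<one>\<^bsub>A.S\<^esub> = \<one>\<^bsub>B.S\<^esub>"
      by (auto simp: A.one_smash B.one_smash)
  qed
  moreover have "?h ` carrier A.S = carrier B.S"
  proof
    show "carrier B.S \<subseteq> ?h ` carrier A.S"
    proof
      fix f assume f: "f \<in> carrier B.S"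
      then have "\<forall>g\<in>carrier G. \<exists>a. a \<in> carrier A \<and> f g = \<pi> a"
        using \<pi>.lift B.smash_apply by blast
      then obtain l where l: "\<And>g. g \<in> carrier G \<Longrightarrow> l g \<in> carrier A \<and> f g = \<pi> (l g)" by metis
      have "f = ?h (restrict l (carrier G))"
        by (rule B.smash_eqI[OF f clo]) (use l in \<open>auto simp: A.carrier_smash\<close>)
      then show "f \<in> ?h ` carrier A.S"
        using l by (auto simp: A.carrier_smash intro!: image_eqI[of _ ?h "restrict l (carrier G)"])
    qed
  qed (use clo in auto)
  ultimately show ?thesis
    by (intro surj_ring_hom.intro surj_ring_hom_axioms.intro ring_hom_ringI2 A.smash_ring B.smash_ring)
qed

section \<open>The word algebra and its quotients\<close>

lemma carrier_word_algebra: "f \<in> carrier word_algebra \<longleftrightarrow> finite {w. f w \<noteq> 0}"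
  and zero_word_algebra: "\<zero>\<^bsub>word_algebra\<^esub> = (\<lambda>w. 0)"
  and one_word_algebra: "\<one>\<^bsub>word_algebra\<^esub> = monomial 1 []"
  and add_word_algebra: "f \<oplus>\<^bsub>word_algebra\<^esub> h = (\<lambda>w. f w + h w)"
  and mult_word_algebra: "f \<otimes>\<^bsub>word_algebra\<^esub> h = (\<lambda>w. \<Sum>i\<le>length w. f (take i w) * h (drop i w))"
  by (simp_all add: word_algebra_def monomial_def fun_eq_iff)

lemma word_algebra_mult_closed:
  assumes "f \<in> carrier word_algebra" "h \<in> carrier word_algebra"
  shows "f \<otimes>\<^bsub>word_algebra\<^esub> h \<in> carrier word_algebra"
proof -
  have "{w. (f \<otimes>\<^bsub>word_algebra\<^esub> h) w \<noteq> 0} \<subseteq> (\<lambda>(u, v). u @ v) ` ({w. f w \<noteq> 0} \<times> {w. h w \<noteq> 0})"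
  proof
    fix w assume "w \<in> {w. (f \<otimes>\<^bsub>word_algebra\<^esub> h) w \<noteq> 0}"
    then obtain i where "f (take i w) * h (drop i w) \<noteq> 0"
      by (auto simp: mult_word_algebra elim: sum.not_neutral_contains_not_neutral)
    then show "w \<in> (\<lambda>(u, v). u @ v) ` ({w. f w \<noteq> 0} \<times> {w. h w \<noteq> 0})"
      by (intro image_eqI[of _ _ "(take i w, drop i w)"]) auto
  qed
  then show ?thesis
    using assms finite_subset unfolding carrier_word_algebra by blast
qed

lemma word_algebra_assoc:
  fixes f h l :: "'a list \<Rightarrow> complex"
  shows
  "f \<otimes>\<^bsub>word_algebra\<^esub> h \<otimes>\<^bsub>word_algebra\<^esub> l = f \<otimes>\<^bsub>word_algebra\<^esub> (h \<otimes>\<^bsub>word_algebra\<^esub> l)"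
proof (rule ext)
  fix w :: "'a list"
  let ?n = "length w"
  have "(f \<otimes>\<^bsub>word_algebra\<^esub> h \<otimes>\<^bsub>word_algebra\<^esub> l) w
      = (\<Sum>i\<le>?n. \<Sum>j\<le>i. f (take j w) * h (take (i - j) (drop j w)) * l (drop i w))"
    unfolding mult_word_algebra sum_distrib_right
    by (intro sum.cong refl) (auto simp: drop_take min_def)
  also have "\<dots> = (\<Sum>(i, j)\<in>Sigma {..?n} (\<lambda>i. {..i}). f (take j w) * h (take (i - j) (drop j w)) * l (drop i w))"
    by (simp add: sum.Sigma)
  \<comment> \<open>A splitting into three factors is recorded by two cut points or by the lengths
    of the first two factors.\<close>
  also have "\<dots> = (\<Sum>(j, k)\<in>Sigma {..?n} (\<lambda>j. {..?n - j}). f (take j w) * (h (take k (drop j w)) * l (drop k (drop j w))))"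
    by (rule sum.reindex_bij_witness[where i = "\<lambda>(j, k). (j + k, j)" and j = "\<lambda>(i, j). (j, i - j)"]) auto
  also have "\<dots> = (f \<otimes>\<^bsub>word_algebra\<^esub> (h \<otimes>\<^bsub>word_algebra\<^esub> l)) w"
    by (simp add: mult_word_algebra sum_distrib_left sum.Sigma)
  finally show "(f \<otimes>\<^bsub>word_algebra\<^esub> h \<otimes>\<^bsub>word_algebra\<^esub> l) w = (f \<otimes>\<^bsub>word_algebra\<^esub> (h \<otimes>\<^bsub>word_algebra\<^esub> l)) w" .
qed

lemma monomial_closed: "monomial a w \<in> carrier word_algebra"
  by (simp add: carrier_word_algebra monomial_def)

lemma monomial_mult_apply:
  "(monomial a u \<otimes>\<^bsub>word_algebra\<^esub> f) w = (if take (length u) w = u then a * f (drop (length u) w) else 0)"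
proof -
  have "(monomial a u \<otimes>\<^bsub>word_algebra\<^esub> f) w
      = (\<Sum>i\<le>length w. if i = length u then (if take (length u) w = u then a * f (drop (length u) w) else 0) else 0)"
    unfolding mult_word_algebra by (intro sum.cong refl) (auto simp: monomial_def)
  also have "\<dots> = (if take (length u) w = u then a * f (drop (length u) w) else 0)"
    by auto
  finally show ?thesis .
qed

lemma monomial_mult: "monomial a u \<otimes>\<^bsub>word_algebra\<^esub> monomial b v = monomial (a * b) (u @ v)"
proof
  fix w
  have "w = u @ v \<longleftrightarrow> take (length u) w = u \<and> drop (length u) w = v"
    by (metis append_eq_conv_conj)
  then show "(monomial a u \<otimes>\<^bsub>word_algebra\<^esub> monomial b v) w = monomial (a * b) (u @ v) w"
    unfolding monomial_mult_apply by (simp add: monomial_def)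
qed

lemma mult_monomial_Nil: "f \<otimes>\<^bsub>word_algebra\<^esub> monomial a [] = (\<lambda>w. f w * a)"
proof
  fix w
  have "(f \<otimes>\<^bsub>word_algebra\<^esub> monomial a []) w = (\<Sum>i\<le>length w. if i = length w then f w * a else 0)"
    unfolding mult_word_algebra by (intro sum.cong refl) (auto simp: monomial_def)
  then show "(f \<otimes>\<^bsub>word_algebra\<^esub> monomial a []) w = f w * a" by simp
qed

lemma word_algebra_ring: "ring word_algebra"
proof (rule ringI)
  have add: "f \<oplus>\<^bsub>word_algebra\<^esub> h \<in> carrier word_algebra"
    if "f \<in> carrier word_algebra" "h \<in> carrier word_algebra" for f h :: "'a list \<Rightarrow> complex"
  proof -
    have "{w. f w + h w \<noteq> 0} \<subseteq> {w. f w \<noteq> 0} \<union> {w. h w \<noteq> 0}" by auto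
    then show ?thesis
      using that finite_subset unfolding carrier_word_algebra add_word_algebra by blast
  qed
  show "abelian_group (word_algebra :: ('a list \<Rightarrow> complex) ring)"
  proof (rule abelian_groupI)
    fix f :: "'a list \<Rightarrow> complex" assume "f \<in> carrier word_algebra"
    then show "\<exists>h\<in>carrier word_algebra. h \<oplus>\<^bsub>word_algebra\<^esub> f = \<zero>\<^bsub>word_algebra\<^esub>"
      by (intro bexI[of _ "\<lambda>w. - f w"]) (auto simp: carrier_word_algebra add_word_algebra zero_word_algebra)
  qed (use add in \<open>auto simp: zero_word_algebra add_word_algebra carrier_word_algebra add_ac\<close>)
  show "Group.monoid (word_algebra :: ('a list \<Rightarrow> complex) ring)"
    by (rule monoidI)
      (auto simp: word_algebra_mult_closed word_algebra_assoc one_word_algebra monomial_closed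
        mult_monomial_Nil monomial_mult_apply fun_eq_iff)
qed (simp_all add: add_word_algebra mult_word_algebra algebra_simps sum.distrib)

interpretation word_algebra: ring word_algebra
  by (rule word_algebra_ring)

lemma uminus_word_algebra:
  assumes "f \<in> carrier word_algebra"
  shows "\<ominus>\<^bsub>word_algebra\<^esub> f = (\<lambda>w. - f w)"
proof (rule word_algebra.minus_equality)
  show "(\<lambda>w. - f w) \<oplus>\<^bsub>word_algebra\<^esub> f = \<zero>\<^bsub>word_algebra\<^esub>"
    by (simp add: add_word_algebra zero_word_algebra)
qed (use assms in \<open>auto simp: carrier_word_algebra\<close>)

lemma minus_word_algebra:
  "h \<in> carrier word_algebra \<Longrightarrow> f \<ominus>\<^bsub>word_algebra\<^esub> h = (\<lambda>w. f w - h w)"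
  by (simp add: a_minus_def uminus_word_algebra add_word_algebra)

lemma word_algebra_induct [consumes 1, case_names add monomial]:
  assumes f: "f \<in> carrier word_algebra"
    and add: "\<And>f h. f \<in> carrier word_algebra \<Longrightarrow> h \<in> carrier word_algebra \<Longrightarrow> P f \<Longrightarrow> P h \<Longrightarrow> P (f \<oplus>\<^bsub>word_algebra\<^esub> h)"
    and monomial: "\<And>a w. P (monomial a w)"
  shows "P f"
proof -
  define cut where "cut T = (\<lambda>w. if w \<in> T then f w else 0)" for T
  have "P (cut T) \<and> cut T \<in> carrier word_algebra" if "finite T" for T
    using that
  proof (induction T)
    case empty
    have "cut {} = monomial 0 []" by (auto simp: cut_def monomial_def)
    then show ?case using monomial monomial_closed by metis
  next
    case (insert w T)
    have "cut (insert w T) = monomial (f w) w \<oplus>\<^bsub>word_algebra\<^esub> cut T"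
      using insert.hyps by (auto simp: cut_def monomial_def add_word_algebra fun_eq_iff)
    then show ?case
      using insert by (auto intro!: add monomial monomial_closed word_algebra.add.m_closed)
  qed
  moreover have "cut {w. f w \<noteq> 0} = f" by (auto simp: cut_def)
  ultimately show ?thesis
    using f unfolding carrier_word_algebra by metis
qed

text \<open>A stable set generates a stable ideal, and on it \<open>\<alpha> g\<close> is invertible
  with inverse \<open>\<alpha> (g^-1)\<close>, so cosets go onto cosets. This shows that the
  elementwise actions \<open>tensor_act\<close> and \<open>sym_act\<close> act on the
  quotients.\<close>

lemma (in ring_action) act_genideal_coset:
  assumes X: "X \<subseteq> carrier A" and inv: "\<And>g x. g \<in> carrier G \<Longrightarrow> x \<in> X \<Longrightarrow> \<alpha> g x \<in> X"
    and g: "g \<in> carrier G" and a: "a \<in> carrier A"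
  shows "\<alpha> g ` (Idl\<^bsub>A\<^esub> X +>\<^bsub>A\<^esub> a) = Idl\<^bsub>A\<^esub> X +>\<^bsub>A\<^esub> \<alpha> g a"
proof -
  interpret I: ideal "Idl\<^bsub>A\<^esub> X" A by (rule A.genideal_ideal[OF X])
  have sub: "\<alpha> g ` (Idl\<^bsub>A\<^esub> X) \<subseteq> Idl\<^bsub>A\<^esub> X" if g: "g \<in> carrier G" for g
  proof -
    interpret h: ring_hom_ring A A "\<alpha> g" by (rule act_ring_hom[OF g])
    have "Idl\<^bsub>A\<^esub> X \<subseteq> {r \<in> carrier A. \<alpha> g r \<in> Idl\<^bsub>A\<^esub> X}"
      by (rule A.genideal_minimal[OF h.ideal_vimage[OF I.is_ideal]])
        (use X inv[OF g] A.genideal_self[OF X] in auto)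
    then show ?thesis by auto
  qed
  have "\<alpha> g ` (Idl\<^bsub>A\<^esub> X) = Idl\<^bsub>A\<^esub> X"
  proof
    show "Idl\<^bsub>A\<^esub> X \<subseteq> \<alpha> g ` (Idl\<^bsub>A\<^esub> X)"
    proof
      fix x assume x: "x \<in> Idl\<^bsub>A\<^esub> X"
      then have "\<alpha> (inv\<^bsub>G\<^esub> g) x \<in> Idl\<^bsub>A\<^esub> X" using sub[of "inv\<^bsub>G\<^esub> g"] g by auto
      moreover have "\<alpha> g (\<alpha> (inv\<^bsub>G\<^esub> g) x) = x"
        using g x I.Icarr act_mult[of g "inv\<^bsub>G\<^esub> g" x] by (simp add: act_one)
      ultimately show "x \<in> \<alpha> g ` (Idl\<^bsub>A\<^esub> X)" by force
    qed
  qed (rule sub[OF g])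
  then have img: "\<And>i. i \<in> Idl\<^bsub>A\<^esub> X \<Longrightarrow> \<alpha> g i \<in> Idl\<^bsub>A\<^esub> X"
    "\<And>i. i \<in> Idl\<^bsub>A\<^esub> X \<Longrightarrow> \<exists>j\<in>Idl\<^bsub>A\<^esub> X. i = \<alpha> g j" by auto
  show ?thesis
  proof
    show "\<alpha> g ` (Idl\<^bsub>A\<^esub> X +>\<^bsub>A\<^esub> a) \<subseteq> Idl\<^bsub>A\<^esub> X +>\<^bsub>A\<^esub> \<alpha> g a"
    proof clarify
      fix y assume "y \<in> Idl\<^bsub>A\<^esub> X +>\<^bsub>A\<^esub> a"
      then obtain i where i: "i \<in> Idl\<^bsub>A\<^esub> X" "y = i \<oplus>\<^bsub>A\<^esub> a"
        unfolding a_r_coset_def' by blast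
      then have "\<alpha> g y = \<alpha> g i \<oplus>\<^bsub>A\<^esub> \<alpha> g a" using g a I.Icarr by (simp add: act_add)
      then show "\<alpha> g y \<in> Idl\<^bsub>A\<^esub> X +>\<^bsub>A\<^esub> \<alpha> g a"
        using img(1)[OF i(1)] unfolding a_r_coset_def' by blast
    qed
    show "Idl\<^bsub>A\<^esub> X +>\<^bsub>A\<^esub> \<alpha> g a \<subseteq> \<alpha> g ` (Idl\<^bsub>A\<^esub> X +>\<^bsub>A\<^esub> a)"
    proof
      fix y assume "y \<in> Idl\<^bsub>A\<^esub> X +>\<^bsub>A\<^esub> \<alpha> g a"
      then obtain j where j: "j \<in> Idl\<^bsub>A\<^esub> X" "y = \<alpha> g j \<oplus>\<^bsub>A\<^esub> \<alpha> g a"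
        unfolding a_r_coset_def' using img(2) by blast
      then have "y = \<alpha> g (j \<oplus>\<^bsub>A\<^esub> a)" using g a I.Icarr by (simp add: act_add)
      then show "y \<in> \<alpha> g ` (Idl\<^bsub>A\<^esub> X +>\<^bsub>A\<^esub> a)"
        using j(1) unfolding a_r_coset_def' by blast
    qed
  qed
qed

lemma surj_ring_hom_comp:
  assumes "surj_ring_hom R S h" "surj_ring_hom S T k"
  shows "surj_ring_hom R T (\<lambda>x. k (h x))"
proof -
  interpret h: surj_ring_hom R S h by fact
  interpret k: surj_ring_hom S T k by fact
  have "(\<lambda>x. k (h x)) \<in> ring_hom R T"
    by (rule ring_hom_memI) auto
  moreover have "(\<lambda>x. k (h x)) ` carrier R = carrier T"
    using h.surj k.surj by (metis image_image)
  ultimately show ?thesis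
    by (intro surj_ring_hom.intro surj_ring_hom_axioms.intro ring_hom_ringI2 h.R.ring_axioms k.S.ring_axioms)
qed

section \<open>Tensor and symmetric algebra as quotients of the word algebra\<close>

definition linearity_relations :: "(complex \<Rightarrow> 'v::ab_group_add \<Rightarrow> 'v) \<Rightarrow> ('v list \<Rightarrow> complex) set" where
  "linearity_relations scale =
     {monomial 1 [x + y] \<ominus>\<^bsub>word_algebra\<^esub> (monomial 1 [x] \<oplus>\<^bsub>word_algebra\<^esub> monomial 1 [y]) | x y. True} \<union>
      {monomial 1 [scale a x] \<ominus>\<^bsub>word_algebra\<^esub> monomial a [x] | a x. True}"

text \<open>Lifts to words of the generators of \<open>sym_ideal\<close>, which itself lives in the
  tensor algebra.\<close>

definition commutators :: "('v list \<Rightarrow> complex) set" where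
  "commutators = {monomial 1 [x] \<otimes>\<^bsub>word_algebra\<^esub> monomial 1 [y]
      \<ominus>\<^bsub>word_algebra\<^esub> monomial 1 [y] \<otimes>\<^bsub>word_algebra\<^esub> monomial 1 [x] | x y. True}"

lemma linearity_relations_eq:
  fixes scale :: "complex \<Rightarrow> 'v::ab_group_add \<Rightarrow> 'v"
  shows "linearity_relations scale =
     {\<lambda>w. monomial 1 [x + y] w - (monomial 1 [x] w + monomial 1 [y] w) | x y. True} \<union>
     {\<lambda>w. monomial 1 [scale a x] w - monomial a [x] w | a x. True}"
proof -
  have "monomial 1 [x + y] \<ominus>\<^bsub>word_algebra\<^esub> (monomial 1 [x] \<oplus>\<^bsub>word_algebra\<^esub> monomial 1 [y])
      = (\<lambda>w. monomial 1 [x + y] w - (monomial 1 [x] w + monomial 1 [y] w))" for x y :: 'v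
    by (subst minus_word_algebra[OF word_algebra.add.m_closed[OF monomial_closed monomial_closed]])
      (simp add: add_word_algebra)
  then show ?thesis
    unfolding linearity_relations_def minus_word_algebra[OF monomial_closed] by simp
qed

lemma linearity_relations_carrier: "linearity_relations scale \<subseteq> carrier word_algebra"
  by (auto simp: linearity_relations_def monomial_closed)

lemma commutators_carrier: "commutators \<subseteq> carrier word_algebra"
  by (auto simp: commutators_def monomial_closed)

lemma tensor_ideal_eq: "tensor_ideal scale = Idl\<^bsub>word_algebra\<^esub> (linearity_relations scale)"
  by (simp add: tensor_ideal_def linearity_relations_def)

lemma ideal_tensor_ideal: "ideal (tensor_ideal scale) word_algebra"
  unfolding tensor_ideal_eq by (rule word_algebra.genideal_ideal[OF linearity_relations_carrier])

lemma tensor_surj: "surj_ring_hom word_algebra (tensor_algebra scale) (tensor_class scale)"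
  unfolding tensor_algebra_def tensor_class_def[abs_def]
  by (rule ideal.quotient_surj_ring_hom[OF ideal_tensor_ideal])

interpretation tensor: surj_ring_hom word_algebra "tensor_algebra scale" "tensor_class scale" for scale
  by (rule tensor_surj)

lemma sym_ideal_eq: "sym_ideal scale = Idl\<^bsub>tensor_algebra scale\<^esub> (tensor_class scale ` commutators)"
proof -
  have eq: "tensor_class scale (monomial 1 [x] \<otimes>\<^bsub>word_algebra\<^esub> monomial 1 [y]
      \<ominus>\<^bsub>word_algebra\<^esub> monomial 1 [y] \<otimes>\<^bsub>word_algebra\<^esub> monomial 1 [x])
    = tensor_class scale (monomial 1 [x]) \<otimes>\<^bsub>tensor_algebra scale\<^esub> tensor_class scale (monomial 1 [y])
      \<ominus>\<^bsub>tensor_algebra scale\<^esub>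
      tensor_class scale (monomial 1 [y]) \<otimes>\<^bsub>tensor_algebra scale\<^esub> tensor_class scale (monomial 1 [x])"
    for x y
    by (simp add: a_minus_def monomial_closed)
  have "tensor_class scale ` commutators = {tensor_class scale (monomial 1 [x]) \<otimes>\<^bsub>tensor_algebra scale\<^esub> tensor_class scale (monomial 1 [y])
      \<ominus>\<^bsub>tensor_algebra scale\<^esub>
      tensor_class scale (monomial 1 [y]) \<otimes>\<^bsub>tensor_algebra scale\<^esub> tensor_class scale (monomial 1 [x]) | x y. True}"
    unfolding commutators_def by (auto simp: eq[symmetric] image_iff)
  then show ?thesis unfolding sym_ideal_def by simp
qed

lemma sym_gens_carrier: "tensor_class scale ` commutators \<subseteq> carrier (tensor_algebra scale)"
  using commutators_carrier by auto

lemma ideal_sym_ideal: "ideal (sym_ideal scale) (tensor_algebra scale)"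
  unfolding sym_ideal_eq by (rule tensor.S.genideal_ideal[OF sym_gens_carrier])

lemma sym_surj: "surj_ring_hom (tensor_algebra scale) (sym_algebra scale) ((+>\<^bsub>tensor_algebra scale\<^esub>) (sym_ideal scale))"
  unfolding sym_algebra_def by (rule ideal.quotient_surj_ring_hom[OF ideal_sym_ideal])

lemma word_sym_surj: "surj_ring_hom word_algebra (sym_algebra scale) (sym_class scale)"
  unfolding sym_class_def[abs_def] by (rule surj_ring_hom_comp[OF tensor_surj sym_surj])

interpretation sym: surj_ring_hom word_algebra "sym_algebra scale" "sym_class scale" for scale
  by (rule word_sym_surj)

lemma tensor_class_eq_0_iff:
  "f \<in> carrier word_algebra \<Longrightarrow> tensor_class scale f = \<zero>\<^bsub>tensor_algebra scale\<^esub> \<longleftrightarrow> f \<in> tensor_ideal scale"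
  unfolding tensor_class_def tensor_algebra_def by (rule ideal.coset_eq_zero_iff[OF ideal_tensor_ideal])

lemma tensor_class_eq_0_mem:
  assumes "ideal Z word_algebra" "linearity_relations scale \<subseteq> Z"
    and "f \<in> carrier word_algebra" "tensor_class scale f = \<zero>\<^bsub>tensor_algebra scale\<^esub>"
  shows "f \<in> Z"
  using word_algebra.genideal_minimal[OF assms(1,2)] assms(3,4)
  by (auto simp: tensor_class_eq_0_iff tensor_ideal_eq)

text \<open>The quotient is taken in two steps, and each kernel is pulled back to words. The lemma
  serves for ideals \<open>Z\<close> cut out by a property that is easy to verify on the two sets of
  relations.\<close>

lemma sym_class_eq_0_mem:
  assumes Z: "ideal Z word_algebra" "linearity_relations scale \<subseteq> Z" "commutators \<subseteq> Z"
    and f: "f \<in> carrier word_algebra" "sym_class scale f = \<zero>\<^bsub>sym_algebra scale\<^esub>"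
  shows "f \<in> Z"
proof (rule tensor.mem_of_hom_mem_genideal[OF Z(1,3)])
  show "tensor_class scale f \<in> Idl\<^bsub>tensor_algebra scale\<^esub> (tensor_class scale ` commutators)"
    using f unfolding sym_class_def sym_algebra_def sym_ideal_eq[symmetric]
    by (subst (asm) ideal.coset_eq_zero_iff[OF ideal_sym_ideal]) auto
qed (use f tensor_class_eq_0_mem[OF Z(1,2)] in auto)

lemma sym_class_relations:
  "f \<in> linearity_relations scale \<union> commutators \<Longrightarrow> sym_class scale f = \<zero>\<^bsub>sym_algebra scale\<^esub>"
proof -
  assume f: "f \<in> linearity_relations scale \<union> commutators"
  then have fW: "f \<in> carrier word_algebra" using linearity_relations_carrier commutators_carrier by auto
  have "tensor_class scale f \<in> sym_ideal scale"
  proof (cases "f \<in> commutators")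
    case True
    then show ?thesis unfolding sym_ideal_eq using tensor.S.genideal_self[OF sym_gens_carrier] by auto
  next
    case False
    then have "f \<in> tensor_ideal scale"
      using f word_algebra.genideal_self[OF linearity_relations_carrier] unfolding tensor_ideal_eq by blast
    then show ?thesis
      using fW tensor_class_eq_0_iff[of f scale]
        additive_subgroup.zero_closed[OF ideal.axioms(1)[OF ideal_sym_ideal]] by simp
  qed
  then show ?thesis
    unfolding sym_class_def sym_algebra_def using fW by (subst ideal.coset_eq_zero_iff[OF ideal_sym_ideal]) auto
qed

section \<open>The group action on the quotients, and the algebra \<open>H\<close>\<close>

context wedge_setting
begin

lemma act_inv_cancel: "g \<in> carrier G \<Longrightarrow> \<rho> (inv g) (\<rho> g x) = x"
  and act_cancel_inv: "g \<in> carrier G \<Longrightarrow> \<rho> g (\<rho> (inv g) x) = x"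
  using act_mult[of "inv g" g x] act_mult[of g "inv g" x] act_one by simp_all

lemma map_act_eq_iff: "g \<in> carrier G \<Longrightarrow> map (\<rho> (inv g)) u = w \<longleftrightarrow> u = map (\<rho> g) w"
  by (auto simp: comp_def act_inv_cancel act_cancel_inv)

lemma word_act_monomial: "g \<in> carrier G \<Longrightarrow> word_act G \<rho> g (monomial a w) = monomial a (map (\<rho> g) w)"
  by (simp add: word_act_def monomial_def map_act_eq_iff)

lemma word_act_closed:
  assumes "g \<in> carrier G" "f \<in> carrier word_algebra"
  shows "word_act G \<rho> g f \<in> carrier word_algebra"
proof -
  have "{w. word_act G \<rho> g f w \<noteq> 0} \<subseteq> map (\<rho> g) ` {w. f w \<noteq> 0}"
  proof
    fix w assume "w \<in> {w. word_act G \<rho> g f w \<noteq> 0}"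
    then show "w \<in> map (\<rho> g) ` {w. f w \<noteq> 0}"
      using assms by (intro image_eqI[of _ _ "map (\<rho> (inv g)) w"])
        (auto simp: word_act_def comp_def act_cancel_inv)
  qed
  then show ?thesis using assms unfolding carrier_word_algebra by (meson finite_imageI finite_subset)
qed

lemma word_action: "ring_action word_algebra G (word_act G \<rho>)"
proof
  show "word_act G \<rho> g \<in> ring_hom word_algebra word_algebra" if g: "g \<in> carrier G" for g
    by (rule ring_hom_memI)
      (use g in \<open>auto simp: word_act_closed one_word_algebra word_act_monomial\<close>,
       auto simp: word_act_def mult_word_algebra add_word_algebra take_map drop_map)
  show "word_act G \<rho> \<one> f = f" for f
    using act_one by (simp add: word_act_def list.map_ident cong: map_cong)
  show "word_act G \<rho> (g \<otimes> h) f = word_act G \<rho> g (word_act G \<rho> h f)"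
    if "g \<in> carrier G" "h \<in> carrier G" for g h f
  proof -
    have "\<rho> (inv h \<otimes> inv g) = (\<lambda>x. \<rho> (inv h) (\<rho> (inv g) x))"
      using that by (auto simp: act_mult)
    then show ?thesis using that by (simp add: word_act_def G.inv_mult_group comp_def)
  qed
qed (rule finite_G)

sublocale word: ring_action word_algebra G "word_act G \<rho>"
  by (rule word_action)

lemma tensor_act_class:
  assumes "g \<in> carrier G" "f \<in> carrier word_algebra"
  shows "tensor_act G \<rho> g (tensor_class scale f) = tensor_class scale (word_act G \<rho> g f)"
  unfolding tensor_act_def tensor_class_def tensor_ideal_eq
proof (rule word.act_genideal_coset[OF linearity_relations_carrier _ assms])
  fix g f assume g: "g \<in> carrier G" and f: "f \<in> linearity_relations scale"
  have eq: "word_act G \<rho> g (f \<ominus>\<^bsub>word_algebra\<^esub> h) = word_act G \<rho> g f \<ominus>\<^bsub>word_algebra\<^esub> word_act G \<rho> g h"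
    if "f \<in> carrier word_algebra" "h \<in> carrier word_algebra" for f h :: "'v list \<Rightarrow> complex"
    using that g word_act_closed[of g h] by (auto simp: minus_word_algebra word_act_def)
  show "word_act G \<rho> g f \<in> linearity_relations scale"
    using f unfolding linearity_relations_def
  proof (elim UnE CollectE exE conjE)
    fix x y assume "f = monomial 1 [x + y] \<ominus>\<^bsub>word_algebra\<^esub> (monomial 1 [x] \<oplus>\<^bsub>word_algebra\<^esub> monomial 1 [y])"
    then have "word_act G \<rho> g f = monomial 1 [\<rho> g x + \<rho> g y]
        \<ominus>\<^bsub>word_algebra\<^esub> (monomial 1 [\<rho> g x] \<oplus>\<^bsub>word_algebra\<^esub> monomial 1 [\<rho> g y])"
      using g by (simp add: eq monomial_closed word.act_add word_act_monomial act_add)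
    then show "word_act G \<rho> g f \<in> {monomial 1 [x + y] \<ominus>\<^bsub>word_algebra\<^esub> (monomial 1 [x] \<oplus>\<^bsub>word_algebra\<^esub> monomial 1 [y]) | x y. True}
        \<union> {monomial 1 [scale a x] \<ominus>\<^bsub>word_algebra\<^esub> monomial a [x] | a x. True}" by blast
  next
    fix a x assume "f = monomial 1 [scale a x] \<ominus>\<^bsub>word_algebra\<^esub> monomial a [x]"
    then have "word_act G \<rho> g f = monomial 1 [scale a (\<rho> g x)] \<ominus>\<^bsub>word_algebra\<^esub> monomial a [\<rho> g x]"
      using g by (simp add: eq monomial_closed word_act_monomial act_scale)
    then show "word_act G \<rho> g f \<in> {monomial 1 [x + y] \<ominus>\<^bsub>word_algebra\<^esub> (monomial 1 [x] \<oplus>\<^bsub>word_algebra\<^esub> monomial 1 [y]) | x y. True}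
        \<union> {monomial 1 [scale a x] \<ominus>\<^bsub>word_algebra\<^esub> monomial a [x] | a x. True}" by blast
  qed
qed

lemma tensor_action: "ring_action (tensor_algebra scale) G (tensor_act G \<rho>)"
  by (rule ring_action_transport[OF word_action tensor_surj]) (rule tensor_act_class)

sublocale tensor: ring_action "tensor_algebra scale" G "tensor_act G \<rho>"
  by (rule tensor_action)

lemma sym_act_class:
  assumes "g \<in> carrier G" "X \<in> carrier (tensor_algebra scale)"
  shows "sym_act G \<rho> g (sym_ideal scale +>\<^bsub>tensor_algebra scale\<^esub> X)
       = sym_ideal scale +>\<^bsub>tensor_algebra scale\<^esub> tensor_act G \<rho> g X"
  unfolding sym_act_def sym_ideal_eq
proof (rule tensor.act_genideal_coset[OF sym_gens_carrier _ assms])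
  fix g X assume g: "g \<in> carrier G" and "X \<in> tensor_class scale ` commutators"
  then obtain x y where X: "X = tensor_class scale (monomial 1 [x] \<otimes>\<^bsub>word_algebra\<^esub> monomial 1 [y]
      \<ominus>\<^bsub>word_algebra\<^esub> monomial 1 [y] \<otimes>\<^bsub>word_algebra\<^esub> monomial 1 [x])"
    unfolding commutators_def by auto
  have eq: "word_act G \<rho> g (f \<ominus>\<^bsub>word_algebra\<^esub> h) = word_act G \<rho> g f \<ominus>\<^bsub>word_algebra\<^esub> word_act G \<rho> g h"
    if "f \<in> carrier word_algebra" "h \<in> carrier word_algebra" for f h :: "'v list \<Rightarrow> complex"
    using that g word_act_closed[of g h] by (auto simp: minus_word_algebra word_act_def)
  have "tensor_act G \<rho> g X = tensor_class scale (monomial 1 [\<rho> g x] \<otimes>\<^bsub>word_algebra\<^esub> monomial 1 [\<rho> g y]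
      \<ominus>\<^bsub>word_algebra\<^esub> monomial 1 [\<rho> g y] \<otimes>\<^bsub>word_algebra\<^esub> monomial 1 [\<rho> g x])"
    using g unfolding X by (simp add: tensor_act_class monomial_closed eq word_act_monomial monomial_mult)
  then show "tensor_act G \<rho> g X \<in> tensor_class scale ` commutators"
    unfolding commutators_def by auto
qed

lemma sym_action: "ring_action (sym_algebra scale) G (sym_act G \<rho>)"
  by (rule ring_action_transport[OF tensor_action sym_surj]) (rule sym_act_class)

sublocale sym: ring_action "sym_algebra scale" G "sym_act G \<rho>"
  by (rule sym_action)

text \<open>\<open>W\<close> covers both smash products and \<open>H\<close>. Its elements are
  coefficient functions of a group element and a word, so that degrees and homogeneous parts can be
  read off there, while the quotients hide them.\<close>

abbreviation "W \<equiv> smash G word_algebra (word_act G \<rho>)"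
abbreviation "TS \<equiv> tensor_smash scale G \<rho>"
abbreviation "SS \<equiv> sym_smash scale G \<rho>"
abbreviation "H \<equiv> kappa_algebra scale G \<rho> \<kappa>"

definition "to_TS a = (\<lambda>g\<in>carrier G. tensor_class scale (a g))"
definition "to_SS a = (\<lambda>g\<in>carrier G. sym_class scale (a g))"
definition "to_H a = kappa_class scale G \<rho> \<kappa> (to_TS a)"

sublocale W: ring W by (rule word.smash_ring)
sublocale TS: ring TS by (rule tensor.smash_ring)
sublocale SS: ring SS by (rule sym.smash_ring)

sublocale to_TS: surj_ring_hom W TS to_TS
  unfolding to_TS_def[abs_def]
  by (rule smash_map_surj_ring_hom[OF word_action tensor_action tensor_surj]) (rule tensor_act_class)

sublocale to_SS: surj_ring_hom W SS to_SS
  unfolding to_SS_def[abs_def]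
proof (rule smash_map_surj_ring_hom[OF word_action sym_action word_sym_surj])
  show "sym_act G \<rho> g (sym_class scale f) = sym_class scale (word_act G \<rho> g f)"
    if "g \<in> carrier G" "f \<in> carrier word_algebra" for g f
    using that by (simp add: sym_class_def sym_act_class tensor_act_class)
qed

definition vec :: "'v \<Rightarrow> 'g \<Rightarrow> 'v list \<Rightarrow> complex" where
  "vec x = word.single \<one> (monomial 1 [x])"

definition group_alg :: "('g \<Rightarrow> complex) \<Rightarrow> 'g \<Rightarrow> 'v list \<Rightarrow> complex" where
  "group_alg a = (\<lambda>g\<in>carrier G. monomial (a g) [])"

definition relation :: "'v \<Rightarrow> 'v \<Rightarrow> 'g \<Rightarrow> 'v list \<Rightarrow> complex" where
  "relation x y = (vec x \<otimes>\<^bsub>W\<^esub> vec y \<ominus>\<^bsub>W\<^esub> vec y \<otimes>\<^bsub>W\<^esub> vec x) \<ominus>\<^bsub>W\<^esub> group_alg (\<kappa> x y)"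

lemma vec_closed: "vec x \<in> carrier W"
  unfolding vec_def by (rule word.single_closed[OF monomial_closed])

lemma group_alg_closed: "group_alg a \<in> carrier W"
  by (auto simp: group_alg_def word.carrier_smash monomial_closed)

lemma relation_closed: "relation x y \<in> carrier W"
  unfolding relation_def by (intro W.minus_closed W.m_closed vec_closed group_alg_closed)

lemma to_TS_vec: "to_TS (vec x) = vec_emb scale G x"
  by (auto simp: to_TS_def vec_emb_def vec_def word.single_def intro!: restrict_ext)

lemma to_TS_group_alg: "to_TS (group_alg a) = group_alg_emb scale G a"
  by (auto simp: to_TS_def group_alg_def group_alg_emb_def intro!: restrict_ext)

lemma to_TS_minus: "a \<in> carrier W \<Longrightarrow> b \<in> carrier W \<Longrightarrow> to_TS (a \<ominus>\<^bsub>W\<^esub> b) = to_TS a \<ominus>\<^bsub>TS\<^esub> to_TS b"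
  by (simp add: a_minus_def)

lemma kappa_ideal_eq: "kappa_ideal scale G \<rho> \<kappa> = Idl\<^bsub>TS\<^esub> (to_TS ` {relation x y | x y. True})"
proof -
  have "to_TS (relation x y) = (vec_emb scale G x \<otimes>\<^bsub>TS\<^esub> vec_emb scale G y
       \<ominus>\<^bsub>TS\<^esub> vec_emb scale G y \<otimes>\<^bsub>TS\<^esub> vec_emb scale G x) \<ominus>\<^bsub>TS\<^esub> group_alg_emb scale G (\<kappa> x y)" for x y
    unfolding relation_def
    by (simp add: to_TS_minus vec_closed group_alg_closed to_TS_vec[symmetric] to_TS_group_alg[symmetric])
  then have "to_TS ` {relation x y | x y. True} = {(vec_emb scale G x \<otimes>\<^bsub>TS\<^esub> vec_emb scale G y
       \<ominus>\<^bsub>TS\<^esub> vec_emb scale G y \<otimes>\<^bsub>TS\<^esub> vec_emb scale G x) \<ominus>\<^bsub>TS\<^esub> group_alg_emb scale G (\<kappa> x y) | x y. True}"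
    by (auto simp: image_iff) metis
  then show ?thesis unfolding kappa_ideal_def Let_def by simp
qed

lemma kappa_gens_carrier: "to_TS ` {relation x y | x y. True} \<subseteq> carrier TS"
  using relation_closed by auto

lemma ideal_kappa_ideal: "ideal (kappa_ideal scale G \<rho> \<kappa>) TS"
  unfolding kappa_ideal_eq by (rule TS.genideal_ideal[OF kappa_gens_carrier])

lemma kappa_surj: "surj_ring_hom TS H (kappa_class scale G \<rho> \<kappa>)"
  unfolding kappa_algebra_def kappa_class_def[abs_def] by (rule ideal.quotient_surj_ring_hom[OF ideal_kappa_ideal])

sublocale to_H: surj_ring_hom W H to_H
  unfolding to_H_def[abs_def] by (rule surj_ring_hom_comp[OF to_TS.surj_ring_hom_axioms kappa_surj])

lemma to_H_eq_0_iff: "a \<in> carrier W \<Longrightarrow> to_H a = \<zero>\<^bsub>H\<^esub> \<longleftrightarrow> to_TS a \<in> kappa_ideal scale G \<rho> \<kappa>"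
  unfolding to_H_def kappa_class_def kappa_algebra_def
  by (rule ideal.coset_eq_zero_iff[OF ideal_kappa_ideal]) simp

lemma to_H_relation: "to_H (relation x y) = \<zero>\<^bsub>H\<^esub>"
  using TS.genideal_self[OF kappa_gens_carrier] relation_closed
  by (auto simp: to_H_eq_0_iff kappa_ideal_eq)

text \<open>The third hypothesis says that \<open>Z\<close> contains the kernel of
  \<open>to_TS\<close>; with the relations added, this accounts for everything that dies in
  \<open>H\<close>.\<close>

lemma to_H_eq_0_mem:
  assumes "ideal Z W" "\<And>x y. relation x y \<in> Z"
    and "\<And>a. a \<in> carrier W \<Longrightarrow> (\<And>g. g \<in> carrier G \<Longrightarrow> a g \<in> tensor_ideal scale) \<Longrightarrow> a \<in> Z"
    and a: "a \<in> carrier W" "to_H a = \<zero>\<^bsub>H\<^esub>"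
  shows "a \<in> Z"
proof (rule to_TS.mem_of_hom_mem_genideal[OF assms(1)])
  show "to_TS a \<in> Idl\<^bsub>TS\<^esub> (to_TS ` {relation x y | x y. True})"
    using a by (simp add: to_H_eq_0_iff kappa_ideal_eq)
  fix b assume b: "b \<in> carrier W" "to_TS b = \<zero>\<^bsub>TS\<^esub>"
  have "b g \<in> tensor_ideal scale" if g: "g \<in> carrier G" for g
    using fun_cong[OF b(2), of g] g b(1)
    by (simp add: to_TS_def tensor.zero_smash tensor_class_eq_0_iff word.smash_apply)
  with b assms(3) show "b \<in> Z" by blast
qed (use assms in auto)

end

section \<open>The natural homomorphism\<close>

lemma (in abelian_subgroup) coset_eq_iff:
  assumes "x \<in> carrier G" "y \<in> carrier G"
  shows "H +> x = H +> y \<longleftrightarrow> x \<ominus> y \<in> H"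
proof
  assume "H +> x = H +> y"
  then obtain h where "h \<in> H" "x = h \<oplus> y"
    using a_rcos_self[OF assms(1)] unfolding a_r_coset_def' by blast
  then show "x \<ominus> y \<in> H"
    using assms by (simp add: a_minus_def a_assoc r_neg)
next
  assume h: "x \<ominus> y \<in> H"
  have "x = (x \<ominus> y) \<oplus> y"
    using assms by (simp add: a_minus_def a_assoc l_neg)
  with h have "x \<in> H +> y" unfolding a_r_coset_def' by blast
  from a_repr_independence[OF this assms(2) a_subgroup] show "H +> x = H +> y" by simp
qed

text \<open>The product of the graded ring ranges over all representatives of its factors; this lets
  each summand be exchanged within its coset.\<close>

lemma (in abelian_subgroup) coset_finsum_cong:
  assumes "finite I" "\<And>i. i \<in> I \<Longrightarrow> s i \<in> H +> t i" "\<And>i. i \<in> I \<Longrightarrow> t i \<in> carrier G"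
  shows "H +> finsum G s I = H +> finsum G t I"
proof -
  have s: "s i \<in> carrier G" if "i \<in> I" for i
    using assms(2)[OF that] a_r_coset_subset_G[OF a_subset assms(3)[OF that]] by blast
  have eq: "H +> s i = H +> t i" if "i \<in> I" for i
    using a_repr_independence[OF assms(2)[OF that] assms(3)[OF that] a_subgroup] by simp
  show ?thesis
    using assms(1) s assms(3) eq
  proof (induction I)
    case (insert i I)
    have "H +> (s i \<oplus> finsum G s I) = H +> (t i \<oplus> finsum G t I)"
      using insert a_rcos_sum[of "s i" "finsum G s I"] a_rcos_sum[of "t i" "finsum G t I"]
      by (simp add: Pi_def)
    then show ?case using insert by (simp add: Pi_def)
  qed simp
qed

lemma UN_UN_const:
  "(\<And>x y. x \<in> X \<Longrightarrow> y \<in> Y \<Longrightarrow> f x y = C) \<Longrightarrow> p \<in> X \<Longrightarrow> q \<in> Y \<Longrightarrow> (\<Union>x\<in>X. \<Union>y\<in>Y. f x y) = C"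
  by auto

lemma word_algebra_finsum_apply:
  assumes "\<And>i. i \<in> I \<Longrightarrow> f i \<in> carrier word_algebra"
  shows "finsum word_algebra f I w = (\<Sum>i\<in>I. f i w)"
  using assms
  by (induction I rule: infinite_finite_induct)
    (auto simp: Pi_def zero_word_algebra add_word_algebra word_algebra.finsum_infinite)

lemma homogeneous_part_closed: "f \<in> carrier word_algebra \<Longrightarrow> homogeneous_part n f \<in> carrier word_algebra"
  unfolding carrier_word_algebra homogeneous_part_def by (erule finite_subset[rotated]) auto

lemma homogeneous_part_zero: "homogeneous_part n (\<lambda>w. 0) = (\<lambda>w. 0)"
  by (auto simp: homogeneous_part_def)

context wedge_setting
begin

lemma W_apply_closed: "a \<in> carrier W \<Longrightarrow> g \<in> carrier G \<Longrightarrow> a g \<in> carrier word_algebra"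
  by (rule word.smash_apply)

lemma W_eqI:
  "a \<in> carrier W \<Longrightarrow> b \<in> carrier W \<Longrightarrow> (\<And>g w. g \<in> carrier G \<Longrightarrow> a g w = b g w) \<Longrightarrow> a = b"
  by (rule word.smash_eqI) auto

lemma W_add_apply: "g \<in> carrier G \<Longrightarrow> (a \<oplus>\<^bsub>W\<^esub> b) g w = a g w + b g w"
  by (simp add: word.add_apply add_word_algebra)

lemma W_zero_apply: "g \<in> carrier G \<Longrightarrow> \<zero>\<^bsub>W\<^esub> g w = 0"
  by (simp add: word.zero_smash zero_word_algebra)

lemma W_single_apply: "k \<in> carrier G \<Longrightarrow> word.single g f k w = (if k = g then f w else 0)"
  by (simp add: word.single_apply zero_word_algebra)

lemma W_uminus_apply:
  assumes "a \<in> carrier W" "g \<in> carrier G"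
  shows "(\<ominus>\<^bsub>W\<^esub> a) g w = - a g w"
  using W.l_neg[OF assms(1)] W_add_apply[OF assms(2), of "\<ominus>\<^bsub>W\<^esub> a" a w] W_zero_apply[OF assms(2), of w]
  by (simp add: eq_neg_iff_add_eq_0)

lemma W_minus_apply:
  "b \<in> carrier W \<Longrightarrow> g \<in> carrier G \<Longrightarrow> (a \<ominus>\<^bsub>W\<^esub> b) g w = a g w - b g w"
  by (simp add: a_minus_def W_add_apply W_uminus_apply)

lemma W_mult_apply:
  assumes "a \<in> carrier W" "b \<in> carrier W" "k \<in> carrier G"
  shows "(a \<otimes>\<^bsub>W\<^esub> b) k w =
    (\<Sum>g\<in>carrier G. \<Sum>i\<le>length w. a g (take i w) * b (inv g \<otimes> k) (map (\<rho> (inv g)) (drop i w)))"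
  unfolding word.mult_apply[OF assms(3)]
  by (subst word_algebra_finsum_apply)
    (use word.mult_apply_closed[OF assms] in \<open>auto simp: mult_word_algebra word_act_def\<close>)

lemma W_finsum_apply:
  assumes "\<And>i. i \<in> I \<Longrightarrow> f i \<in> carrier W" "g \<in> carrier G"
  shows "finsum W f I g w = (\<Sum>i\<in>I. f i g w)"
  using assms(1)
  by (induction I rule: infinite_finite_induct)
    (auto simp: Pi_def W_zero_apply W_add_apply W.finsum_infinite assms(2))

lemma single_mult_single:
  assumes "g \<in> carrier G" "h \<in> carrier G" "a \<in> carrier word_algebra" "b \<in> carrier word_algebra"
  shows "word.single g a \<otimes>\<^bsub>W\<^esub> word.single h b = word.single (g \<otimes> h) (a \<otimes>\<^bsub>word_algebra\<^esub> word_act G \<rho> g b)"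
proof (rule word.smash_eqI)
  fix k assume k: "k \<in> carrier G"
  have "inv g \<otimes> k = h \<longleftrightarrow> k = g \<otimes> h"
    using assms k by (metis G.inv_closed G.inv_solve_left)
  then show "(word.single g a \<otimes>\<^bsub>W\<^esub> word.single h b) k
      = word.single (g \<otimes> h) (a \<otimes>\<^bsub>word_algebra\<^esub> word_act G \<rho> g b) k"
    using assms k
    by (simp add: word.single_mult_apply word.single_closed word.single_apply word.act_zero)
qed (use assms in \<open>auto intro!: word.smash_mult_closed word.single_closed word_algebra.m_closed word_act_closed\<close>)

section \<open>Word length as degree, and the filtration\<close>

definition hom_part :: "nat \<Rightarrow> ('g \<Rightarrow> 'v list \<Rightarrow> complex) \<Rightarrow> 'g \<Rightarrow> 'v list \<Rightarrow> complex" where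
  "hom_part n a = (\<lambda>g\<in>carrier G. homogeneous_part n (a g))"

lemma hom_part_closed: "a \<in> carrier W \<Longrightarrow> hom_part n a \<in> carrier W"
  by (auto simp: hom_part_def word.carrier_smash intro!: homogeneous_part_closed)

lemma hom_part_apply: "g \<in> carrier G \<Longrightarrow> hom_part n a g w = (if length w = n then a g w else 0)"
  by (simp add: hom_part_def homogeneous_part_def)

lemma hom_part_add:
  "a \<in> carrier W \<Longrightarrow> b \<in> carrier W \<Longrightarrow> hom_part n (a \<oplus>\<^bsub>W\<^esub> b) = hom_part n a \<oplus>\<^bsub>W\<^esub> hom_part n b"
  by (rule W_eqI) (auto simp: hom_part_closed hom_part_apply W_add_apply)

lemma hom_part_minus:
  "a \<in> carrier W \<Longrightarrow> b \<in> carrier W \<Longrightarrow> hom_part n (a \<ominus>\<^bsub>W\<^esub> b) = hom_part n a \<ominus>\<^bsub>W\<^esub> hom_part n b"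
  by (rule W_eqI) (auto simp: hom_part_closed hom_part_apply W_minus_apply)

lemma hom_part_single:
  "f \<in> carrier word_algebra \<Longrightarrow> hom_part n (word.single g f) = word.single g (homogeneous_part n f)"
  by (rule W_eqI) (simp_all add: hom_part_closed hom_part_apply W_single_apply word.single_closed
      homogeneous_part_closed, auto simp: homogeneous_part_def W_single_apply)

text \<open>The group acts letterwise and preserves word length, so the degree \<open>n\<close> part
  of a product collects the products of parts of degrees \<open>i\<close> and
  \<open>n - i\<close>.\<close>

lemma hom_part_mult:
  assumes a: "a \<in> carrier W" and b: "b \<in> carrier W"
  shows "hom_part n (a \<otimes>\<^bsub>W\<^esub> b) = finsum W (\<lambda>i. hom_part i a \<otimes>\<^bsub>W\<^esub> hom_part (n - i) b) {..n}"
proof (rule W_eqI)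
  fix k w assume k: "k \<in> carrier G"
  let ?t = "\<lambda>g i. a g (take i w) * b (inv g \<otimes> k) (map (\<rho> (inv g)) (drop i w))"
  have "finsum W (\<lambda>i. hom_part i a \<otimes>\<^bsub>W\<^esub> hom_part (n - i) b) {..n} k w
      = (\<Sum>i\<le>n. (hom_part i a \<otimes>\<^bsub>W\<^esub> hom_part (n - i) b) k w)"
    by (rule W_finsum_apply) (use a b k in \<open>auto intro!: W.m_closed hom_part_closed\<close>)
  \<comment> \<open>The projections to the two degrees leave only the cut at \<open>j = i\<close>,
    and only for words of length \<open>n\<close>.\<close>
  also have "\<dots> = (\<Sum>i\<le>n. \<Sum>g\<in>carrier G. \<Sum>j\<le>length w. if j = i \<and> length w = n then ?t g j else 0)"
    using k by (auto simp: W_mult_apply hom_part_closed a b hom_part_apply intro!: sum.cong)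
  also have "\<dots> = (\<Sum>g\<in>carrier G. \<Sum>j\<le>length w. \<Sum>i\<le>n. if j = i \<and> length w = n then ?t g j else 0)"
    by (rule trans[OF sum.swap]) (rule sum.cong[OF refl sum.swap])
  also have "\<dots> = (if length w = n then \<Sum>g\<in>carrier G. \<Sum>j\<le>length w. ?t g j else 0)"
    by (auto intro!: sum.cong)
  also have "\<dots> = hom_part n (a \<otimes>\<^bsub>W\<^esub> b) k w"
    using k a b by (simp add: hom_part_apply W_mult_apply)
  finally show "hom_part n (a \<otimes>\<^bsub>W\<^esub> b) k w = finsum W (\<lambda>i. hom_part i a \<otimes>\<^bsub>W\<^esub> hom_part (n - i) b) {..n} k w"
    by simp
qed (use a b in \<open>auto intro!: hom_part_closed W.m_closed W.finsum_closed\<close>)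

text \<open>The strict bound makes \<open>below n\<close> a lift of step \<open>n - 1\<close> of the
  filtration, with \<open>below 0\<close> zero, so that \<open>FB n\<close> is its image for every
  \<open>n\<close>.\<close>

definition below :: "nat \<Rightarrow> ('g \<Rightarrow> 'v list \<Rightarrow> complex) set" where
  "below n = {a \<in> carrier W. \<forall>g\<in>carrier G. \<forall>w. a g w \<noteq> 0 \<longrightarrow> length w < n}"

lemma below_closed: "a \<in> below n \<Longrightarrow> a \<in> carrier W"
  by (simp add: below_def)

lemma below_add: "a \<in> below n \<Longrightarrow> b \<in> below n \<Longrightarrow> a \<oplus>\<^bsub>W\<^esub> b \<in> below n"
  by (auto simp: below_def W_add_apply) (metis add.right_neutral)

lemma below_uminus: "a \<in> below n \<Longrightarrow> \<ominus>\<^bsub>W\<^esub> a \<in> below n"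
  by (auto simp: below_def W_uminus_apply)

lemma below_zero: "\<zero>\<^bsub>W\<^esub> \<in> below n"
  by (auto simp: below_def W_zero_apply)

lemma below_mono: "a \<in> below m \<Longrightarrow> m \<le> n \<Longrightarrow> a \<in> below n"
  by (auto simp: below_def intro: less_le_trans)

lemma below_0: "below 0 = {\<zero>\<^bsub>W\<^esub>}"
  using below_zero[of 0] by (auto simp: below_def W_zero_apply intro!: W_eqI)

text \<open>Lengths at most \<open>i - 1\<close> and \<open>j - 1\<close> add up to less than
  \<open>i + j - 1\<close>; if \<open>i\<close> or \<open>j\<close> is 0, one factor vanishes and
  the truncated subtraction does no harm.\<close>

lemma below_mult:
  assumes "a \<in> below i" "b \<in> below j"
  shows "a \<otimes>\<^bsub>W\<^esub> b \<in> below (i + j - 1)"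
  unfolding below_def
proof (intro CollectI conjI ballI allI impI)
  note ab = below_closed[OF assms(1)] below_closed[OF assms(2)]
  show "a \<otimes>\<^bsub>W\<^esub> b \<in> carrier W" using ab by simp
  fix k w assume k: "k \<in> carrier G" and "(a \<otimes>\<^bsub>W\<^esub> b) k w \<noteq> 0"
  then obtain g where g: "g \<in> carrier G"
    "(\<Sum>i\<le>length w. a g (take i w) * b (inv g \<otimes> k) (map (\<rho> (inv g)) (drop i w))) \<noteq> 0"
    unfolding W_mult_apply[OF ab k] by (meson sum.not_neutral_contains_not_neutral)
  then obtain l where l: "l \<le> length w" "a g (take l w) * b (inv g \<otimes> k) (map (\<rho> (inv g)) (drop l w)) \<noteq> 0"
    by (metis (no_types, lifting) atMost_iff sum.not_neutral_contains_not_neutral)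
  then have "a g (take l w) \<noteq> 0" "b (inv g \<otimes> k) (map (\<rho> (inv g)) (drop l w)) \<noteq> 0" by auto
  then have "length (take l w) < i" "length (map (\<rho> (inv g)) (drop l w)) < j"
    using assms g(1) k unfolding below_def by blast+
  then show "length w < i + j - 1" using l(1) by simp
qed

lemma hom_part_below: "a \<in> carrier W \<Longrightarrow> hom_part n a \<in> below (Suc n)"
  by (auto simp: below_def hom_part_closed hom_part_apply split: if_splits)

abbreviation "F \<equiv> kappa_filtration scale G \<rho> \<kappa>"
abbreviation "FB \<equiv> filt_below H F"
abbreviation "GR \<equiv> gr_kappa scale G \<rho> \<kappa>"
abbreviation "\<xi> \<equiv> natural_hom scale G \<rho> \<kappa>"

lemma filtration_eq: "F n = to_H ` below (Suc n)"
proof -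
  have "carrier G \<rightarrow>\<^sub>E tensor_upto scale n = to_TS ` below (Suc n)"
  proof
    show "to_TS ` below (Suc n) \<subseteq> carrier G \<rightarrow>\<^sub>E tensor_upto scale n"
      using W_apply_closed by (auto simp: to_TS_def below_def tensor_upto_def less_Suc_eq_le)
    show "carrier G \<rightarrow>\<^sub>E tensor_upto scale n \<subseteq> to_TS ` below (Suc n)"
    proof
      fix u assume u: "u \<in> carrier G \<rightarrow>\<^sub>E tensor_upto scale n"
      then have "\<forall>g\<in>carrier G. \<exists>f. u g = tensor_class scale f \<and> f \<in> carrier word_algebra \<and> (\<forall>w. f w \<noteq> 0 \<longrightarrow> length w \<le> n)"
        unfolding tensor_upto_def by fast
      then obtain f where f: "\<And>g. g \<in> carrier G \<Longrightarrow>
          u g = tensor_class scale (f g) \<and> f g \<in> carrier word_algebra \<and> (\<forall>w. f g w \<noteq> 0 \<longrightarrow> length w \<le> n)"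
        by metis
      have "restrict f (carrier G) \<in> below (Suc n)"
        using f by (auto simp: below_def word.carrier_smash less_Suc_eq_le)
      moreover have "u = to_TS (restrict f (carrier G))"
        using u f by (intro ext) (auto simp: to_TS_def PiE_def extensional_def)
      ultimately show "u \<in> to_TS ` below (Suc n)" by blast
    qed
  qed
  then show ?thesis
    unfolding kappa_filtration_def to_H_def[abs_def] by (simp add: image_image)
qed

lemma filt_below_eq: "FB n = to_H ` below n"
  by (cases n) (simp_all add: filt_below_def filtration_eq below_0)

lemma FB_subgroup: "abelian_subgroup (FB n) H"
proof (rule abelian_subgroupI3)
  show "additive_subgroup (FB n) H"
  proof (rule additive_subgroupI, rule to_H.S.add.subgroupI)
    show "FB n \<subseteq> carrier H" using below_closed by (auto simp: filt_below_eq)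
    show "FB n \<noteq> {}" using below_zero by (auto simp: filt_below_eq)
    show "\<ominus>\<^bsub>H\<^esub> a \<in> FB n" if a: "a \<in> FB n" for a
    proof -
      obtain b where b: "b \<in> below n" "a = to_H b" using a by (auto simp: filt_below_eq)
      have "\<ominus>\<^bsub>H\<^esub> a = to_H (\<ominus>\<^bsub>W\<^esub> b)" using b below_closed by simp
      then show ?thesis using b below_uminus by (auto simp: filt_below_eq)
    qed
    show "a \<oplus>\<^bsub>H\<^esub> b \<in> FB n" if a: "a \<in> FB n" "b \<in> FB n" for a b
    proof -
      obtain a' b' where b: "a' \<in> below n" "a = to_H a'" "b' \<in> below n" "b = to_H b'"
        using a by (auto simp: filt_below_eq)
      then have "a \<oplus>\<^bsub>H\<^esub> b = to_H (a' \<oplus>\<^bsub>W\<^esub> b')" using below_closed by simp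
      then show ?thesis using b below_add by (auto simp: filt_below_eq)
    qed
  qed
  show "abelian_group H" by (rule to_H.S.abelian_group_axioms)
qed

lemma FB_closed: "x \<in> FB n \<Longrightarrow> x \<in> carrier H"
  by (auto simp: filt_below_eq below_closed)

lemma FB_zero: "\<zero>\<^bsub>H\<^esub> \<in> FB n"
  using below_zero[of n] by (auto simp: filt_below_eq intro!: image_eqI[of _ _ "\<zero>\<^bsub>W\<^esub>"])

lemma FB_add: "x \<in> FB n \<Longrightarrow> y \<in> FB n \<Longrightarrow> x \<oplus>\<^bsub>H\<^esub> y \<in> FB n"
  using additive_subgroup.a_closed[OF abelian_subgroup.axioms(1)[OF FB_subgroup]] .

lemma FB_finsum: "(\<And>i. i \<in> I \<Longrightarrow> f i \<in> FB n) \<Longrightarrow> finsum H f I \<in> FB n"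
proof (induction I rule: infinite_finite_induct)
  case (insert i I)
  then have "f \<in> I \<rightarrow> carrier H" "f i \<in> carrier H" using FB_closed by blast+
  with insert show ?case by (auto intro!: FB_add)
qed (auto simp: FB_zero to_H.S.finsum_infinite)

text \<open>In filtration steps: \<open>F (i - 1)\<close> times \<open>F j\<close> lies in
  \<open>F (i + j - 1)\<close>, in either order. This makes products in the graded ring independent
  of representatives.\<close>

lemma FB_Suc_mult: 
  assumes "x \<in> FB i" "y \<in> FB (Suc j)"
  shows "x \<otimes>\<^bsub>H\<^esub> y \<in> FB (i + j)" "y \<otimes>\<^bsub>H\<^esub> x \<in> FB (i + j)"
proof -
  obtain a b where ab: "a \<in> below i" "x = to_H a" "b \<in> below (Suc j)" "y = to_H b"
    using assms by (auto simp: filt_below_eq)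
  then have "x \<otimes>\<^bsub>H\<^esub> y = to_H (a \<otimes>\<^bsub>W\<^esub> b)" "y \<otimes>\<^bsub>H\<^esub> x = to_H (b \<otimes>\<^bsub>W\<^esub> a)"
    using below_closed by simp_all
  moreover have "a \<otimes>\<^bsub>W\<^esub> b \<in> below (i + j)" "b \<otimes>\<^bsub>W\<^esub> a \<in> below (i + j)"
    using below_mult[OF ab(1,3)] below_mult[OF ab(3,1)] by (simp_all add: add.commute)
  ultimately show "x \<otimes>\<^bsub>H\<^esub> y \<in> FB (i + j)" "y \<otimes>\<^bsub>H\<^esub> x \<in> FB (i + j)"
    by (auto simp: filt_below_eq)
qed

lemma to_H_hom_part: "a \<in> carrier W \<Longrightarrow> to_H (hom_part n a) \<in> FB (Suc n)"
  by (auto simp: filt_below_eq hom_part_below)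

lemma vec_mult: "vec x \<otimes>\<^bsub>W\<^esub> vec y = word.single \<one> (monomial 1 [x, y])"
  unfolding vec_def
  by (simp add: single_mult_single monomial_closed word_act_monomial act_one monomial_mult)

lemma group_alg_apply: "g \<in> carrier G \<Longrightarrow> group_alg a g = monomial (a g) []"
  by (simp add: group_alg_def)

section \<open>Well-definedness of the natural homomorphism\<close>

lemma to_H_group_alg: "to_H (group_alg (\<kappa> x y)) = to_H (vec x \<otimes>\<^bsub>W\<^esub> vec y \<ominus>\<^bsub>W\<^esub> vec y \<otimes>\<^bsub>W\<^esub> vec x)"
proof -
  let ?c = "vec x \<otimes>\<^bsub>W\<^esub> vec y \<ominus>\<^bsub>W\<^esub> vec y \<otimes>\<^bsub>W\<^esub> vec x"
  have c: "?c \<in> carrier W" using vec_closed by simp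
  have "to_H (?c \<ominus>\<^bsub>W\<^esub> group_alg (\<kappa> x y)) = \<zero>\<^bsub>H\<^esub>"
    using to_H_relation[of x y] unfolding relation_def .
  then have "to_H ?c \<ominus>\<^bsub>H\<^esub> to_H (group_alg (\<kappa> x y)) = \<zero>\<^bsub>H\<^esub>"
    using c group_alg_closed by (simp only: a_minus_def to_H.hom_add to_H.hom_a_inv W.a_inv_closed)
  then show ?thesis
    using to_H.S.r_right_minus_eq[of "to_H ?c" "to_H (group_alg (\<kappa> x y))"] c
    by (simp add: group_alg_closed)
qed

text \<open>The relations of SV are homogeneous and their images in \<open>H\<close> drop in degree:
  linearity relations die, while \<open>x y - y x\<close> of degree 2 becomes
  \<open>\<kappa>(x,y)\<close> of degree 0. This is what makes \<xi> independent of lifts.\<close>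

lemma to_H_hom_part_kernel:
  assumes a: "a \<in> carrier W" "to_SS a = \<zero>\<^bsub>SS\<^esub>"
  shows "to_H (hom_part n a) \<in> FB n"
proof -
  \<comment> \<open>Quantifying over all degrees and all \<open>g\<close> makes \<open>Z\<close> a
    two-sided ideal, so that only the relations remain to be tested.\<close>
  define Z where "Z = {f \<in> carrier word_algebra. \<forall>n. \<forall>g\<in>carrier G.
      to_H (word.single g (homogeneous_part n f)) \<in> FB n}"
  have single_hom: "word.single g (homogeneous_part n f) = hom_part n (word.single g f)"
    if "f \<in> carrier word_algebra" for n g f
    using that by (simp add: hom_part_single)
  have Z: "ideal Z word_algebra"
  proof (rule ideal_of_closed[OF word_algebra_ring])
    show "\<zero>\<^bsub>word_algebra\<^esub> \<in> Z"
    proof -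
      have "word.single g (homogeneous_part n \<zero>\<^bsub>word_algebra\<^esub>) = \<zero>\<^bsub>W\<^esub>" for g n
        by (auto simp: zero_word_algebra homogeneous_part_zero word.single_def word.zero_smash
            intro!: restrict_ext)
      then show ?thesis by (simp add: Z_def FB_zero)
    qed
    show "f \<oplus>\<^bsub>word_algebra\<^esub> h \<in> Z" if "f \<in> Z" "h \<in> Z" for f h
    proof -
      have fh: "f \<in> carrier word_algebra" "h \<in> carrier word_algebra" using that by (auto simp: Z_def)
      have "word.single g (f \<oplus>\<^bsub>word_algebra\<^esub> h) = word.single g f \<oplus>\<^bsub>W\<^esub> word.single g h" for g
        by (rule word.smash_eqI) (use fh in \<open>auto simp: word.single_closed word.single_apply word.add_apply\<close>)
      then have "to_H (word.single g (homogeneous_part n (f \<oplus>\<^bsub>word_algebra\<^esub> h)))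
          = to_H (word.single g (homogeneous_part n f)) \<oplus>\<^bsub>H\<^esub> to_H (word.single g (homogeneous_part n h))" for g n
        using fh by (simp add: single_hom hom_part_add hom_part_closed word.single_closed)
      then show ?thesis using that by (auto simp: Z_def FB_add)
    qed
    fix f c :: "'v list \<Rightarrow> complex" assume f: "f \<in> Z" and c: "c \<in> carrier word_algebra"
    have fW: "f \<in> carrier word_algebra" using f by (simp add: Z_def)
    have fZ: "to_H (hom_part n (word.single g f)) \<in> FB n" if "g \<in> carrier G" for g n
      using f that by (auto simp: Z_def single_hom fW)
    show "c \<otimes>\<^bsub>word_algebra\<^esub> f \<in> Z"
    proof -
      have "to_H (word.single g (homogeneous_part n (c \<otimes>\<^bsub>word_algebra\<^esub> f))) \<in> FB n" if g: "g \<in> carrier G" for g n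
      proof -
        have "word.single g (c \<otimes>\<^bsub>word_algebra\<^esub> f) = word.single \<one> c \<otimes>\<^bsub>W\<^esub> word.single g f"
          using g c fW by (simp add: single_mult_single word.act_one)
        then have "to_H (word.single g (homogeneous_part n (c \<otimes>\<^bsub>word_algebra\<^esub> f)))
           = finsum H (\<lambda>i. to_H (hom_part i (word.single \<one> c)) \<otimes>\<^bsub>H\<^esub> to_H (hom_part (n - i) (word.single g f))) {..n}"
          using c fW by (simp add: single_hom hom_part_mult word.single_closed hom_part_closed
              to_H.hom_finsum Pi_def comp_def)
        also have "\<dots> \<in> FB n"
        proof (rule FB_finsum)
          fix i assume "i \<in> {..n}"
          then show "to_H (hom_part i (word.single \<one> c)) \<otimes>\<^bsub>H\<^esub> to_H (hom_part (n - i) (word.single g f)) \<in> FB n"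
            using FB_Suc_mult(2)[OF fZ[OF g, of "n - i"] to_H_hom_part[OF word.single_closed[OF c], of i \<one>]] by simp
        qed
        finally show ?thesis .
      qed
      then show ?thesis using c fW by (simp add: Z_def)
    qed
    show "f \<otimes>\<^bsub>word_algebra\<^esub> c \<in> Z"
    proof -
      have "to_H (word.single g (homogeneous_part n (f \<otimes>\<^bsub>word_algebra\<^esub> c))) \<in> FB n" if g: "g \<in> carrier G" for g n
      proof -
        \<comment> \<open>On the right \<open>c\<close> has to pass \<open>g\<close>, so the
          corresponding factor in \<open>W\<close> is \<open>g^-1 c\<close>.\<close>
        let ?c = "word_act G \<rho> (inv g) c"
        have c': "?c \<in> carrier word_algebra" using g c by (simp add: word_act_closed)
        have "word_act G \<rho> g ?c = c"
          using g c word.act_mult[of g "inv g" c] by (simp add: word.act_one)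
        then have "word.single g (f \<otimes>\<^bsub>word_algebra\<^esub> c) = word.single g f \<otimes>\<^bsub>W\<^esub> word.single \<one> ?c"
          using g c' fW by (simp add: single_mult_single)
        then have "to_H (word.single g (homogeneous_part n (f \<otimes>\<^bsub>word_algebra\<^esub> c)))
           = finsum H (\<lambda>i. to_H (hom_part i (word.single g f)) \<otimes>\<^bsub>H\<^esub> to_H (hom_part (n - i) (word.single \<one> ?c))) {..n}"
          using c c' fW by (simp add: single_hom hom_part_mult word.single_closed hom_part_closed
              to_H.hom_finsum Pi_def comp_def)
        also have "\<dots> \<in> FB n"
        proof (rule FB_finsum)
          fix i assume "i \<in> {..n}"
          then show "to_H (hom_part i (word.single g f)) \<otimes>\<^bsub>H\<^esub> to_H (hom_part (n - i) (word.single \<one> ?c)) \<in> FB n"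
            using FB_Suc_mult(1)[OF fZ[OF g, of i] to_H_hom_part[OF word.single_closed[OF c'], of "n - i" \<one>]] by simp
        qed
        finally show ?thesis .
      qed
      then show ?thesis using c fW by (simp add: Z_def)
    qed
  qed (auto simp: Z_def)
  have lin: "linearity_relations scale \<subseteq> Z"
  proof
    fix f assume f: "f \<in> linearity_relations scale"
    then have fW: "f \<in> carrier word_algebra" using linearity_relations_carrier by auto
    have "length w = 1" if "f w \<noteq> 0" for w
      using f that unfolding linearity_relations_eq by (auto simp: monomial_def split: if_splits)
    then have hp: "homogeneous_part n f = (if n = 1 then f else (\<lambda>w. 0))" for n
      by (auto simp: homogeneous_part_def fun_eq_iff)
    have f0: "tensor_class scale f = \<zero>\<^bsub>tensor_algebra scale\<^esub>"
      using f word_algebra.genideal_self[OF linearity_relations_carrier]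
      by (auto simp: tensor_class_eq_0_iff fW tensor_ideal_eq)
    have "to_TS (word.single g f) = \<zero>\<^bsub>TS\<^esub>" for g
      unfolding to_TS_def word.single_def tensor.zero_smash by (rule restrict_ext) (simp add: f0)
    then have "to_H (word.single g f) = \<zero>\<^bsub>H\<^esub>" for g
      using to_H.hom_zero unfolding to_H_def by (metis to_TS.hom_zero)
    moreover have "word.single g (\<lambda>w. 0) = \<zero>\<^bsub>W\<^esub>" for g
      by (auto simp: word.single_def word.zero_smash zero_word_algebra intro!: restrict_ext)
    ultimately show "f \<in> Z"
      by (auto simp: Z_def fW hp FB_zero)
  qed
  have comm: "commutators \<subseteq> Z"
  proof
    fix f :: "'v list \<Rightarrow> complex" assume f: "f \<in> commutators"
    then have fW: "f \<in> carrier word_algebra" using commutators_carrier by auto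
    from f obtain x y where xy: "f = monomial 1 [x, y] \<ominus>\<^bsub>word_algebra\<^esub> monomial 1 [y, x]"
      by (auto simp: commutators_def monomial_mult)
    have "length w = 2" if "f w \<noteq> 0" for w
      using that unfolding xy minus_word_algebra[OF monomial_closed]
      by (auto simp: monomial_def split: if_splits)
    then have hp: "homogeneous_part n f = (if n = 2 then f else (\<lambda>w. 0))" for n
      by (auto simp: homogeneous_part_def fun_eq_iff)
    have f1: "vec x \<otimes>\<^bsub>W\<^esub> vec y \<ominus>\<^bsub>W\<^esub> vec y \<otimes>\<^bsub>W\<^esub> vec x = word.single \<one> f"
      unfolding vec_mult xy
      by (rule W_eqI) (simp add: word.single_closed monomial_closed, simp add: word.single_closed monomial_closed,
          simp add: word.single_closed monomial_closed W_minus_apply W_single_apply minus_word_algebra)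
    have k: "to_H (word.single \<one> f) = to_H (group_alg (\<kappa> x y))"
      using to_H_group_alg[of x y] unfolding f1 ..
    \<comment> \<open>A group element on the right keeps \<open>\<kappa>(x,y)\<close> in degree 0,
      that is in \<open>below 1\<close>, which is even smaller than the required
      \<open>below 2\<close>.\<close>
    have "to_H (word.single g f) \<in> FB 2" if g: "g \<in> carrier G" for g
    proof -
      have "word.single g f = word.single \<one> f \<otimes>\<^bsub>W\<^esub> word.single g (monomial 1 [])"
        using g fW
        by (simp add: single_mult_single monomial_closed word_act_monomial mult_monomial_Nil)
      then have "to_H (word.single g f) = to_H (group_alg (\<kappa> x y) \<otimes>\<^bsub>W\<^esub> word.single g (monomial 1 []))"
        by (simp add: k word.single_closed monomial_closed fW group_alg_closed)
      moreover have "group_alg (\<kappa> x y) \<in> below 1" "word.single g (monomial 1 []) \<in> below 1"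
        by (simp_all add: below_def group_alg_closed word.single_closed monomial_closed W_single_apply)
          (auto simp: group_alg_def monomial_def split: if_splits)
      from below_mono[OF below_mult[OF this], of 2]
      have "group_alg (\<kappa> x y) \<otimes>\<^bsub>W\<^esub> word.single g (monomial 1 []) \<in> below 2" by simp
      ultimately show ?thesis by (auto simp: filt_below_eq)
    qed
    moreover have "word.single g (\<lambda>w. 0) = \<zero>\<^bsub>W\<^esub>" for g
      by (auto simp: word.single_def word.zero_smash zero_word_algebra intro!: restrict_ext)
    ultimately show "f \<in> Z"
      by (auto simp: Z_def fW hp FB_zero)
  qed
  have parts: "to_H (hom_part n (word.single g (a g))) \<in> FB n" if g: "g \<in> carrier G" for g
  proof -
    have "sym_class scale (a g) = \<zero>\<^bsub>sym_algebra scale\<^esub>"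
      using fun_cong[OF a(2), of g] g by (simp add: to_SS_def sym.zero_smash)
    then have "a g \<in> Z"
      using sym_class_eq_0_mem[OF Z lin comm W_apply_closed[OF a(1) g]] by simp
    then show ?thesis using g by (auto simp: Z_def single_hom)
  qed
  from a(1) show ?thesis
  proof (induction rule: word.smash_induct)
    case zero
    have "hom_part n \<zero>\<^bsub>W\<^esub> = \<zero>\<^bsub>W\<^esub>"
      by (rule W_eqI) (auto simp: hom_part_closed hom_part_apply W_zero_apply)
    then show ?case by (simp add: FB_zero)
  next
    case (add f h)
    then show ?case by (simp add: hom_part_add hom_part_closed FB_add)
  qed (rule parts)
qed

text \<open>Two lifts differ by an element of the kernel of \<open>to_SS\<close>, whose homogeneous
  parts fall into \<open>FB n\<close>; hence all cosets in the union coincide.\<close>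

lemma natural_hom_to_SS:
  assumes a: "a \<in> carrier W"
  shows "\<xi> (to_SS a) n = FB n +>\<^bsub>H\<^esub> to_H (hom_part n a)"
proof -
  let ?\<Phi> = "{\<phi> \<in> carrier G \<rightarrow> carrier word_algebra. to_SS a = (\<lambda>g\<in>carrier G. sym_class scale (\<phi> g))}"
  have "FB n +>\<^bsub>H\<^esub> kappa_class scale G \<rho> \<kappa> (\<lambda>g\<in>carrier G. tensor_class scale (homogeneous_part n (\<phi> g)))
     = FB n +>\<^bsub>H\<^esub> to_H (hom_part n a)" if \<phi>: "\<phi> \<in> ?\<Phi>" for \<phi>
  proof -
    let ?\<phi> = "restrict \<phi> (carrier G)"
    have \<phi>W: "?\<phi> \<in> carrier W" using \<phi> by (auto simp: word.carrier_smash)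
    have eq: "kappa_class scale G \<rho> \<kappa> (\<lambda>g\<in>carrier G. tensor_class scale (homogeneous_part n (\<phi> g))) = to_H (hom_part n ?\<phi>)"
      unfolding to_H_def to_TS_def hom_part_def by (auto intro!: arg_cong[where f = "kappa_class scale G \<rho> \<kappa>"] restrict_ext)
    have "to_SS ?\<phi> = to_SS a"
      using \<phi> by (auto simp: to_SS_def intro!: restrict_ext)
    then have "to_SS (?\<phi> \<ominus>\<^bsub>W\<^esub> a) = \<zero>\<^bsub>SS\<^esub>"
      using a \<phi>W by (simp add: a_minus_def SS.r_neg)
    then have "to_H (hom_part n (?\<phi> \<ominus>\<^bsub>W\<^esub> a)) \<in> FB n"
      using a \<phi>W by (intro to_H_hom_part_kernel) simp_all
    then have "to_H (hom_part n ?\<phi>) \<ominus>\<^bsub>H\<^esub> to_H (hom_part n a) \<in> FB n"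
      using a \<phi>W by (simp add: hom_part_minus hom_part_closed) (simp add: a_minus_def hom_part_closed)
    then show ?thesis
      unfolding eq using a \<phi>W by (subst abelian_subgroup.coset_eq_iff[OF FB_subgroup]) (auto simp: hom_part_closed)
  qed
  moreover have "a \<in> ?\<Phi>"
    using a by (auto simp: to_SS_def W_apply_closed)
  ultimately show ?thesis
    unfolding natural_hom_def by blast
qed

section \<open>The natural homomorphism is a surjective ring homomorphism\<close>

lemma coset_mem_carrier: "x \<in> carrier H \<Longrightarrow> y \<in> FB n +>\<^bsub>H\<^esub> x \<Longrightarrow> y \<in> carrier H"
  using to_H.S.a_r_coset_subset_G[of "FB n" x] FB_closed by blast

lemma GR_simps:
  "carrier GR = {u. (\<forall>n. \<exists>x\<in>F n. u n = FB n +>\<^bsub>H\<^esub> x) \<and> finite {n. u n \<noteq> FB n}}"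
  "u \<otimes>\<^bsub>GR\<^esub> v = (\<lambda>n. \<Union>x\<in>{x. \<forall>i. x i \<in> u i}. \<Union>y\<in>{y. \<forall>i. y i \<in> v i}.
         FB n +>\<^bsub>H\<^esub> finsum H (\<lambda>i. x i \<otimes>\<^bsub>H\<^esub> y (n - i)) {..n})"
  "\<one>\<^bsub>GR\<^esub> = (\<lambda>n. FB n +>\<^bsub>H\<^esub> (if n = 0 then \<one>\<^bsub>H\<^esub> else \<zero>\<^bsub>H\<^esub>))"
  "u \<oplus>\<^bsub>GR\<^esub> v = (\<lambda>n. u n <+>\<^bsub>H\<^esub> v n)"
  by (simp_all add: assoc_graded_def)

lemma FB_coset_zero: "FB n +>\<^bsub>H\<^esub> \<zero>\<^bsub>H\<^esub> = FB n"
  by (rule to_H.S.a_coset_add_zero) (use FB_closed in auto)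

lemma natural_hom_closed:
  assumes a: "a \<in> carrier W"
  shows "\<xi> (to_SS a) \<in> carrier GR"
proof -
  have "\<exists>x\<in>F n. FB n +>\<^bsub>H\<^esub> to_H (hom_part n a) = FB n +>\<^bsub>H\<^esub> x" for n
    unfolding filtration_eq using hom_part_below[OF a] by blast
  moreover have "finite {n. FB n +>\<^bsub>H\<^esub> to_H (hom_part n a) \<noteq> FB n}"
  proof (rule finite_subset)
    show "{n. FB n +>\<^bsub>H\<^esub> to_H (hom_part n a) \<noteq> FB n} \<subseteq> (\<Union>g\<in>carrier G. length ` {w. a g w \<noteq> 0})"
    proof (rule subsetI, rule ccontr)
      fix n assume n: "n \<in> {n. FB n +>\<^bsub>H\<^esub> to_H (hom_part n a) \<noteq> FB n}"
        and "n \<notin> (\<Union>g\<in>carrier G. length ` {w. a g w \<noteq> 0})"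
      then have "hom_part n a = \<zero>\<^bsub>W\<^esub>"
        using a by (intro W_eqI) (auto simp: hom_part_closed hom_part_apply W_zero_apply)
      with n show False by (simp add: FB_coset_zero)
    qed
    show "finite (\<Union>g\<in>carrier G. length ` {w. a g w \<noteq> 0})"
      using finite_G W_apply_closed[OF a] by (auto simp: carrier_word_algebra)
  qed
  ultimately show ?thesis
    using a by (simp add: GR_simps natural_hom_to_SS)
qed

lemma natural_hom_mult:
  assumes a: "a \<in> carrier W" and b: "b \<in> carrier W"
  shows "\<xi> (to_SS a \<otimes>\<^bsub>SS\<^esub> to_SS b) = \<xi> (to_SS a) \<otimes>\<^bsub>GR\<^esub> \<xi> (to_SS b)"
proof
  fix n
  let ?a = "\<lambda>i. to_H (hom_part i a)" and ?b = "\<lambda>i. to_H (hom_part i b)"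
  have ab: "?a i \<in> carrier H" "?b i \<in> carrier H" for i
    using a b by (simp_all add: hom_part_closed)
  \<comment> \<open>With \<open>x i = p + ?a i\<close> and
    \<open>y (n - i) = q + ?b (n - i)\<close>, the error in the product is
    \<open>p y + ?a q\<close>, which lies one filtration step lower.\<close>
  have coset_eq: "FB n +>\<^bsub>H\<^esub> finsum H (\<lambda>i. x i \<otimes>\<^bsub>H\<^esub> y (n - i)) {..n} = FB n +>\<^bsub>H\<^esub> finsum H (\<lambda>i. ?a i \<otimes>\<^bsub>H\<^esub> ?b (n - i)) {..n}"
    if x: "\<And>i. x i \<in> FB i +>\<^bsub>H\<^esub> ?a i" and y: "\<And>i. y i \<in> FB i +>\<^bsub>H\<^esub> ?b i" for x y
  proof (rule abelian_subgroup.coset_finsum_cong[OF FB_subgroup])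
    fix i assume i: "i \<in> {..n}"
    obtain p where p: "p \<in> FB i" "x i = p \<oplus>\<^bsub>H\<^esub> ?a i"
      using x[of i] unfolding a_r_coset_def' by blast
    obtain q where q: "q \<in> FB (n - i)" "y (n - i) = q \<oplus>\<^bsub>H\<^esub> ?b (n - i)"
      using y[of "n - i"] unfolding a_r_coset_def' by blast
    have yH: "y (n - i) \<in> carrier H" using coset_mem_carrier[OF ab(2) y] .
    have yF: "y (n - i) \<in> FB (Suc (n - i))"
    proof -
      have "q \<in> FB (Suc (n - i))" using q(1) below_mono[of _ "n - i" "Suc (n - i)"] by (auto simp: filt_below_eq)
      then show ?thesis using q(2) FB_add to_H_hom_part[OF b] by simp
    qed
    have "x i \<otimes>\<^bsub>H\<^esub> y (n - i) = (p \<otimes>\<^bsub>H\<^esub> y (n - i) \<oplus>\<^bsub>H\<^esub> ?a i \<otimes>\<^bsub>H\<^esub> q) \<oplus>\<^bsub>H\<^esub> ?a i \<otimes>\<^bsub>H\<^esub> ?b (n - i)"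
      using FB_closed[OF p(1)] FB_closed[OF q(1)] ab yH
      by (simp add: p(2) to_H.S.l_distr to_H.S.a_assoc) (simp add: q(2) to_H.S.r_distr)
    moreover have "p \<otimes>\<^bsub>H\<^esub> y (n - i) \<oplus>\<^bsub>H\<^esub> ?a i \<otimes>\<^bsub>H\<^esub> q \<in> FB n"
      using FB_Suc_mult(1)[OF p(1) yF] FB_Suc_mult(2)[OF q(1) to_H_hom_part[OF a, of i]] i
      by (intro FB_add) simp_all
    ultimately show "x i \<otimes>\<^bsub>H\<^esub> y (n - i) \<in> FB n +>\<^bsub>H\<^esub> (?a i \<otimes>\<^bsub>H\<^esub> ?b (n - i))"
      unfolding a_r_coset_def' by blast
  qed (use ab in auto)
  have self: "?a i \<in> FB i +>\<^bsub>H\<^esub> ?a i" "?b i \<in> FB i +>\<^bsub>H\<^esub> ?b i" for i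
    using ab by (auto intro: abelian_subgroup.a_rcos_self[OF FB_subgroup])
  have "(\<xi> (to_SS a) \<otimes>\<^bsub>GR\<^esub> \<xi> (to_SS b)) n
      = (\<Union>x\<in>{x. \<forall>i. x i \<in> FB i +>\<^bsub>H\<^esub> ?a i}. \<Union>y\<in>{y. \<forall>i. y i \<in> FB i +>\<^bsub>H\<^esub> ?b i}.
         FB n +>\<^bsub>H\<^esub> finsum H (\<lambda>i. x i \<otimes>\<^bsub>H\<^esub> y (n - i)) {..n})"
    unfolding GR_simps natural_hom_to_SS[OF a] natural_hom_to_SS[OF b] ..
  also have "\<dots> = FB n +>\<^bsub>H\<^esub> finsum H (\<lambda>i. ?a i \<otimes>\<^bsub>H\<^esub> ?b (n - i)) {..n}"
    by (rule UN_UN_const[where p = ?a and q = ?b]) (use coset_eq self in blast)+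
  also have "finsum H (\<lambda>i. ?a i \<otimes>\<^bsub>H\<^esub> ?b (n - i)) {..n} = to_H (hom_part n (a \<otimes>\<^bsub>W\<^esub> b))"
    using a b by (simp add: hom_part_mult hom_part_closed to_H.hom_finsum Pi_def comp_def)
  also have "FB n +>\<^bsub>H\<^esub> to_H (hom_part n (a \<otimes>\<^bsub>W\<^esub> b)) = \<xi> (to_SS (a \<otimes>\<^bsub>W\<^esub> b)) n"
    using a b by (simp add: natural_hom_to_SS del: to_SS.hom_mult)
  finally show "\<xi> (to_SS a \<otimes>\<^bsub>SS\<^esub> to_SS b) n = (\<xi> (to_SS a) \<otimes>\<^bsub>GR\<^esub> \<xi> (to_SS b)) n"
    using a b by simp
qed

lemma natural_hom_add:
  assumes a: "a \<in> carrier W" and b: "b \<in> carrier W"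
  shows "\<xi> (to_SS a \<oplus>\<^bsub>SS\<^esub> to_SS b) = \<xi> (to_SS a) \<oplus>\<^bsub>GR\<^esub> \<xi> (to_SS b)"
proof
  fix n
  have "\<xi> (to_SS (a \<oplus>\<^bsub>W\<^esub> b)) n = (\<xi> (to_SS a) \<oplus>\<^bsub>GR\<^esub> \<xi> (to_SS b)) n"
    using a b abelian_subgroup.a_rcos_sum[OF FB_subgroup, of "to_H (hom_part n a)" "to_H (hom_part n b)" n]
    by (simp add: natural_hom_to_SS GR_simps hom_part_add hom_part_closed del: to_SS.hom_add)
  then show "\<xi> (to_SS a \<oplus>\<^bsub>SS\<^esub> to_SS b) n = (\<xi> (to_SS a) \<oplus>\<^bsub>GR\<^esub> \<xi> (to_SS b)) n"
    using a b by simp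
qed

lemma natural_hom_one: "\<xi> \<one>\<^bsub>SS\<^esub> = \<one>\<^bsub>GR\<^esub>"
proof
  fix n
  have "hom_part n \<one>\<^bsub>W\<^esub> = (if n = 0 then \<one>\<^bsub>W\<^esub> else \<zero>\<^bsub>W\<^esub>)"
    by (rule W_eqI) (simp add: hom_part_closed, simp, auto simp: hom_part_apply W_zero_apply word.one_smash
        one_word_algebra zero_word_algebra monomial_def)
  moreover have "\<xi> (to_SS \<one>\<^bsub>W\<^esub>) n = FB n +>\<^bsub>H\<^esub> to_H (hom_part n \<one>\<^bsub>W\<^esub>)"
    by (rule natural_hom_to_SS) simp
  ultimately show "\<xi> \<one>\<^bsub>SS\<^esub> n = \<one>\<^bsub>GR\<^esub> n"
    by (simp add: GR_simps)
qed

lemma natural_hom_ring_hom: "\<xi> \<in> ring_hom SS GR"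
proof (rule ring_hom_memI)
  fix x y assume "x \<in> carrier SS" "y \<in> carrier SS"
  then obtain a b where "x = to_SS a" "a \<in> carrier W" "y = to_SS b" "b \<in> carrier W"
    using to_SS.lift by blast
  then show "\<xi> x \<in> carrier GR" "\<xi> (x \<otimes>\<^bsub>SS\<^esub> y) = \<xi> x \<otimes>\<^bsub>GR\<^esub> \<xi> y" "\<xi> (x \<oplus>\<^bsub>SS\<^esub> y) = \<xi> x \<oplus>\<^bsub>GR\<^esub> \<xi> y"
    using natural_hom_closed natural_hom_mult natural_hom_add by metis+
qed (rule natural_hom_one)

lemma natural_hom_surj: "\<xi> ` carrier SS = carrier GR"
proof
  show "\<xi> ` carrier SS \<subseteq> carrier GR"
    using ring_hom_closed[OF natural_hom_ring_hom] by blast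
  show "carrier GR \<subseteq> \<xi> ` carrier SS"
  proof
    fix u assume "u \<in> carrier GR"
    then have u: "\<And>n. \<exists>b. b \<in> below (Suc n) \<and> u n = FB n +>\<^bsub>H\<^esub> to_H b" "finite {n. u n \<noteq> FB n}"
      unfolding GR_simps filtration_eq by blast+
    then obtain b where b: "\<And>n. b n \<in> below (Suc n)" "\<And>n. u n = FB n +>\<^bsub>H\<^esub> to_H (b n)" by metis
    \<comment> \<open>The words of length \<open>n\<close> are taken from a representative of
      \<open>u n\<close>; degrees in which \<open>u n\<close> is zero are skipped, which keeps the
      support finite.\<close>
    define a where "a = (\<lambda>g\<in>carrier G. \<lambda>w. if u (length w) \<noteq> FB (length w) then b (length w) g w else 0)"
    have bW: "b n \<in> carrier W" for n using b(1) below_closed by blast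
    have aW: "a \<in> carrier W"
    proof -
      have "finite {w. a g w \<noteq> 0}" if g: "g \<in> carrier G" for g
      proof (rule finite_subset)
        show "{w. a g w \<noteq> 0} \<subseteq> (\<Union>n\<in>{n. u n \<noteq> FB n}. {w. b n g w \<noteq> 0})"
          using g by (auto simp: a_def)
        show "finite (\<Union>n\<in>{n. u n \<noteq> FB n}. {w. b n g w \<noteq> 0})"
          using u(2) W_apply_closed[OF bW g] by (auto simp: carrier_word_algebra)
      qed
      then show ?thesis
        unfolding word.carrier_smash by (intro PiE_I) (simp_all add: carrier_word_algebra, simp add: a_def)
    qed
    have "\<xi> (to_SS a) n = u n" for n
    proof (cases "u n = FB n")
      case True
      have "hom_part n a = \<zero>\<^bsub>W\<^esub>"
        using aW True by (intro W_eqI) (auto simp: hom_part_closed hom_part_apply W_zero_apply a_def)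
      then show ?thesis using aW True by (simp add: natural_hom_to_SS FB_coset_zero)
    next
      case False
      have "hom_part n a = hom_part n (b n)"
        using aW bW False by (intro W_eqI) (auto simp: hom_part_closed hom_part_apply a_def)
      \<comment> \<open>The representative \<open>b n\<close> may also contain shorter words, but
        these only contribute to \<open>FB n\<close>.\<close>
      moreover have "b n \<ominus>\<^bsub>W\<^esub> hom_part n (b n) \<in> below n"
        using b(1)[of n] bW[of n]
        by (auto simp: below_def W_minus_apply hom_part_closed hom_part_apply less_Suc_eq split: if_splits)
      then have "to_H (b n) \<ominus>\<^bsub>H\<^esub> to_H (hom_part n (b n)) \<in> FB n"
        using bW[of n] by (auto simp: filt_below_eq a_minus_def hom_part_closed intro!: image_eqI)
      then have "FB n +>\<^bsub>H\<^esub> to_H (b n) = FB n +>\<^bsub>H\<^esub> to_H (hom_part n (b n))"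
        using bW[of n] by (subst abelian_subgroup.coset_eq_iff[OF FB_subgroup]) (auto simp: hom_part_closed)
      ultimately show ?thesis using aW b(2)[of n] by (simp add: natural_hom_to_SS)
    qed
    then have "u = \<xi> (to_SS a)" by auto
    then show "u \<in> \<xi> ` carrier SS" using aW by auto
  qed
qed

text \<open>As \<xi> is a surjective homomorphism, only triviality of its kernel is at stake. On
  lifts in \<open>W\<close> this is the converse of \<open>to_H_hom_part_kernel\<close>.\<close>

lemma natural_hom_iso_iff:
  "\<xi> \<in> ring_iso SS GR \<longleftrightarrow>
     (\<forall>a\<in>carrier W. (\<forall>n. to_H (hom_part n a) \<in> FB n) \<longrightarrow> to_SS a = \<zero>\<^bsub>SS\<^esub>)"
proof -
  have eq: "\<xi> (to_SS a) = \<xi> (to_SS b) \<longleftrightarrow> (\<forall>n. to_H (hom_part n (a \<ominus>\<^bsub>W\<^esub> b)) \<in> FB n)"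
    if "a \<in> carrier W" "b \<in> carrier W" for a b
  proof -
    have "\<xi> (to_SS a) n = \<xi> (to_SS b) n \<longleftrightarrow> to_H (hom_part n (a \<ominus>\<^bsub>W\<^esub> b)) \<in> FB n" for n
      using that by (simp add: natural_hom_to_SS abelian_subgroup.coset_eq_iff[OF FB_subgroup]
          hom_part_minus hom_part_closed) (simp add: a_minus_def hom_part_closed)
    then show ?thesis by (auto simp: fun_eq_iff)
  qed
  have "inj_on \<xi> (carrier SS) \<longleftrightarrow>
     (\<forall>a\<in>carrier W. (\<forall>n. to_H (hom_part n a) \<in> FB n) \<longrightarrow> to_SS a = \<zero>\<^bsub>SS\<^esub>)"
  proof
    assume inj: "inj_on \<xi> (carrier SS)"
    show "\<forall>a\<in>carrier W. (\<forall>n. to_H (hom_part n a) \<in> FB n) \<longrightarrow> to_SS a = \<zero>\<^bsub>SS\<^esub>"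
    proof (intro ballI impI)
      fix a assume a: "a \<in> carrier W" "\<forall>n. to_H (hom_part n a) \<in> FB n"
      then have "\<xi> (to_SS a) = \<xi> (to_SS \<zero>\<^bsub>W\<^esub>)"
        by (subst eq) (auto simp: a_minus_def)
      then have "to_SS a = to_SS \<zero>\<^bsub>W\<^esub>"
        using inj a(1) by (auto dest!: inj_onD)
      then show "to_SS a = \<zero>\<^bsub>SS\<^esub>" by simp
    qed
  next
    assume *: "\<forall>a\<in>carrier W. (\<forall>n. to_H (hom_part n a) \<in> FB n) \<longrightarrow> to_SS a = \<zero>\<^bsub>SS\<^esub>"
    show "inj_on \<xi> (carrier SS)"
    proof (rule inj_onI)
      fix x y assume "x \<in> carrier SS" "y \<in> carrier SS" and xy: "\<xi> x = \<xi> y"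
      then obtain a b where ab: "x = to_SS a" "a \<in> carrier W" "y = to_SS b" "b \<in> carrier W"
        using to_SS.lift by blast
      then have "to_SS (a \<ominus>\<^bsub>W\<^esub> b) = \<zero>\<^bsub>SS\<^esub>"
        using * eq[of a b] xy by simp
      then have "to_SS a \<ominus>\<^bsub>SS\<^esub> to_SS b = \<zero>\<^bsub>SS\<^esub>"
        using ab by (simp add: a_minus_def)
      then show "x = y" using ab by simp
    qed
  qed
  then show ?thesis
    using natural_hom_ring_hom natural_hom_surj by (simp add: ring_iso_def bij_betw_def)
qed

end

section \<open>Functionals on the word algebra\<close>

text \<open>A basis of \<open>S\<close> stays independent after adjoining \<open>v\<close>, so the
  values 0 on the basis and 1 at \<open>v\<close> can be prescribed.\<close>

lemma (in vector_space) separating_functional: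
  assumes "subspace S" "v \<notin> S"
  obtains f where "Vector_Spaces.linear scale (*) f" "\<And>x. x \<in> S \<Longrightarrow> f x = 0" "f v \<noteq> 0"
proof -
  have "vector_space ((*) :: 'a \<Rightarrow> _)"
    by standard (auto simp: algebra_simps)
  then interpret pair: vector_space_pair scale "(*)"
    by (intro vector_space_pair.intro vector_space_axioms)
  obtain B where B: "B \<subseteq> S" "independent B" "S \<subseteq> span B"
    using maximal_independent_subset by blast
  have "span B \<subseteq> S" using B(1) assms(1) by (simp add: span_minimal)
  then have "v \<notin> span B" using assms(2) by blast
  then have ind: "independent (insert v B)" using B(2) by (rule independent_insertI)
  obtain f where f: "Vector_Spaces.linear scale (*) f" "\<forall>x\<in>insert v B. f x = (if x = v then 1 else 0)"
    using pair.linear_independent_extend[OF ind, of "\<lambda>x. if x = v then 1 else 0"] by blast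
  have "f x = 0" if "x \<in> S" for x
  proof (rule pair.linear_eq_0_on_span[OF f(1)])
    show "x \<in> span B" using that B(3) by blast
    show "f b = 0" if "b \<in> B" for b
      using that f(2) assms(2) B(1) by auto
  qed
  with f that show thesis by auto
qed

section \<open>Functionals on words and the ideals they detect\<close>

definition pairing :: "('v list \<Rightarrow> complex) \<Rightarrow> ('v list \<Rightarrow> complex) \<Rightarrow> complex" where
  "pairing \<Lambda> f = (\<Sum>w | f w \<noteq> 0. f w * \<Lambda> w)"

lemma pairing_eq_sum: "finite A \<Longrightarrow> {w. f w \<noteq> 0} \<subseteq> A \<Longrightarrow> pairing \<Lambda> f = (\<Sum>w\<in>A. f w * \<Lambda> w)"
  unfolding pairing_def by (rule sum.mono_neutral_left) auto

lemma pairing_add: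
  assumes "f \<in> carrier word_algebra" "h \<in> carrier word_algebra"
  shows "pairing \<Lambda> (f \<oplus>\<^bsub>word_algebra\<^esub> h) = pairing \<Lambda> f + pairing \<Lambda> h"
proof -
  let ?A = "{w. f w \<noteq> 0} \<union> {w. h w \<noteq> 0}"
  have A: "finite ?A" using assms by (simp add: carrier_word_algebra)
  have "pairing \<Lambda> (f \<oplus>\<^bsub>word_algebra\<^esub> h) = (\<Sum>w\<in>?A. (f \<oplus>\<^bsub>word_algebra\<^esub> h) w * \<Lambda> w)"
    by (rule pairing_eq_sum[OF A]) (auto simp: add_word_algebra)
  moreover have "pairing \<Lambda> f = (\<Sum>w\<in>?A. f w * \<Lambda> w)" "pairing \<Lambda> h = (\<Sum>w\<in>?A. h w * \<Lambda> w)"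
    by (rule pairing_eq_sum[OF A]; auto)+
  ultimately show ?thesis by (simp add: add_word_algebra sum.distrib algebra_simps)
qed

lemma pairing_monomial: "pairing \<Lambda> (monomial a w) = a * \<Lambda> w"
proof -
  have "pairing \<Lambda> (monomial a w) = (\<Sum>w'\<in>{w}. monomial a w w' * \<Lambda> w')"
    by (rule pairing_eq_sum) (auto simp: monomial_def)
  then show ?thesis by (simp add: monomial_def[of a w])
qed

lemma pairing_zero: "pairing \<Lambda> \<zero>\<^bsub>word_algebra\<^esub> = 0"
  by (simp add: pairing_def zero_word_algebra)

lemma pairing_minus:
  assumes "f \<in> carrier word_algebra" "h \<in> carrier word_algebra"
  shows "pairing \<Lambda> (f \<ominus>\<^bsub>word_algebra\<^esub> h) = pairing \<Lambda> f - pairing \<Lambda> h"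
proof -
  have "pairing \<Lambda> (f \<ominus>\<^bsub>word_algebra\<^esub> h) + pairing \<Lambda> h = pairing \<Lambda> (f \<ominus>\<^bsub>word_algebra\<^esub> h \<oplus>\<^bsub>word_algebra\<^esub> h)"
    using assms by (simp add: pairing_add)
  also have "f \<ominus>\<^bsub>word_algebra\<^esub> h \<oplus>\<^bsub>word_algebra\<^esub> h = f"
    using assms by (simp add: minus_word_algebra add_word_algebra)
  finally show ?thesis by (simp add: algebra_simps)
qed

text \<open>The largest two-sided ideal in the kernel of \<open>pairing \<Lambda>\<close>.\<close>

definition pairing_ideal :: "('v list \<Rightarrow> complex) \<Rightarrow> ('v list \<Rightarrow> complex) set" where
  "pairing_ideal \<Lambda> = {f \<in> carrier word_algebra. \<forall>b\<in>carrier word_algebra. \<forall>c\<in>carrier word_algebra.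
     pairing \<Lambda> (b \<otimes>\<^bsub>word_algebra\<^esub> f \<otimes>\<^bsub>word_algebra\<^esub> c) = 0}"

lemma ideal_pairing_ideal:
  fixes \<Lambda> :: "'a list \<Rightarrow> complex"
  shows "ideal (pairing_ideal \<Lambda>) word_algebra"
proof (rule ideal_of_closed[OF word_algebra_ring])
  fix f c :: "'a list \<Rightarrow> complex" assume f: "f \<in> pairing_ideal \<Lambda>" and c: "c \<in> carrier word_algebra"
  then have fW: "f \<in> carrier word_algebra" by (simp add: pairing_ideal_def)
  have "b \<otimes>\<^bsub>word_algebra\<^esub> (c \<otimes>\<^bsub>word_algebra\<^esub> f) \<otimes>\<^bsub>word_algebra\<^esub> e = (b \<otimes>\<^bsub>word_algebra\<^esub> c) \<otimes>\<^bsub>word_algebra\<^esub> f \<otimes>\<^bsub>word_algebra\<^esub> e"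
    "b \<otimes>\<^bsub>word_algebra\<^esub> (f \<otimes>\<^bsub>word_algebra\<^esub> c) \<otimes>\<^bsub>word_algebra\<^esub> e = b \<otimes>\<^bsub>word_algebra\<^esub> f \<otimes>\<^bsub>word_algebra\<^esub> (c \<otimes>\<^bsub>word_algebra\<^esub> e)" for b e :: "'a list \<Rightarrow> complex"
    by (simp_all only: word_algebra_assoc)
  with f c fW show "c \<otimes>\<^bsub>word_algebra\<^esub> f \<in> pairing_ideal \<Lambda>" "f \<otimes>\<^bsub>word_algebra\<^esub> c \<in> pairing_ideal \<Lambda>"
    by (auto simp: pairing_ideal_def)
qed (auto simp: pairing_ideal_def pairing_zero word_algebra.l_distr word_algebra.r_distr pairing_add)

lemma pairing_ideal_imp_pairing_0: "f \<in> pairing_ideal \<Lambda> \<Longrightarrow> pairing \<Lambda> f = 0"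
proof -
  assume f: "f \<in> pairing_ideal \<Lambda>"
  then have "pairing \<Lambda> (\<one>\<^bsub>word_algebra\<^esub> \<otimes>\<^bsub>word_algebra\<^esub> f \<otimes>\<^bsub>word_algebra\<^esub> \<one>\<^bsub>word_algebra\<^esub>) = 0"
    unfolding pairing_ideal_def by blast
  then show ?thesis using f by (simp add: pairing_ideal_def)
qed

text \<open>The condition is additive in both outer factors, which are sums of monomials.\<close>

lemma mem_pairing_idealI:
  fixes f :: "'a list \<Rightarrow> complex"
  assumes f: "f \<in> carrier word_algebra"
    and mon: "\<And>a u b v. pairing \<Lambda> (monomial a u \<otimes>\<^bsub>word_algebra\<^esub> f \<otimes>\<^bsub>word_algebra\<^esub> monomial b v) = 0"
  shows "f \<in> pairing_ideal \<Lambda>"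
proof -
  have "pairing \<Lambda> (b \<otimes>\<^bsub>word_algebra\<^esub> f \<otimes>\<^bsub>word_algebra\<^esub> c) = 0"
    if "b \<in> carrier word_algebra" and c: "c \<in> carrier word_algebra" for b c :: "'a list \<Rightarrow> complex"
    using that(1)
  proof (induction rule: word_algebra_induct)
    case (monomial a u)
    from c show ?case
      by (induction rule: word_algebra_induct)
        (use f in \<open>auto simp: word_algebra.r_distr pairing_add monomial_closed mon\<close>)
  qed (use f c in \<open>auto simp: word_algebra.l_distr pairing_add\<close>)
  with f show ?thesis by (auto simp: pairing_ideal_def)
qed

lemma monomial_sandwich_minus:
  assumes "f \<in> carrier word_algebra" "h \<in> carrier word_algebra"
  shows "monomial a u \<otimes>\<^bsub>word_algebra\<^esub> (f \<ominus>\<^bsub>word_algebra\<^esub> h) \<otimes>\<^bsub>word_algebra\<^esub> monomial b v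
      = monomial a u \<otimes>\<^bsub>word_algebra\<^esub> f \<otimes>\<^bsub>word_algebra\<^esub> monomial b v
        \<ominus>\<^bsub>word_algebra\<^esub> monomial a u \<otimes>\<^bsub>word_algebra\<^esub> h \<otimes>\<^bsub>word_algebra\<^esub> monomial b v"
  using assms by (simp add: a_minus_def word_algebra.l_distr word_algebra.r_distr monomial_closed
      word_algebra.l_minus word_algebra.r_minus)

lemma linearity_relations_pairing_ideal:
  fixes \<Lambda> :: "'v::ab_group_add list \<Rightarrow> complex"
  assumes "multilin scale \<Lambda>"
  shows "linearity_relations scale \<subseteq> pairing_ideal \<Lambda>"
proof
  have ml: "\<Lambda> (u @ (x + y) # v) = \<Lambda> (u @ x # v) + \<Lambda> (u @ y # v)" "\<Lambda> (u @ scale a x # v) = a * \<Lambda> (u @ x # v)" for u v x y a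
    using assms by (auto simp: multilin_def lin_fun_def)
  fix f assume f: "f \<in> linearity_relations scale"
  show "f \<in> pairing_ideal \<Lambda>"
  proof (rule mem_pairing_idealI)
    show "f \<in> carrier word_algebra" using f linearity_relations_carrier by blast
    fix a b :: complex and u v :: "'v list"
    from f show "pairing \<Lambda> (monomial a u \<otimes>\<^bsub>word_algebra\<^esub> f \<otimes>\<^bsub>word_algebra\<^esub> monomial b v) = 0"
      unfolding linearity_relations_def
      by (auto simp: monomial_sandwich_minus monomial_closed word_algebra.l_distr word_algebra.r_distr monomial_mult
          pairing_minus pairing_add pairing_monomial ml algebra_simps)
  qed
qed

lemma commutators_pairing_ideal:
  assumes "\<And>u x y v. \<Lambda> (u @ x # y # v) = \<Lambda> (u @ y # x # v)"
  shows "commutators \<subseteq> pairing_ideal \<Lambda>"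
proof
  fix f :: "'a list \<Rightarrow> complex" assume f: "f \<in> commutators"
  show "f \<in> pairing_ideal \<Lambda>"
  proof (rule mem_pairing_idealI)
    show "f \<in> carrier word_algebra" using f commutators_carrier by blast
    fix a b :: complex and u v :: "'a list"
    from f show "pairing \<Lambda> (monomial a u \<otimes>\<^bsub>word_algebra\<^esub> f \<otimes>\<^bsub>word_algebra\<^esub> monomial b v) = 0"
      unfolding commutators_def
      by (auto simp: monomial_sandwich_minus monomial_closed monomial_mult pairing_minus pairing_monomial assms)
  qed
qed

text \<open>Multilinearity and symmetry place all relations of SV in the ideal
  \<open>pairing_ideal \<Lambda>\<close>, which therefore contains the whole kernel of
  \<open>sym_class\<close>.\<close>

lemma pairing_sym_class_0:
  assumes "multilin scale \<Lambda>" "\<And>u x y v. \<Lambda> (u @ x # y # v) = \<Lambda> (u @ y # x # v)"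
    and "f \<in> carrier word_algebra" "sym_class scale f = \<zero>\<^bsub>sym_algebra scale\<^esub>"
  shows "pairing \<Lambda> f = 0"
  proof -
  have "commutators \<subseteq> pairing_ideal \<Lambda>" by (rule commutators_pairing_ideal) (rule assms(2))
  from sym_class_eq_0_mem[OF ideal_pairing_ideal linearity_relations_pairing_ideal[OF assms(1)] this assms(3,4)]
  show ?thesis by (rule pairing_ideal_imp_pairing_0)
qed

lemma pairing_tensor_class_0:
  assumes "multilin scale \<Lambda>"
    and "f \<in> carrier word_algebra" "tensor_class scale f = \<zero>\<^bsub>tensor_algebra scale\<^esub>"
  shows "pairing \<Lambda> f = 0"
  using tensor_class_eq_0_mem[OF ideal_pairing_ideal linearity_relations_pairing_ideal[OF assms(1)] assms(2,3)]
  by (rule pairing_ideal_imp_pairing_0)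

lemma pairing_homogeneous_parts:
  assumes f: "f \<in> carrier word_algebra" and "\<And>n. pairing \<Lambda> (homogeneous_part n f) = 0"
  shows "pairing \<Lambda> f = 0"
proof -
  let ?A = "{w. f w \<noteq> 0}"
  have A: "finite ?A" using f by (simp add: carrier_word_algebra)
  have "pairing \<Lambda> f = (\<Sum>w\<in>?A. \<Sum>n\<in>length ` ?A. homogeneous_part n f w * \<Lambda> w)"
    unfolding pairing_def
  proof (intro sum.cong refl)
    fix w assume w: "w \<in> ?A"
    have "(\<Sum>n\<in>length ` ?A. homogeneous_part n f w * \<Lambda> w) = (\<Sum>n\<in>length ` ?A. if n = length w then f w * \<Lambda> w else 0)"
      by (intro sum.cong refl) (auto simp: homogeneous_part_def)
    then show "f w * \<Lambda> w = (\<Sum>n\<in>length ` ?A. homogeneous_part n f w * \<Lambda> w)"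
      using w A by (simp add: sum.delta)
  qed
  also have "\<dots> = (\<Sum>n\<in>length ` ?A. \<Sum>w\<in>?A. homogeneous_part n f w * \<Lambda> w)"
    by (rule sum.swap)
  also have "\<dots> = (\<Sum>n\<in>length ` ?A. pairing \<Lambda> (homogeneous_part n f))"
    by (intro sum.cong refl pairing_eq_sum[symmetric] A) (auto simp: homogeneous_part_def)
  finally show ?thesis using assms(2) by simp
qed

text \<open>Linear algebra provides a functional that vanishes on the kernel of
  \<open>sym_class\<close> but not at \<open>f\<close>. Its values on words are multilinear and
  symmetric because the relations, multiplied by words on both sides, stay in the kernel.\<close>

lemma sym_class_separated:
  fixes f :: "'v::ab_group_add list \<Rightarrow> complex"
  assumes f: "f \<in> carrier word_algebra" "sym_class scale f \<noteq> \<zero>\<^bsub>sym_algebra scale\<^esub>"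
  obtains \<Lambda> where "multilin scale \<Lambda>" "\<And>u x y v. \<Lambda> (u @ x # y # v) = \<Lambda> (u @ y # x # v)" "pairing \<Lambda> f \<noteq> 0"
proof -
  let ?sc = "\<lambda>(c::complex) (f :: 'v list \<Rightarrow> complex) w. c * f w"
  interpret V: vector_space ?sc
    by standard (auto simp: algebra_simps fun_eq_iff)
  let ?K = "{f \<in> carrier word_algebra. sym_class scale f = \<zero>\<^bsub>sym_algebra scale\<^esub>}"
  have plus: "f + h = f \<oplus>\<^bsub>word_algebra\<^esub> h" for f h :: "'v list \<Rightarrow> complex"
    by (auto simp: add_word_algebra)
  have smult: "?sc c f = monomial c [] \<otimes>\<^bsub>word_algebra\<^esub> f" for c f
    by (auto simp: monomial_mult_apply)
  have "V.subspace ?K"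
  proof (rule V.subspaceI)
    have zero: "(0 :: 'v list \<Rightarrow> complex) = \<zero>\<^bsub>word_algebra\<^esub>" by (auto simp: zero_word_algebra)
    show "0 \<in> ?K" unfolding zero by simp
    show "x + y \<in> ?K" if "x \<in> ?K" "y \<in> ?K" for x y
      using that unfolding plus by simp
    show "?sc c x \<in> ?K" if "x \<in> ?K" for c x
      using that unfolding smult by (simp add: monomial_closed)
  qed
  moreover have "f \<notin> ?K" using f by simp
  ultimately obtain \<phi> where \<phi>: "Vector_Spaces.linear ?sc (*) \<phi>" "\<And>x. x \<in> ?K \<Longrightarrow> \<phi> x = 0" "\<phi> f \<noteq> 0"
    using V.separating_functional by blast
  have l_add: "\<phi> (f \<oplus>\<^bsub>word_algebra\<^esub> h) = \<phi> f + \<phi> h" and l_scale: "\<phi> (?sc c f) = c * \<phi> f" for f h c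
    using \<phi>(1) unfolding plus[symmetric] by (auto simp: Vector_Spaces.linear_iff)
  have l_minus: "\<phi> (f \<ominus>\<^bsub>word_algebra\<^esub> h) = \<phi> f - \<phi> h" if "h \<in> carrier word_algebra" for f h
    using l_add[of "\<lambda>w. f w - h w" h] that by (simp add: add_word_algebra minus_word_algebra)
  define \<Lambda> where "\<Lambda> w = \<phi> (monomial 1 w)" for w
  have l_monomial: "\<phi> (monomial a w) = a * \<Lambda> w" for a w
  proof -
    have "monomial a w = ?sc a (monomial 1 w)" by (auto simp: monomial_def)
    then show ?thesis using l_scale[of a "monomial 1 w"] by (simp only: \<Lambda>_def)
  qed
  have rel: "\<phi> (monomial 1 u \<otimes>\<^bsub>word_algebra\<^esub> g \<otimes>\<^bsub>word_algebra\<^esub> monomial 1 v) = 0"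
    if "g \<in> linearity_relations scale \<union> commutators" for u v g
  proof (rule \<phi>(2))
    have "g \<in> carrier word_algebra"
      using that linearity_relations_carrier[of scale] commutators_carrier by blast
    then show "monomial 1 u \<otimes>\<^bsub>word_algebra\<^esub> g \<otimes>\<^bsub>word_algebra\<^esub> monomial 1 v \<in> ?K"
      using sym_class_relations[OF that] by (simp add: monomial_closed)
  qed
  have "\<Lambda> (u @ (x + y) # v) = \<Lambda> (u @ x # v) + \<Lambda> (u @ y # v)" for u x y v
    using rel[of "monomial 1 [x + y] \<ominus>\<^bsub>word_algebra\<^esub> (monomial 1 [x] \<oplus>\<^bsub>word_algebra\<^esub> monomial 1 [y])" u v]
    by (auto simp: linearity_relations_def monomial_sandwich_minus monomial_closed word_algebra.l_distr word_algebra.r_distr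
        monomial_mult l_minus l_add l_monomial)
  moreover have "\<Lambda> (u @ scale a x # v) = a * \<Lambda> (u @ x # v)" for u a x v
    using rel[of "monomial 1 [scale a x] \<ominus>\<^bsub>word_algebra\<^esub> monomial a [x]" u v]
    by (auto simp: linearity_relations_def monomial_sandwich_minus monomial_closed monomial_mult l_minus l_monomial)
  ultimately have "multilin scale \<Lambda>" by (simp add: multilin_def lin_fun_def)
  moreover have "\<Lambda> (u @ x # y # v) = \<Lambda> (u @ y # x # v)" for u x y v
    using rel[of "monomial 1 [x] \<otimes>\<^bsub>word_algebra\<^esub> monomial 1 [y] \<ominus>\<^bsub>word_algebra\<^esub> monomial 1 [y] \<otimes>\<^bsub>word_algebra\<^esub> monomial 1 [x]" u v]
    by (auto simp: commutators_def monomial_sandwich_minus monomial_closed monomial_mult l_minus l_monomial)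
  moreover have "pairing \<Lambda> h = \<phi> h" if "h \<in> carrier word_algebra" for h
    using that by (induction rule: word_algebra_induct) (auto simp: pairing_add l_add pairing_monomial l_monomial)
  then have "pairing \<Lambda> f \<noteq> 0" using f(1) \<phi>(3) by simp
  ultimately show thesis by (rule that)
qed

section \<open>Functionals on the smash product, and injectivity of the natural homomorphism\<close>

context wedge_setting
begin

lemma W_induct [consumes 1, case_names add single]:
  assumes "b \<in> carrier W"
    and add: "\<And>a b. a \<in> carrier W \<Longrightarrow> b \<in> carrier W \<Longrightarrow> P a \<Longrightarrow> P b \<Longrightarrow> P (a \<oplus>\<^bsub>W\<^esub> b)"
    and single: "\<And>g a w. g \<in> carrier G \<Longrightarrow> P (word.single g (monomial a w))"
  shows "P b"
proof -
  have P: "P (word.single g f)" if "f \<in> carrier word_algebra" and g: "g \<in> carrier G" for f g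
    using that(1)
  proof (induction rule: word_algebra_induct)
    case (add f h)
    have "word.single g (f \<oplus>\<^bsub>word_algebra\<^esub> h) = word.single g f \<oplus>\<^bsub>W\<^esub> word.single g h"
      using add by (intro word.smash_eqI) (auto simp: word.single_closed word.single_apply word.add_apply)
    with add show ?case by (simp add: assms(2) word.single_closed)
  qed (rule single[OF g])
  have "word.single \<one> (monomial 0 []) = \<zero>\<^bsub>W\<^esub>"
    by (rule W_eqI) (auto simp: word.single_closed monomial_closed W_single_apply W_zero_apply, simp add: monomial_def)
  then have zero: "P \<zero>\<^bsub>W\<^esub>" using single[of \<one> 0 "[]"] by simp
  have "P c" if "c \<in> carrier W" "\<And>g. g \<in> carrier G \<Longrightarrow> c g \<in> carrier word_algebra" for c
    using that(1) by (induction rule: word.smash_induct) (use zero add P that in auto)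
  with assms(1) W_apply_closed show ?thesis by blast
qed

definition pairings :: "('g \<Rightarrow> 'v list \<Rightarrow> complex) \<Rightarrow> ('g \<Rightarrow> 'v list \<Rightarrow> complex) \<Rightarrow> complex" where
  "pairings \<Lambda> b = (\<Sum>g\<in>carrier G. pairing (\<Lambda> g) (b g))"

lemma pairings_add:
  "a \<in> carrier W \<Longrightarrow> b \<in> carrier W \<Longrightarrow> pairings \<Lambda> (a \<oplus>\<^bsub>W\<^esub> b) = pairings \<Lambda> a + pairings \<Lambda> b"
  by (simp add: pairings_def word.add_apply pairing_add W_apply_closed sum.distrib)

lemma pairings_minus:
  assumes "a \<in> carrier W" "b \<in> carrier W"
  shows "pairings \<Lambda> (a \<ominus>\<^bsub>W\<^esub> b) = pairings \<Lambda> a - pairings \<Lambda> b"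
proof -
  have "a \<ominus>\<^bsub>W\<^esub> b \<oplus>\<^bsub>W\<^esub> b = a"
    using assms by (simp add: a_minus_def W.a_assoc W.l_neg)
  then show ?thesis
    using pairings_add[of "a \<ominus>\<^bsub>W\<^esub> b" b \<Lambda>] assms by simp
qed

lemma pairings_zero: "pairings \<Lambda> \<zero>\<^bsub>W\<^esub> = 0"
  by (simp add: pairings_def word.zero_smash pairing_zero)

lemma pairings_single: "g \<in> carrier G \<Longrightarrow> pairings \<Lambda> (word.single g f) = pairing (\<Lambda> g) f"
proof -
  assume g: "g \<in> carrier G"
  have "pairings \<Lambda> (word.single g f) = (\<Sum>k\<in>carrier G. if k = g then pairing (\<Lambda> g) f else 0)"
    unfolding pairings_def by (intro sum.cong refl) (auto simp: word.single_apply pairing_zero)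
  then show ?thesis using g finite_G by simp
qed

lemma W_distrib_minus:
  assumes "a \<in> carrier W" "b \<in> carrier W" "c \<in> carrier W"
  shows "(a \<ominus>\<^bsub>W\<^esub> b) \<otimes>\<^bsub>W\<^esub> c = a \<otimes>\<^bsub>W\<^esub> c \<ominus>\<^bsub>W\<^esub> b \<otimes>\<^bsub>W\<^esub> c"
    and "c \<otimes>\<^bsub>W\<^esub> (a \<ominus>\<^bsub>W\<^esub> b) = c \<otimes>\<^bsub>W\<^esub> a \<ominus>\<^bsub>W\<^esub> c \<otimes>\<^bsub>W\<^esub> b"
  using assms by (simp_all add: a_minus_def W.l_distr W.r_distr W.l_minus W.r_minus)

text \<open>Between \<open>u g\<close> and \<open>v h\<close>, all group elements are moved to the
  right: \<open>x\<close>, \<open>y\<close> become \<open>g x\<close>, \<open>g y\<close>, and a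
  term \<open>k\<close> of \<open>\<kappa>(x,y)\<close> ends up in the component
  \<open>g k h\<close>. Equivariance turns the coefficients into those of
  \<open>\<kappa> (\<rho> g x) (\<rho> g y)\<close>, so that \<open>respects_kappa\<close>
  applies.\<close>

lemma pairings_relation:
  assumes rk: "\<And>k. respects_kappa \<Lambda> k"
    and g: "g \<in> carrier G" and h: "h \<in> carrier G"
  shows "pairings \<Lambda> (word.single g (monomial a u) \<otimes>\<^bsub>W\<^esub> relation x y \<otimes>\<^bsub>W\<^esub> word.single h (monomial b v)) = 0"
proof -
  let ?L = "word.single g (monomial a u)" and ?R = "word.single h (monomial b v)"
  let ?K = "group_alg (\<kappa> x y)"
  have L: "?L \<in> carrier W" and R: "?R \<in> carrier W"
    by (simp_all add: word.single_closed monomial_closed)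
  have vv: "?L \<otimes>\<^bsub>W\<^esub> (vec x \<otimes>\<^bsub>W\<^esub> vec y) \<otimes>\<^bsub>W\<^esub> ?R
      = word.single (g \<otimes> h) (monomial (a * b) (u @ \<rho> g x # \<rho> g y # map (\<rho> g) v))" for x y
    using g h unfolding vec_mult
    by (simp add: single_mult_single monomial_closed word_act_monomial monomial_mult word_act_closed)
  have K: "(?L \<otimes>\<^bsub>W\<^esub> ?K \<otimes>\<^bsub>W\<^esub> ?R) k
      = monomial (a * b * \<kappa> x y (inv g \<otimes> (k \<otimes> inv h))) (u @ map (\<rho> (k \<otimes> inv h)) v)"
    if k: "k \<in> carrier G" for k
  proof -
    have "(?L \<otimes>\<^bsub>W\<^esub> ?K) (k \<otimes> inv h) = monomial (a * \<kappa> x y (inv g \<otimes> (k \<otimes> inv h))) u"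
      using g h k
      by (simp add: word.single_mult_apply monomial_closed group_alg_closed group_alg_apply
          word_act_monomial monomial_mult)
    then show ?thesis
      using g h k L
      by (simp add: word.mult_single_apply monomial_closed group_alg_closed word_act_monomial monomial_mult ac_simps)
  qed
  have "pairings \<Lambda> (?L \<otimes>\<^bsub>W\<^esub> ?K \<otimes>\<^bsub>W\<^esub> ?R)
      = (\<Sum>k\<in>carrier G. a * b * \<kappa> x y (inv g \<otimes> (k \<otimes> inv h)) * \<Lambda> k (u @ map (\<rho> (k \<otimes> inv h)) v))"
    unfolding pairings_def by (intro sum.cong refl) (simp add: K pairing_monomial)
  also have "\<dots> = (\<Sum>j\<in>carrier G. a * b * (\<kappa> (\<rho> g x) (\<rho> g y) j * \<Lambda> (j \<otimes> (g \<otimes> h)) (u @ map (\<rho> j) (map (\<rho> g) v))))"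
  \<comment> \<open>Here \<open>k\<close> is the component of the product, and
    \<open>j = k h^-1 g^-1\<close> satisfies \<open>g^-1 j g = g^-1 k h^-1\<close>.\<close>
  proof (rule sum.reindex_bij_witness[where i = "\<lambda>j. j \<otimes> (g \<otimes> h)" and j = "\<lambda>k. k \<otimes> inv h \<otimes> inv g"])
    fix k assume k: "k \<in> carrier G"
    show 1: "k \<otimes> inv h \<otimes> inv g \<otimes> (g \<otimes> h) = k"
      using g h k by (metis G.inv_closed G.inv_mult_group G.l_inv G.m_assoc G.m_closed G.r_one)
    have 2: "k \<otimes> inv h \<otimes> inv g \<otimes> g = k \<otimes> inv h"
      using g h k by (simp add: G.m_assoc)
    have "\<rho> (k \<otimes> inv h \<otimes> inv g) \<circ> \<rho> g = \<rho> (k \<otimes> inv h)"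
      using g h k by (auto simp: act_mult act_inv_cancel)
    moreover have "\<kappa> (\<rho> g x) (\<rho> g y) (k \<otimes> inv h \<otimes> inv g) = \<kappa> x y (inv g \<otimes> (k \<otimes> inv h))"
      using g h k 2 by (simp add: kappa_act G.m_assoc)
    ultimately show "a * b * (\<kappa> (\<rho> g x) (\<rho> g y) (k \<otimes> inv h \<otimes> inv g) *
          \<Lambda> (k \<otimes> inv h \<otimes> inv g \<otimes> (g \<otimes> h)) (u @ map (\<rho> (k \<otimes> inv h \<otimes> inv g)) (map (\<rho> g) v)))
       = a * b * \<kappa> x y (inv g \<otimes> (k \<otimes> inv h)) * \<Lambda> k (u @ map (\<rho> (k \<otimes> inv h)) v)"
      unfolding 1 by simp
  next
    fix j assume j: "j \<in> carrier G"
    show "j \<otimes> (g \<otimes> h) \<otimes> inv h \<otimes> inv g = j"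
      using g h j by (metis G.inv_closed G.inv_mult_group G.m_assoc G.m_closed G.r_inv G.r_one)
  qed (use g h in auto)
  also have "\<dots> = a * b * (\<Lambda> (g \<otimes> h) (u @ \<rho> g x # \<rho> g y # map (\<rho> g) v) - \<Lambda> (g \<otimes> h) (u @ \<rho> g y # \<rho> g x # map (\<rho> g) v))"
    using rk[of "length u + length v + 2"] g h unfolding respects_kappa_def
    by (simp add: sum_distrib_left[symmetric])
  finally have EK: "pairings \<Lambda> (?L \<otimes>\<^bsub>W\<^esub> ?K \<otimes>\<^bsub>W\<^esub> ?R) = \<dots>" .
  have "pairings \<Lambda> (?L \<otimes>\<^bsub>W\<^esub> relation x y \<otimes>\<^bsub>W\<^esub> ?R)
      = pairings \<Lambda> (?L \<otimes>\<^bsub>W\<^esub> (vec x \<otimes>\<^bsub>W\<^esub> vec y) \<otimes>\<^bsub>W\<^esub> ?R)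
      - pairings \<Lambda> (?L \<otimes>\<^bsub>W\<^esub> (vec y \<otimes>\<^bsub>W\<^esub> vec x) \<otimes>\<^bsub>W\<^esub> ?R) - pairings \<Lambda> (?L \<otimes>\<^bsub>W\<^esub> ?K \<otimes>\<^bsub>W\<^esub> ?R)"
    unfolding relation_def using L R
    by (simp add: W_distrib_minus pairings_minus vec_closed group_alg_closed)
  also have "\<dots> = 0"
    unfolding EK vv pairings_single[OF G.m_closed[OF g h]] pairing_monomial
    by (simp add: right_diff_distrib)
  finally show ?thesis .
qed

text \<open>The largest two-sided ideal killed by \<open>pairings \<Lambda>\<close> contains the
  relations because \<Lambda> respects \<kappa>, and the kernel of \<open>to_TS\<close> because
  \<Lambda> is multilinear; so it contains the kernel of \<open>to_H\<close>.\<close>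

lemma pairings_to_H_kernel:
  assumes ml: "multilin_family \<Lambda>" and rk: "\<And>k. respects_kappa \<Lambda> k"
    and a: "a \<in> carrier W" "to_H a = \<zero>\<^bsub>H\<^esub>"
  shows "pairings \<Lambda> a = 0"
proof -
  define Z where "Z = {b \<in> carrier W. \<forall>c\<in>carrier W. \<forall>e\<in>carrier W. pairings \<Lambda> (c \<otimes>\<^bsub>W\<^esub> b \<otimes>\<^bsub>W\<^esub> e) = 0}"
  have Z: "ideal Z W"
  proof (rule ideal_of_closed[OF W.ring_axioms])
    fix b x assume b: "b \<in> Z" and x: "x \<in> carrier W"
    then have bW: "b \<in> carrier W" by (simp add: Z_def)
    have "c \<otimes>\<^bsub>W\<^esub> (x \<otimes>\<^bsub>W\<^esub> b) \<otimes>\<^bsub>W\<^esub> e = (c \<otimes>\<^bsub>W\<^esub> x) \<otimes>\<^bsub>W\<^esub> b \<otimes>\<^bsub>W\<^esub> e"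
      "c \<otimes>\<^bsub>W\<^esub> (b \<otimes>\<^bsub>W\<^esub> x) \<otimes>\<^bsub>W\<^esub> e = c \<otimes>\<^bsub>W\<^esub> b \<otimes>\<^bsub>W\<^esub> (x \<otimes>\<^bsub>W\<^esub> e)"
      if "c \<in> carrier W" "e \<in> carrier W" for c e
      using that bW x by (simp_all add: W.m_assoc)
    with b x bW show "x \<otimes>\<^bsub>W\<^esub> b \<in> Z" "b \<otimes>\<^bsub>W\<^esub> x \<in> Z" by (auto simp: Z_def)
  qed (auto simp: Z_def pairings_zero W.l_distr W.r_distr pairings_add)
  have "relation x y \<in> Z" for x y
  proof -
    have "pairings \<Lambda> (c \<otimes>\<^bsub>W\<^esub> relation x y \<otimes>\<^bsub>W\<^esub> e) = 0" if "c \<in> carrier W" and e: "e \<in> carrier W" for c e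
      using that(1)
    proof (induction rule: W_induct)
      case (single g a w)
      from e show ?case
        by (induction rule: W_induct)
          (use single in \<open>auto simp: W.r_distr pairings_add relation_closed word.single_closed monomial_closed
              pairings_relation[OF rk]\<close>)
    qed (use e in \<open>auto simp: W.l_distr pairings_add relation_closed\<close>)
    then show ?thesis by (simp add: Z_def relation_closed)
  qed
  moreover have "b \<in> Z" if b: "b \<in> carrier W" "\<And>g. g \<in> carrier G \<Longrightarrow> b g \<in> tensor_ideal scale" for b
  proof -
    have b0: "to_TS b = \<zero>\<^bsub>TS\<^esub>"
      unfolding to_TS_def tensor.zero_smash using b
      by (intro restrict_ext) (simp add: tensor_class_eq_0_iff W_apply_closed)
    have "pairings \<Lambda> (c \<otimes>\<^bsub>W\<^esub> b \<otimes>\<^bsub>W\<^esub> e) = 0" if ce: "c \<in> carrier W" "e \<in> carrier W" for c e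
    proof -
      have cW: "c \<otimes>\<^bsub>W\<^esub> b \<otimes>\<^bsub>W\<^esub> e \<in> carrier W" using ce b by simp
      have "to_TS (c \<otimes>\<^bsub>W\<^esub> b \<otimes>\<^bsub>W\<^esub> e) = \<zero>\<^bsub>TS\<^esub>" using ce b by (simp add: b0)
      then have 0: "to_TS (c \<otimes>\<^bsub>W\<^esub> b \<otimes>\<^bsub>W\<^esub> e) g = \<zero>\<^bsub>TS\<^esub> g" for g by (simp only:)
      have "tensor_class scale ((c \<otimes>\<^bsub>W\<^esub> b \<otimes>\<^bsub>W\<^esub> e) g) = \<zero>\<^bsub>tensor_algebra scale\<^esub>"
        if g: "g \<in> carrier G" for g
      proof -
        have "to_TS (c \<otimes>\<^bsub>W\<^esub> b \<otimes>\<^bsub>W\<^esub> e) g = tensor_class scale ((c \<otimes>\<^bsub>W\<^esub> b \<otimes>\<^bsub>W\<^esub> e) g)"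
          unfolding to_TS_def using g by simp
        moreover have "\<zero>\<^bsub>TS\<^esub> g = \<zero>\<^bsub>tensor_algebra scale\<^esub>"
          using g by (simp add: tensor.zero_smash)
        ultimately show ?thesis using that by (simp only: 0)
      qed
      then show ?thesis
        unfolding pairings_def using ml W_apply_closed[OF cW]
        by (intro sum.neutral ballI pairing_tensor_class_0[where scale = scale]) (auto simp: multilin_family_def)
    qed
    then show ?thesis using b by (simp add: Z_def)
  qed
  ultimately have "a \<in> Z" using to_H_eq_0_mem[OF Z _ _ a] by blast
  then have "pairings \<Lambda> (\<one>\<^bsub>W\<^esub> \<otimes>\<^bsub>W\<^esub> a \<otimes>\<^bsub>W\<^esub> \<one>\<^bsub>W\<^esub>) = 0" unfolding Z_def by blast
  then show ?thesis using a by simp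
qed

theorem jacobi_imp_natural_hom_iso:
  assumes jacobi
  shows "\<xi> \<in> ring_iso SS GR"
  unfolding natural_hom_iso_iff
proof (intro ballI impI, rule ccontr)
  fix a assume a: "a \<in> carrier W" and FB: "\<forall>n. to_H (hom_part n a) \<in> FB n" and nz: "to_SS a \<noteq> \<zero>\<^bsub>SS\<^esub>"
  have "\<exists>g\<in>carrier G. sym_class scale (a g) \<noteq> \<zero>\<^bsub>sym_algebra scale\<^esub>"
  proof (rule ccontr)
    assume "\<not> ?thesis"
    then have "to_SS a = \<zero>\<^bsub>SS\<^esub>"
      unfolding to_SS_def sym.zero_smash by (intro restrict_ext) auto
    with nz show False ..
  qed
  then obtain g0 where g0: "g0 \<in> carrier G" "sym_class scale (a g0) \<noteq> \<zero>\<^bsub>sym_algebra scale\<^esub>" by blast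
  obtain \<Lambda>0 where \<Lambda>0: "multilin scale \<Lambda>0" "\<And>u x y v. \<Lambda>0 (u @ x # y # v) = \<Lambda>0 (u @ y # x # v)"
    "pairing \<Lambda>0 (a g0) \<noteq> 0"
    using sym_class_separated[OF W_apply_closed[OF a g0(1)] g0(2)] by blast
  obtain n where n: "pairing \<Lambda>0 (homogeneous_part n (a g0)) \<noteq> 0"
    using pairing_homogeneous_parts[OF W_apply_closed[OF a g0(1)]] \<Lambda>0(3) by blast
  \<comment> \<open>Concentrated in one group component and one degree. At length \<open>n\<close>
    the commutators vanish by symmetry, and the words of length \<open>n - 2\<close> on the right
    side have value 0, so the relations hold up to length \<open>n\<close>.\<close>
  define \<Lambda>1 where "\<Lambda>1 g w = (if g = g0 \<and> length w = n then \<Lambda>0 w else 0)" for g w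
  have "multilin_family \<Lambda>1"
    using \<Lambda>0(1) by (auto simp: multilin_family_def multilin_def \<Lambda>1_def intro!: lin_fun_if lin_fun_0)
  moreover have "respects_kappa \<Lambda>1 k" if "k \<le> n" for k
    using that \<Lambda>0(2) by (auto simp: respects_kappa_def \<Lambda>1_def intro!: sum.neutral)
  ultimately obtain \<Lambda> where \<Lambda>: "multilin_family \<Lambda>" "\<And>k. respects_kappa \<Lambda> k"
      "\<And>g w. length w \<le> n \<Longrightarrow> \<Lambda> g w = \<Lambda>1 g w"
    using functional_extension[OF assms, of \<Lambda>1 n] by metis
  \<comment> \<open>The degree \<open>n\<close> part and the shorter \<open>b\<close> agree in
    \<open>H\<close>, so the extended functional cannot distinguish them; but it vanishes on words
    shorter than \<open>n\<close>.\<close>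
  obtain b where b: "b \<in> below n" "to_H (hom_part n a) = to_H b"
    using FB by (auto simp: filt_below_eq)
  have "pairings \<Lambda> (hom_part n a \<ominus>\<^bsub>W\<^esub> b) = 0"
    using a b below_closed[OF b(1)]
    by (intro pairings_to_H_kernel[OF \<Lambda>(1,2)]) (auto simp: hom_part_closed a_minus_def to_H.S.r_neg)
  then have eq: "pairings \<Lambda> (hom_part n a) = pairings \<Lambda> b"
    using a below_closed[OF b(1)] by (simp add: pairings_minus hom_part_closed)
  have "pairing (\<Lambda> g) (b g) = 0" if "g \<in> carrier G" for g
    unfolding pairing_def using b(1) that
    by (intro sum.neutral) (auto simp: below_def \<Lambda>(3) \<Lambda>1_def less_imp_le)
  then have "pairings \<Lambda> b = 0" by (simp add: pairings_def)
  moreover have "pairings \<Lambda> (hom_part n a) = pairing \<Lambda>0 (homogeneous_part n (a g0))"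
  proof -
    have "pairing (\<Lambda> g) (hom_part n a g) = (if g = g0 then pairing \<Lambda>0 (homogeneous_part n (a g0)) else 0)"
      if "g \<in> carrier G" for g
      using that unfolding pairing_def
      by (auto simp: hom_part_def homogeneous_part_def \<Lambda>(3) \<Lambda>1_def intro!: sum.cong sum.neutral)
    then show ?thesis using g0(1) finite_G by (simp add: pairings_def)
  qed
  ultimately show False using n eq by simp
qed

text \<open>The Jacobi identity for the commutator in \<open>H\<close>, read in the degree one part of the graded ring.\<close>

lemma natural_hom_iso_imp_relation:
  assumes iso: "\<xi> \<in> ring_iso SS GR" and h: "h \<in> carrier G"
  shows "sym_class scale (\<lambda>w. \<kappa> x y h * (monomial 1 [\<rho> h z] w - monomial 1 [z] w)
      + \<kappa> y z h * (monomial 1 [\<rho> h x] w - monomial 1 [x] w)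
      + \<kappa> z x h * (monomial 1 [\<rho> h y] w - monomial 1 [y] w)) = \<zero>\<^bsub>sym_algebra scale\<^esub>"
proof -
  define c where "c x y = vec x \<otimes>\<^bsub>W\<^esub> vec y \<ominus>\<^bsub>W\<^esub> vec y \<otimes>\<^bsub>W\<^esub> vec x" for x y
  define K where "K x y = group_alg (\<kappa> x y)" for x y
  define br where "br b z = b \<otimes>\<^bsub>W\<^esub> vec z \<ominus>\<^bsub>W\<^esub> vec z \<otimes>\<^bsub>W\<^esub> b" for b z
  have cW: "c x y \<in> carrier W" and KW: "K x y \<in> carrier W" for x y
    by (simp_all add: c_def K_def vec_closed group_alg_closed)
  have brW: "b \<in> carrier W \<Longrightarrow> br b z \<in> carrier W" for b z
    by (simp add: br_def vec_closed)
  have vvv: "vec x \<otimes>\<^bsub>W\<^esub> vec y \<otimes>\<^bsub>W\<^esub> vec z = word.single \<one> (monomial 1 [x, y, z])"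
    "vec z \<otimes>\<^bsub>W\<^esub> (vec x \<otimes>\<^bsub>W\<^esub> vec y) = word.single \<one> (monomial 1 [z, x, y])" for x y z
    unfolding vec_mult unfolding vec_def
    by (simp_all add: single_mult_single monomial_closed word_act_monomial act_one monomial_mult)
  have brc: "br (c x y) z = (word.single \<one> (monomial 1 [x, y, z]) \<ominus>\<^bsub>W\<^esub> word.single \<one> (monomial 1 [y, x, z]))
      \<ominus>\<^bsub>W\<^esub> (word.single \<one> (monomial 1 [z, x, y]) \<ominus>\<^bsub>W\<^esub> word.single \<one> (monomial 1 [z, y, x]))" for x y z
    unfolding br_def c_def by (simp add: W_distrib_minus vec_closed vvv)
  \<comment> \<open>The Jacobi identity of an associative ring: the twelve words of length three
    cancel.\<close>
  have "br (c x y) z \<oplus>\<^bsub>W\<^esub> br (c y z) x \<oplus>\<^bsub>W\<^esub> br (c z x) y = \<zero>\<^bsub>W\<^esub>"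
    by (rule W_eqI) (simp add: brW cW, simp,
        simp add: brc W_add_apply W_minus_apply W_single_apply W_zero_apply word.single_closed monomial_closed)
  moreover have brH: "to_H (br (K x y) z) = to_H (br (c x y) z)" for x y z
  proof -
    have "to_H (br b z) = to_H b \<otimes>\<^bsub>H\<^esub> to_H (vec z) \<ominus>\<^bsub>H\<^esub> to_H (vec z) \<otimes>\<^bsub>H\<^esub> to_H b" if "b \<in> carrier W" for b
      using that by (simp add: br_def a_minus_def vec_closed)
    then show ?thesis
      using to_H_group_alg[of x y] cW KW by (simp add: c_def K_def)
  qed
  \<comment> \<open>Replacing each inner commutator by \<kappa> keeps the image in \<open>H\<close>
    but leaves only words of length one.\<close>
  define a where "a = br (K x y) z \<oplus>\<^bsub>W\<^esub> br (K y z) x \<oplus>\<^bsub>W\<^esub> br (K z x) y"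
  have aW: "a \<in> carrier W" by (simp add: a_def brW KW)
  have "to_H a = to_H (br (c x y) z \<oplus>\<^bsub>W\<^esub> br (c y z) x \<oplus>\<^bsub>W\<^esub> br (c z x) y)"
    using brW cW KW by (simp add: a_def brH)
  ultimately have a0: "to_H a = \<zero>\<^bsub>H\<^esub>" by simp
  have brK: "br (K x y) z k w = \<kappa> x y k * (monomial 1 [\<rho> k z] w - monomial 1 [z] w)"
    if k: "k \<in> carrier G" for x y z k w
  proof -
    have "(K x y \<otimes>\<^bsub>W\<^esub> vec z) k = monomial (\<kappa> x y k) [\<rho> k z]"
      using k KW unfolding vec_def
      by (simp add: word.mult_single_apply monomial_closed word_act_monomial K_def group_alg_apply monomial_mult)
    moreover have "(vec z \<otimes>\<^bsub>W\<^esub> K x y) k = monomial (\<kappa> x y k) [z]"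
      using k KW unfolding vec_def
      by (simp add: word.single_mult_apply monomial_closed word_act_monomial K_def group_alg_apply monomial_mult)
    ultimately show ?thesis
      using k KW by (simp add: br_def W_minus_apply vec_closed) (simp add: monomial_def)
  qed
  have ak: "a k = (\<lambda>w. \<kappa> x y k * (monomial 1 [\<rho> k z] w - monomial 1 [z] w)
      + \<kappa> y z k * (monomial 1 [\<rho> k x] w - monomial 1 [x] w)
      + \<kappa> z x k * (monomial 1 [\<rho> k y] w - monomial 1 [y] w))" if "k \<in> carrier G" for k
    using that by (auto simp: a_def W_add_apply brK)
  have "length w = 1" if "a k w \<noteq> 0" "k \<in> carrier G" for k w
    using that(1) unfolding ak[OF that(2)] by (auto simp: monomial_def split: if_splits)
  then have "hom_part n a = (if n = 1 then a else \<zero>\<^bsub>W\<^esub>)" for n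
    using aW by (intro W_eqI) (auto simp: hom_part_closed hom_part_apply W_zero_apply)
  \<comment> \<open>The element \<open>a\<close> is its own part of degree 1 and is zero in
    \<open>H\<close>, so each of its parts lies in \<open>FB n\<close> and injectivity of \<xi>
    applies.\<close>
  then have "to_H (hom_part n a) \<in> FB n" for n
    by (simp add: a0 FB_zero)
  then have "to_SS a = \<zero>\<^bsub>SS\<^esub>"
    using iso aW unfolding natural_hom_iso_iff by blast
  then have "to_SS a h = \<zero>\<^bsub>SS\<^esub> h" by (simp only:)
  then have "sym_class scale (a h) = \<zero>\<^bsub>sym_algebra scale\<^esub>"
    using h unfolding to_SS_def sym.zero_smash by simp
  then show ?thesis unfolding ak[OF h] .
qed

end

section \<open>From injectivity in degree one to the Jacobi identity\<close>

context symplectic_setting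
begin

text \<open>The degree one part of the symmetric algebra is tested by the functionals
  \<open>\<omega>(-, v)\<close>, which separate vectors by nondegeneracy.\<close>

theorem natural_hom_iso_imp_jacobi:
  assumes iso: "\<xi> \<in> ring_iso SS GR"
  shows jacobi
  unfolding jacobi_def
proof (intro ballI allI, rule om_nondeg)
  fix h x y z v assume h: "h \<in> carrier G"
  define f where "f = (\<lambda>w. \<kappa> x y h * (monomial 1 [\<rho> h z] w - monomial 1 [z] w)
      + \<kappa> y z h * (monomial 1 [\<rho> h x] w - monomial 1 [x] w)
      + \<kappa> z x h * (monomial 1 [\<rho> h y] w - monomial 1 [y] w))"
  \<comment> \<open>The value 0 on all words of length other than 1 makes the functional symmetric,
    since a swap takes two letters.\<close>
  define \<Lambda> where "\<Lambda> w = (if length w = 1 then \<omega> (hd w) v else 0)" for w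
  have "multilin scale \<Lambda>"
    unfolding multilin_def \<Lambda>_def by (intro allI lin_fun_if lin_fun_0)
      (auto simp: lin_fun_def om_add_left om_scale_left)
  let ?A = "{[\<rho> h z], [z], [\<rho> h x], [x], [\<rho> h y], [y]}"
  have supp: "{w. f w \<noteq> 0} \<subseteq> ?A"
    by (rule subsetI, rule ccontr) (simp add: f_def monomial_def)
  then have fW: "f \<in> carrier word_algebra"
    by (simp add: carrier_word_algebra finite_subset)
  have "pairing \<Lambda> f = 0"
    using natural_hom_iso_imp_relation[OF iso h, of x y z] \<open>multilin scale \<Lambda>\<close> fW unfolding f_def[symmetric]
    by (intro pairing_sym_class_0[where scale = scale]) (auto simp: \<Lambda>_def)
  \<comment> \<open>Some of the six words may coincide, so each monomial is evaluated separately
    over the set they form.\<close>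
  have m: "(\<Sum>w\<in>?A. c * monomial 1 [u] w * \<Lambda> w) = c * \<omega> u v" if "[u] \<in> ?A" for c u
  proof -
    have "(\<Sum>w\<in>?A. c * monomial 1 [u] w * \<Lambda> w) = (\<Sum>w\<in>?A. if w = [u] then c * \<omega> u v else 0)"
      by (intro sum.cong refl) (auto simp: monomial_def \<Lambda>_def)
    also have "\<dots> = c * \<omega> u v" using that by (subst sum.delta) auto
    finally show ?thesis .
  qed
  have "pairing \<Lambda> f = (\<Sum>w\<in>?A. f w * \<Lambda> w)"
    by (rule pairing_eq_sum[OF _ supp]) simp
  also have "\<dots> = (\<Sum>w\<in>?A. \<kappa> x y h * monomial 1 [\<rho> h z] w * \<Lambda> w) - (\<Sum>w\<in>?A. \<kappa> x y h * monomial 1 [z] w * \<Lambda> w)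
     + ((\<Sum>w\<in>?A. \<kappa> y z h * monomial 1 [\<rho> h x] w * \<Lambda> w) - (\<Sum>w\<in>?A. \<kappa> y z h * monomial 1 [x] w * \<Lambda> w))
     + ((\<Sum>w\<in>?A. \<kappa> z x h * monomial 1 [\<rho> h y] w * \<Lambda> w) - (\<Sum>w\<in>?A. \<kappa> z x h * monomial 1 [y] w * \<Lambda> w))"
    unfolding sum.distrib[symmetric] sum_subtractf[symmetric]
    by (intro sum.cong refl) (simp add: f_def algebra_simps)
  also have "\<dots> = \<omega> (scale (\<kappa> x y h) (\<rho> h z - z) + scale (\<kappa> y z h) (\<rho> h x - x) + scale (\<kappa> z x h) (\<rho> h y - y)) v"
    by (simp only: m insert_iff simp_thms) (simp add: om_add_left om_scale_left om_diff_left algebra_simps)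
  finally show "\<omega> (scale (\<kappa> x y h) (\<rho> h z - z) + scale (\<kappa> y z h) (\<rho> h x - x) + scale (\<kappa> z x h) (\<rho> h y - y)) v = 0"
    using \<open>pairing \<Lambda> f = 0\<close> by simp
qed

end

theorem theorem8p3:
  fixes scale :: "complex \<Rightarrow> 'v::ab_group_add \<Rightarrow> 'v"
    and \<omega> :: "'v \<Rightarrow> 'v \<Rightarrow> complex"
    and G :: "('g, 'm) monoid_scheme"
    and \<rho> :: "'g \<Rightarrow> 'v \<Rightarrow> 'v"
    and \<kappa> :: "'v \<Rightarrow> 'v \<Rightarrow> 'g \<Rightarrow> complex"
  assumes "\<exists>B. finite_dimensional_vector_space scale B"
    and "symplectic_form scale \<omega>"
    and "group G" and "finite (carrier G)"
    and "faithful_action G (UNIV :: 'v set) \<rho>"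
    and "\<And>g. g \<in> carrier G \<Longrightarrow> Vector_Spaces.linear scale scale (\<rho> g)"
    and "invariant_form G \<rho> \<omega>"
    and "{B. skew_form scale B \<and> invariant_form G \<rho> B} = {\<lambda>x y. a * \<omega> x y | a. True}"
    and "equivariant_wedge_map scale G \<rho> \<kappa>"
  shows "natural_hom scale G \<rho> \<kappa> \<in> ring_iso (sym_smash scale G \<rho>) (gr_kappa scale G \<rho> \<kappa>) \<longleftrightarrow>
    (\<exists>(t :: complex) (c :: 'g \<Rightarrow> complex).
       (\<forall>g\<in>carrier G. \<forall>s\<in>symplectic_reflections scale G \<rho>.
          c (g \<otimes>\<^bsub>G\<^esub> s \<otimes>\<^bsub>G\<^esub> inv\<^bsub>G\<^esub> g) = c s) \<and>
       (\<forall>x y. \<kappa> x y = (\<lambda>h. t * \<omega> x y * group_elt \<one>\<^bsub>G\<^esub> h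
          - 2 * (\<Sum>s\<in>symplectic_reflections scale G \<rho>.
                   c s * refl_form \<rho> \<omega> s x y * group_elt s h))))"
proof -
  interpret symplectic_setting scale G \<rho> \<kappa> \<omega>
  proof (intro symplectic_setting.intro wedge_setting.intro wedge_setting_axioms.intro symplectic_setting_axioms.intro)
    show "vector_space scale"
      using assms(1) finite_dimensional_vector_space.axioms(1) by blast
    show "group_action G UNIV \<rho>" "inj_on \<rho> (carrier G)"
      using assms(5) by (auto simp: faithful_action_def faithful_action_axioms_def)
    show "\<exists>a. B = (\<lambda>x y. a * \<omega> x y)" if "skew_form scale B" "invariant_form G \<rho> B" for B
      using that assms(8) by blast
  qed (use assms in auto)
  show ?thesis
    unfolding jacobi_iff_kappa_form[symmetric]
    using natural_hom_iso_imp_jacobi jacobi_imp_natural_hom_iso by blast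
qed

end
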